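(* $F_v(J_5,J_5;5)\le 36$.
   Context: All graphs are finite and simple. $J_n$ denotes $K_n$ with one edge removed. "A graph $F$ contains $H$" means $F$ has a (not necessarily induced) subgraph isomorphic to $H$. $G\rightarrow(H_1,H_2)^v$ means: for every partition $V(G)=X_1\cup X_2$ there is $i$ such that the subgraph induced by $X_i$ contains $H_i$. $F_v(H_1,H_2;k)$ is the minimum number of vertices of a $K_k$-free graph $G$ with $G\rightarrow(H_1,H_2)^v$. *)

theory Defs
  imports Main
begin

type_synonym graph = "nat set \<times> nat set set"

definition simple_graph :: "graph \<Rightarrow> bool" where
  "simple_graph G \<longleftrightarrow> finite (fst G) \<and> (\<forall>e\<in>snd G. e \<subseteq> fst G \<and> card e = 2)"

text \<open>F contains H: H is isomorphic to a (not necessarily induced) subgraph of F.\<close>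
definition contains :: "graph \<Rightarrow> graph \<Rightarrow> bool" where
  "contains F H \<longleftrightarrow> (\<exists>f. inj_on f (fst H) \<and> f ` fst H \<subseteq> fst F \<and>
      (\<forall>e\<in>snd H. f ` e \<in> snd F))"

definition induced :: "graph \<Rightarrow> nat set \<Rightarrow> graph" where
  "induced G X = (X, {e\<in>snd G. e \<subseteq> X})"

definition complete :: "nat \<Rightarrow> graph" where
  "complete n = ({0..<n}, {e. e \<subseteq> {0..<n} \<and> card e = 2})"

definition J :: "nat \<Rightarrow> graph" where
  "J n = ({0..<n}, {e. e \<subseteq> {0..<n} \<and> card e = 2} - {{0, 1}})"

definition vertex_arrows :: "graph \<Rightarrow> graph \<Rightarrow> graph \<Rightarrow> bool" where
  "vertex_arrows G H1 H2 \<longleftrightarrow> (\<forall>X1 X2. X1 \<union> X2 = fst G \<and> X1 \<inter> X2 = {} \<longrightarrow>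
      contains (induced G X1) H1 \<or> contains (induced G X2) H2)"

definition Fv :: "graph \<Rightarrow> graph \<Rightarrow> nat \<Rightarrow> nat" where
  "Fv H1 H2 k = (LEAST n. \<exists>G. simple_graph G \<and> card (fst G) = n \<and>
      \<not> contains G (complete k) \<and> vertex_arrows G H1 H2)"

end

theory Submission
  imports Defs
begin

text \<open>The witness is the circulant graph on \<open>\<int>\<^sub>3\<^sub>6\<close> with distance set
  \<open>{1, 2, 3, 7, 8, 10, 12, 13, 15, 17, 18}\<close>. Since it is vertex-transitive, a \<open>K\<^sub>5\<close> may be
  translated so that it contains vertex 0; its other four vertices then form a \<open>K\<^sub>4\<close> among the
  neighbours of 0, and a short search over the neighbourhood shows there is none. That every
  2-colouring of the vertices contains a monochromatic \<open>J\<^sub>5\<close> is verified by a decision tree: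
  it branches on the colours of vertices one at a time, and each leaf names a \<open>J\<^sub>5\<close> already
  monochromatic under the colours fixed along its path.\<close>

definition adjacent :: "graph \<Rightarrow> nat \<Rightarrow> nat \<Rightarrow> bool" where
  "adjacent G u v \<longleftrightarrow> {u, v} \<in> snd G"

lemma adjacent_sym: "adjacent G u v \<longleftrightarrow> adjacent G v u"
  by (simp add: adjacent_def insert_commute)

lemma adjacent_vertices:
  assumes "simple_graph G" "adjacent G u v"
  shows "u \<in> fst G" "v \<in> fst G" "u \<noteq> v"
  using assms by (auto simp: simple_graph_def adjacent_def)

lemma adjacent_induced:
  "adjacent (induced G X) u v \<longleftrightarrow> adjacent G u v \<and> u \<in> X \<and> v \<in> X"
  by (auto simp: adjacent_def induced_def)

lemma simple_graph_induced:
  assumes "simple_graph G" "X \<subseteq> fst G"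
  shows "simple_graph (induced G X)"
  using assms finite_subset by (auto simp: simple_graph_def induced_def)

lemma contains_complete_clique:
  assumes "contains G (complete k)"
  shows "\<exists>V \<subseteq> fst G. finite V \<and> card V = k \<and> pairwise (adjacent G) V"
proof -
  obtain f where f: "inj_on f {0..<k}" "f ` {0..<k} \<subseteq> fst G"
    and edges: "\<forall>e\<in>{e. e \<subseteq> {0..<k} \<and> card e = 2}. f ` e \<in> snd G"
    using assms unfolding contains_def complete_def fst_conv snd_conv by blast
  have "adjacent G (f i) (f j)" if "i < k" "j < k" "f i \<noteq> f j" for i j
    using bspec[OF edges, of "{i, j}"] that by (cases "i = j") (auto simp: adjacent_def)
  then show ?thesis
    using f by (intro exI[of _ "f ` {0..<k}"]) (auto simp: card_image pairwise_def)
qed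

fun J5_copy :: "graph \<Rightarrow> nat list \<Rightarrow> bool" where
  "J5_copy G [a, b, c, d, e] \<longleftrightarrow> a \<noteq> b \<and>
     adjacent G a c \<and> adjacent G a d \<and> adjacent G a e \<and>
     adjacent G b c \<and> adjacent G b d \<and> adjacent G b e \<and>
     adjacent G c d \<and> adjacent G c e \<and> adjacent G d e"
| "J5_copy G _ \<longleftrightarrow> False"

lemma J5_copy_induced: "J5_copy (induced G X) xs \<longleftrightarrow> J5_copy G xs \<and> set xs \<subseteq> X"
  by (induction G xs rule: J5_copy.induct) (auto simp: adjacent_induced)

lemma J5_copy_vertices:
  assumes "simple_graph G" "J5_copy G xs"
  shows "set xs \<subseteq> fst G"
proof -
  obtain a b c d e where "xs = [a, b, c, d, e]"
    using assms(2) by (auto elim: J5_copy.elims)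
  then show ?thesis
    using assms(2) adjacent_vertices(1,2)[OF assms(1)] by auto
qed

lemma J5_copy_contains:
  assumes G: "simple_graph G" and copy: "J5_copy G xs"
  shows "contains G (J 5)"
proof -
  obtain a b c d e where xs: "xs = [a, b, c, d, e]"
    using copy by (auto elim: J5_copy.elims)
  define f where "f = (\<lambda>i. xs ! i)"
  have adj: "adjacent G (f i) (f j)" if "i < 5" "j < 5" "i \<noteq> j" "{i, j} \<noteq> {0, 1}" for i j
    using that copy
    by (auto simp: xs f_def less_Suc_eq numeral_eq_Suc doubleton_eq_iff adjacent_sym)
  have "f i \<noteq> f j" if "i < 5" "j < 5" "i \<noteq> j" for i j
  proof (cases "{i, j} = {0, 1}")
    case True
    then show ?thesis using copy by (auto simp: xs f_def doubleton_eq_iff)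
  next
    case False
    then show ?thesis using adj[OF that False] adjacent_vertices(3)[OF G] by blast
  qed
  then have "inj_on f {0..<5}"
    unfolding inj_on_def by (metis atLeastLessThan_iff)
  moreover have "f i \<in> fst G" if "i < 5" for i
  proof -
    have "adjacent G (f i) (f (if i = 2 then 3 else 2))"
      using adj[of i "if i = 2 then 3 else 2"] that by (auto simp: doubleton_eq_iff)
    then show ?thesis using adjacent_vertices(1)[OF G] by blast
  qed
  moreover have "f ` ed \<in> snd G" if "ed \<in> snd (J 5)" for ed
  proof -
    have ed: "ed \<subseteq> {0..<5}" "card ed = 2" "ed \<noteq> {0, 1}"
      using that by (auto simp: J_def)
    then obtain i j where "ed = {i, j}" "i \<noteq> j"
      by (auto simp: card_2_iff)
    with ed adj show ?thesis by (simp add: adjacent_def)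
  qed
  ultimately show ?thesis
    unfolding contains_def by (intro exI[of _ f]) (auto simp: J_def)
qed

text \<open>The test \<open>k = 0\<close> is an \<open>if\<close> rather than a disjunct: the simplifier does not rewrite
  inside the branches of an undecided \<open>if\<close>, so evaluation stops there instead of unfolding
  the recursion through every sublist.\<close>

fun has_clique :: "('a \<Rightarrow> 'a \<Rightarrow> bool) \<Rightarrow> nat \<Rightarrow> 'a list \<Rightarrow> bool" where
  "has_clique adj k [] \<longleftrightarrow> k = 0"
| "has_clique adj k (x # xs) \<longleftrightarrow>
     (if k = 0 then True
      else has_clique adj (k - 1) (filter (adj x) xs) \<or> has_clique adj k xs)"

lemma has_clique_if_clique:
  assumes "finite V" "card V = k" "V \<subseteq> set xs" "pairwise adj V"
  shows "has_clique adj k xs"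
  using assms
proof (induction adj k xs arbitrary: V rule: has_clique.induct)
  case (2 adj k x xs)
  show ?case
  proof (cases "x \<in> V")
    case True
    have "V - {x} \<subseteq> set (filter (adj x) xs)"
      using "2.prems" True by (auto simp: pairwise_def)
    then have "has_clique adj (k - 1) (filter (adj x) xs)"
      using "2.prems" True by (intro "2.IH"(1)[of "V - {x}"]) (auto simp: card_gt_0_iff pairwise_def)
    then show ?thesis by simp
  next
    case False
    then show ?thesis using "2.IH"(2) "2.prems" by auto
  qed
qed simp

text \<open>A split tree is a case analysis on a 2-colouring: \<open>R\<close> and \<open>B\<close> hold the vertices coloured
  so far with either colour, \<open>Branch v\<close> tries both colours for \<open>v\<close>, and a \<open>Leaf\<close> names a
  list satisfying \<open>P\<close> that is already monochromatic.\<close>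

datatype split_tree = Leaf "nat list" | Branch nat split_tree split_tree

fun certifies :: "(nat list \<Rightarrow> bool) \<Rightarrow> nat list \<Rightarrow> nat list \<Rightarrow> split_tree \<Rightarrow> bool" where
  "certifies P R B (Leaf xs) \<longleftrightarrow>
     P xs \<and> (list_all (\<lambda>v. v \<in> set R) xs \<or> list_all (\<lambda>v. v \<in> set B) xs)"
| "certifies P R B (Branch v t1 t2) \<longleftrightarrow> certifies P (v # R) B t1 \<and> certifies P R (v # B) t2"

lemma certifies_monochromatic:
  assumes "certifies P R B t" "set R \<subseteq> X" "set B \<inter> X = {}"
  shows "\<exists>xs. P xs \<and> (set xs \<subseteq> X \<or> set xs \<inter> X = {})"
  using assms
proof (induction t arbitrary: R B)
  case (Leaf xs)
  then show ?case by (auto simp: list_all_iff)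
next
  case (Branch v t1 t2)
  then show ?case by (cases "v \<in> X") auto
qed

text \<open>Swapping the two colours, the colour of one vertex \<open>v\<close> may be fixed in advance.\<close>

lemma vertex_arrows_J5_if_certifies:
  assumes G: "simple_graph G" and "v \<in> fst G" and cert: "certifies (J5_copy G) [v] [] t"
  shows "vertex_arrows G (J 5) (J 5)"
  unfolding vertex_arrows_def
proof (intro allI impI)
  fix X1 X2 assume part: "X1 \<union> X2 = fst G \<and> X1 \<inter> X2 = {}"
  have side: "\<exists>xs. J5_copy G xs \<and> (set xs \<subseteq> X \<or> set xs \<subseteq> Y)"
    if "v \<in> X" "X \<union> Y = fst G" for X Y
  proof -
    obtain xs where "J5_copy G xs" "set xs \<subseteq> X \<or> set xs \<inter> X = {}"
      using certifies_monochromatic[OF cert, of X] \<open>v \<in> X\<close> by auto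
    moreover have "set xs \<subseteq> fst G"
      using J5_copy_vertices[OF G] calculation(1) .
    ultimately show ?thesis using that(2) by blast
  qed
  obtain xs where "J5_copy G xs" "set xs \<subseteq> X1 \<or> set xs \<subseteq> X2"
    using side[of X1 X2] side[of X2 X1] part \<open>v \<in> fst G\<close> by blast
  moreover have "simple_graph (induced G X1)" "simple_graph (induced G X2)"
    using simple_graph_induced[OF G] part by blast+
  ultimately show "contains (induced G X1) (J 5) \<or> contains (induced G X2) (J 5)"
    using J5_copy_contains J5_copy_induced by blast
qed

text \<open>If \<open>D\<close> is closed under \<open>d \<mapsto> n - d\<close>, \<open>diff_graph n D\<close> is the circulant graph on
  \<open>\<int>\<^sub>n\<close> with distance set \<open>D\<close>.\<close>

definition diff_adj :: "nat set \<Rightarrow> nat \<Rightarrow> nat \<Rightarrow> bool" where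
  "diff_adj D u v \<longleftrightarrow> (if u \<le> v then v - u else u - v) \<in> D"

definition diff_graph :: "nat \<Rightarrow> nat set \<Rightarrow> graph" where
  "diff_graph n D = ({0..<n}, {{u, v} | u v. u < n \<and> v < n \<and> diff_adj D u v})"

lemma diff_adj_sym: "diff_adj D u v \<longleftrightarrow> diff_adj D v u"
  by (simp add: diff_adj_def)

lemma diff_adj_shift: "a \<le> u \<Longrightarrow> a \<le> v \<Longrightarrow> diff_adj D (u - a) (v - a) \<longleftrightarrow> diff_adj D u v"
  by (auto simp: diff_adj_def)

lemma diff_adj_neq: "0 \<notin> D \<Longrightarrow> diff_adj D u v \<Longrightarrow> u \<noteq> v"
  by (auto simp: diff_adj_def)

lemma adjacent_diff_graph:
  "adjacent (diff_graph n D) u v \<longleftrightarrow> u < n \<and> v < n \<and> diff_adj D u v"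
  by (auto simp: adjacent_def diff_graph_def doubleton_eq_iff diff_adj_sym)

lemma simple_graph_diff_graph:
  assumes "0 \<notin> D"
  shows "simple_graph (diff_graph n D)"
  using diff_adj_neq[OF assms] by (auto simp: simple_graph_def diff_graph_def)

text \<open>Translating a clique so that its least vertex becomes 0 puts the other vertices into \<open>D\<close>.\<close>

lemma diff_adj_clique_shift:
  assumes "finite V" "card V = Suc k" "pairwise (diff_adj D) V"
  shows "\<exists>W \<subseteq> D. finite W \<and> card W = k \<and> pairwise (diff_adj D) W"
proof -
  define a where "a = Min V"
  define W where "W = (\<lambda>v. v - a) ` (V - {a})"
  have "V \<noteq> {}" using assms(2) by auto
  then have a: "a \<in> V" "\<And>v. v \<in> V \<Longrightarrow> a \<le> v"
    using assms(1) by (simp_all add: a_def)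
  have inj: "inj_on (\<lambda>v. v - a) V"
    using a(2) by (auto simp: inj_on_def) (metis le_add_diff_inverse)
  have "W \<subseteq> D"
  proof
    fix w assume "w \<in> W"
    then obtain v where "v \<in> V" "v \<noteq> a" "w = v - a" by (auto simp: W_def)
    then show "w \<in> D" using assms(3) a by (auto simp: pairwise_def diff_adj_def)
  qed
  moreover have "card W = k"
    unfolding W_def using assms(1,2) a(1) inj by (simp add: card_image inj_on_diff)
  moreover have "pairwise (diff_adj D) W"
    using assms(3) a(2) by (auto simp: pairwise_def W_def diff_adj_shift)
  moreover have "finite W"
    using assms(1) by (simp add: W_def)
  ultimately show ?thesis by blast
qed

lemma diff_graph_complete_free:
  assumes "\<not> has_clique (diff_adj D) k ds" "D \<subseteq> set ds"
  shows "\<not> contains (diff_graph n D) (complete (Suc k))"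
proof
  assume "contains (diff_graph n D) (complete (Suc k))"
  from contains_complete_clique[OF this] obtain V where V: "finite V" "card V = Suc k"
    and "pairwise (adjacent (diff_graph n D)) V"
    by blast
  then have "pairwise (diff_adj D) V"
    by (simp add: pairwise_def adjacent_diff_graph)
  then obtain W where "W \<subseteq> D" "finite W" "card W = k"
    and "pairwise (diff_adj D) W"
    using diff_adj_clique_shift[OF V] by blast
  then have "has_clique (diff_adj D) k ds"
    using assms(2) by (intro has_clique_if_clique) auto
  with assms(1) show False ..
qed

text \<open>Closed under \<open>d \<mapsto> 36 - d\<close>; the distances up to 18 are those of the circulant graph.\<close>

definition distances_36 :: "nat list" where
  "distances_36 = [1, 2, 3, 7, 8, 10, 12, 13, 15, 17, 18, 19, 21, 23, 24, 26, 28, 29, 33, 34, 35]"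

definition G36 :: graph where
  "G36 = diff_graph 36 (set distances_36)"

lemma simple_graph_G36: "simple_graph G36"
  unfolding G36_def by (rule simple_graph_diff_graph) (simp add: distances_36_def)

lemma G36_K5_free: "\<not> contains G36 (complete 5)"
proof -
  have "\<not> has_clique (diff_adj (set distances_36)) 4 distances_36"
    by (simp add: distances_36_def diff_adj_def)
  then show ?thesis
    unfolding G36_def using diff_graph_complete_free[of _ 4] by simp
qed

text \<open>The decision tree \<open>cert_G36\<close> below is cut into subtrees only so that the simplifier
  checks each of them separately.\<close>

definition cert_0 :: split_tree where
  "cert_0 =
    Branch 3 (Branch 19 (Leaf [3, 19, 0, 1, 2]) (Branch 13 (Leaf [2, 13, 0, 1, 3]) (Branch 18
    (Leaf [2, 18, 0, 1, 3]) (Branch 29 (Leaf [2, 29, 0, 1, 3]) (Branch 10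
    (Leaf [1, 10, 0, 2, 3]) (Branch 15 (Leaf [1, 15, 0, 2, 3]) (Branch 21
    (Leaf [1, 21, 0, 2, 3]) (Branch 26 (Leaf [1, 26, 0, 2, 3]) (Branch 20
    (Leaf [0, 20, 1, 2, 3]) (Branch 8 (Branch 11 (Branch 23 (Branch 16 (Branch 31 (Branch 33
    (Branch 5 (Leaf [5, 16, 23, 31, 33]) (Branch 34 (Leaf [0, 11, 1, 8, 34])
    (Leaf [15, 26, 5, 13, 34]))) (Leaf [19, 33, 18, 20, 21])) (Leaf [20, 31, 18, 19, 21]))
    (Leaf [18, 29, 16, 19, 26])) (Leaf [10, 21, 13, 20, 23])) (Leaf [21, 26, 11, 18, 19]))
    (Leaf [10, 21, 8, 18, 20]))))))))))) (Branch 19 (Branch 35 (Leaf [19, 35, 0, 1, 2])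
    (Branch 18 (Leaf [2, 18, 0, 1, 19]) (Branch 12 (Leaf [1, 12, 0, 2, 19]) (Branch 17
    (Leaf [1, 17, 0, 2, 19]) (Branch 21 (Leaf [1, 21, 0, 2, 19]) (Branch 26
    (Leaf [1, 26, 0, 2, 19]) (Branch 9 (Leaf [0, 9, 1, 2, 19]) (Branch 20
    (Leaf [0, 20, 1, 2, 19]) (Branch 5 (Branch 11 (Branch 10 (Branch 31 (Branch 13 (Branch 28
    (Leaf [2, 13, 5, 28, 31]) (Branch 7 (Branch 33 (Leaf [0, 31, 7, 10, 33]) (Branch 30
    (Branch 32 (Leaf [1, 32, 11, 13, 30]) (Leaf [17, 33, 9, 32, 35]))
    (Leaf [30, 35, 9, 12, 33]))) (Leaf [26, 35, 7, 9, 28]))) (Leaf [13, 18, 3, 20, 21]))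
    (Leaf [20, 31, 3, 18, 21])) (Leaf [10, 21, 3, 18, 20])) (Leaf [21, 26, 3, 11, 18]))
    (Leaf [20, 26, 3, 5, 18])))))))))) (Branch 35 (Branch 18 (Leaf [2, 18, 0, 1, 35]) (Branch 12
    (Leaf [1, 12, 0, 2, 35]) (Branch 17 (Leaf [1, 17, 0, 2, 35]) (Branch 28
    (Leaf [1, 28, 0, 2, 35]) (Branch 9 (Leaf [0, 9, 1, 2, 35]) (Branch 14
    (Leaf [0, 14, 1, 2, 35]) (Branch 20 (Leaf [0, 20, 1, 2, 35]) (Branch 25
    (Leaf [0, 25, 1, 2, 35]) (Branch 7 (Branch 10 (Branch 22 (Branch 15 (Branch 30 (Branch 32
    (Branch 4 (Leaf [4, 15, 22, 30, 32]) (Branch 33 (Leaf [10, 15, 0, 7, 33])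
    (Leaf [14, 25, 4, 12, 33]))) (Leaf [18, 32, 17, 19, 20])) (Leaf [19, 30, 17, 18, 20]))
    (Leaf [17, 28, 15, 18, 25])) (Leaf [9, 20, 12, 19, 22])) (Leaf [20, 25, 10, 17, 18]))
    (Leaf [9, 20, 7, 17, 19])))))))))) (Branch 4 (Branch 14 (Branch 25 (Leaf [14, 25, 1, 2, 4])
    (Branch 22 (Leaf [2, 22, 1, 4, 14]) (Branch 27 (Leaf [2, 27, 1, 4, 14]) (Branch 12
    (Leaf [1, 12, 2, 4, 14]) (Leaf [22, 27, 12, 25, 35]))))) (Branch 25 (Branch 22
    (Leaf [2, 22, 1, 4, 25]) (Branch 27 (Leaf [2, 27, 1, 4, 25]) (Branch 12
    (Leaf [1, 12, 2, 4, 25]) (Leaf [22, 27, 12, 14, 35])))) (Branch 30 (Branch 9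
    (Leaf [4, 9, 1, 2, 30]) (Branch 11 (Leaf [2, 11, 1, 4, 30]) (Branch 12
    (Leaf [1, 12, 2, 4, 30]) (Leaf [19, 35, 9, 11, 12])))) (Branch 27 (Branch 7 (Branch 10
    (Branch 17 (Leaf [2, 7, 0, 10, 17]) (Branch 28 (Leaf [2, 7, 0, 10, 28]) (Branch 18
    (Branch 33 (Leaf [7, 18, 0, 10, 33]) (Branch 12 (Branch 23 (Leaf [12, 23, 0, 2, 10])
    (Branch 15 (Leaf [10, 15, 0, 2, 12]) (Branch 13 (Leaf [2, 13, 0, 10, 12])
    (Leaf [25, 30, 13, 15, 23])))) (Leaf [14, 25, 12, 33, 35]))) (Leaf [17, 28, 18, 25, 35]))))
    (Branch 15 (Branch 17 (Leaf [2, 7, 0, 15, 17]) (Branch 28 (Leaf [2, 7, 0, 15, 28])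
    (Branch 18 (Branch 8 (Leaf [7, 18, 0, 8, 15]) (Branch 33 (Leaf [7, 18, 0, 15, 33])
    (Branch 23 (Branch 12 (Leaf [12, 23, 0, 2, 15]) (Leaf [10, 35, 12, 25, 33]))
    (Leaf [8, 33, 10, 23, 25])))) (Leaf [17, 28, 10, 18, 25])))) (Branch 23 (Branch 21
    (Leaf [0, 4, 2, 21, 23]) (Branch 24 (Branch 26 (Leaf [2, 24, 0, 23, 26]) (Branch 34
    (Leaf [0, 27, 1, 24, 34]) (Branch 11 (Branch 9 (Leaf [11, 27, 1, 9, 24]) (Branch 6
    (Branch 16 (Branch 31 (Leaf [6, 31, 16, 23, 24]) (Branch 18 (Branch 29 (Branch 8
    (Leaf [18, 29, 0, 1, 8]) (Leaf [8, 19, 21, 31, 34])) (Leaf [29, 34, 19, 21, 31]))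
    (Leaf [3, 19, 18, 21, 31]))) (Leaf [9, 34, 16, 19, 26])) (Leaf [9, 34, 6, 19, 21])))
    (Leaf [21, 26, 11, 19, 34])))) (Branch 11 (Branch 31 (Branch 5 (Leaf [4, 31, 2, 5, 23])
    (Branch 13 (Branch 26 (Leaf [2, 13, 0, 23, 26]) (Branch 34 (Leaf [0, 11, 1, 13, 34])
    (Leaf [3, 34, 5, 24, 26]))) (Branch 26 (Branch 18 (Branch 16 (Branch 28
    (Leaf [26, 31, 16, 18, 28]) (Leaf [3, 28, 5, 13, 15])) (Leaf [5, 16, 3, 13, 15]))
    (Leaf [13, 18, 3, 5, 15])) (Leaf [15, 26, 3, 5, 13])))) (Leaf [3, 14, 21, 24, 31]))
    (Leaf [3, 14, 11, 21, 24])))) (Branch 8 (Branch 22 (Branch 33 (Branch 26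
    (Leaf [8, 33, 0, 7, 26]) (Branch 29 (Leaf [0, 27, 1, 8, 29]) (Branch 11 (Branch 5
    (Leaf [22, 33, 4, 5, 7]) (Branch 18 (Leaf [0, 11, 1, 8, 18]) (Leaf [15, 26, 3, 5, 18])))
    (Leaf [10, 26, 3, 11, 29])))) (Leaf [25, 30, 15, 23, 33])) (Leaf [25, 30, 15, 22, 23]))
    (Leaf [10, 15, 8, 23, 25]))))) (Branch 6 (Branch 17 (Branch 22 (Branch 9 (Branch 24
    (Leaf [22, 27, 1, 9, 24]) (Branch 10 (Leaf [0, 9, 2, 10, 17]) (Branch 26 (Branch 28
    (Leaf [2, 27, 9, 26, 28]) (Leaf [10, 35, 7, 25, 28])) (Leaf [14, 25, 7, 24, 26]))))
    (Branch 28 (Branch 10 (Leaf [17, 28, 0, 2, 10]) (Branch 15 (Leaf [17, 28, 0, 2, 15])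
    (Branch 5 (Leaf [17, 28, 2, 4, 5]) (Branch 21 (Leaf [0, 4, 2, 21, 28]) (Branch 8 (Branch 29
    (Leaf [1, 6, 8, 27, 29]) (Branch 34 (Leaf [1, 6, 8, 27, 34]) (Branch 11 (Branch 31
    (Branch 18 (Leaf [0, 11, 1, 8, 18]) (Branch 13 (Branch 26 (Branch 16
    (Leaf [26, 31, 13, 16, 28]) (Leaf [5, 16, 3, 15, 18])) (Leaf [15, 26, 3, 5, 18]))
    (Leaf [13, 18, 3, 5, 15]))) (Leaf [29, 34, 19, 21, 31])) (Leaf [9, 29, 11, 19, 21]))))
    (Leaf [9, 25, 7, 8, 10])))))) (Leaf [30, 35, 7, 9, 28]))) (Leaf [14, 25, 7, 22, 35]))
    (Leaf [14, 25, 7, 17, 35])) (Leaf [14, 25, 6, 7, 35]))) (Branch 12 (Branch 17 (Branch 10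
    (Leaf [12, 17, 0, 2, 10]) (Branch 15 (Leaf [12, 17, 0, 2, 15]) (Branch 5
    (Leaf [12, 17, 2, 4, 5]) (Branch 8 (Branch 28 (Branch 21 (Leaf [0, 4, 2, 21, 28]) (Branch 11
    (Branch 18 (Leaf [0, 11, 1, 8, 18]) (Branch 13 (Branch 26 (Branch 31 (Branch 16
    (Leaf [26, 31, 13, 16, 28]) (Leaf [5, 16, 3, 15, 18])) (Leaf [15, 31, 3, 5, 18]))
    (Leaf [15, 26, 3, 5, 18])) (Leaf [13, 18, 3, 5, 15]))) (Branch 29 (Branch 18
    (Leaf [18, 29, 0, 1, 8]) (Leaf [10, 21, 3, 11, 18])) (Leaf [11, 27, 3, 10, 29]))))
    (Leaf [25, 30, 15, 27, 28])) (Leaf [10, 15, 8, 25, 27]))))) (Leaf [14, 25, 17, 27, 35]))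
    (Leaf [14, 25, 12, 27, 35])))))) (Branch 6 (Branch 11 (Branch 8 (Branch 18
    (Leaf [0, 11, 1, 8, 18]) (Branch 29 (Leaf [0, 11, 1, 8, 29]) (Branch 26 (Branch 23
    (Leaf [2, 8, 0, 23, 26]) (Branch 9 (Leaf [1, 26, 8, 9, 11]) (Branch 25 (Branch 28
    (Leaf [0, 25, 2, 26, 28]) (Branch 7 (Leaf [6, 26, 7, 8, 25]) (Branch 10 (Branch 20
    (Branch 27 (Leaf [20, 25, 8, 10, 27]) (Leaf [7, 27, 9, 28, 35])) (Leaf [9, 20, 7, 28, 35]))
    (Leaf [10, 35, 7, 9, 28])))) (Branch 33 (Branch 7 (Leaf [8, 33, 0, 7, 26]) (Branch 17
    (Branch 28 (Branch 13 (Leaf [0, 11, 13, 26, 28]) (Branch 15 (Leaf [17, 28, 0, 2, 15])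
    (Branch 5 (Leaf [0, 5, 2, 26, 28]) (Leaf [13, 18, 3, 5, 15])))) (Leaf [4, 35, 7, 25, 28]))
    (Leaf [19, 25, 4, 7, 17]))) (Leaf [4, 35, 23, 25, 33]))))) (Branch 5 (Branch 16 (Branch 23
    (Leaf [5, 16, 6, 8, 23]) (Branch 9 (Leaf [1, 6, 8, 9, 16]) (Branch 27 (Branch 25
    (Leaf [1, 6, 8, 25, 27]) (Branch 28 (Branch 15 (Leaf [0, 5, 2, 15, 28]) (Branch 13
    (Branch 31 (Leaf [5, 16, 13, 28, 31]) (Branch 21 (Leaf [2, 13, 0, 21, 28])
    (Leaf [3, 19, 18, 21, 31]))) (Leaf [15, 26, 13, 23, 25]))) (Leaf [26, 35, 18, 25, 28])))
    (Leaf [9, 29, 19, 26, 27])))) (Leaf [18, 29, 3, 16, 26])) (Leaf [18, 29, 3, 5, 26])))))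
    (Branch 22 (Branch 24 (Branch 9 (Leaf [11, 22, 1, 9, 24]) (Branch 14
    (Leaf [11, 22, 1, 14, 24]) (Branch 34 (Leaf [0, 11, 1, 24, 34]) (Branch 26 (Branch 23
    (Leaf [2, 24, 0, 23, 26]) (Branch 12 (Branch 25 (Leaf [1, 12, 22, 24, 25]) (Branch 33
    (Branch 7 (Leaf [24, 33, 0, 7, 26]) (Branch 10 (Leaf [2, 33, 0, 10, 12]) (Branch 15
    (Leaf [2, 33, 0, 12, 15]) (Branch 5 (Branch 20 (Leaf [2, 22, 5, 12, 20])
    (Leaf [9, 20, 7, 8, 10])) (Leaf [7, 23, 5, 8, 15]))))) (Leaf [4, 35, 23, 25, 33])))
    (Branch 27 (Branch 33 (Branch 25 (Leaf [1, 6, 24, 25, 27]) (Branch 7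
    (Leaf [24, 33, 0, 7, 26]) (Branch 17 (Branch 10 (Branch 28 (Branch 15 (Branch 13
    (Leaf [0, 11, 10, 13, 28]) (Branch 20 (Leaf [2, 27, 10, 17, 20]) (Branch 30
    (Leaf [2, 27, 15, 17, 30]) (Leaf [12, 23, 13, 20, 30])))) (Leaf [7, 23, 8, 15, 25]))
    (Leaf [4, 35, 7, 25, 28])) (Leaf [9, 25, 7, 8, 10])) (Leaf [14, 19, 4, 7, 17]))))
    (Leaf [4, 35, 12, 14, 33])) (Leaf [14, 19, 4, 12, 27])))) (Branch 7 (Branch 16 (Branch 5
    (Leaf [6, 22, 5, 7, 24]) (Branch 23 (Branch 13 (Leaf [13, 24, 6, 16, 23])
    (Leaf [3, 34, 5, 13, 26])) (Leaf [23, 34, 5, 8, 26]))) (Leaf [9, 34, 8, 16, 26]))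
    (Leaf [8, 19, 7, 9, 26])))))) (Branch 30 (Branch 9 (Leaf [2, 11, 1, 9, 30]) (Branch 20
    (Leaf [2, 22, 1, 20, 30]) (Branch 18 (Branch 13 (Leaf [13, 18, 1, 11, 30]) (Branch 28
    (Leaf [1, 28, 11, 18, 30]) (Branch 21 (Branch 5 (Branch 7 (Branch 10 (Branch 23
    (Leaf [10, 21, 0, 2, 23]) (Branch 33 (Leaf [7, 18, 0, 10, 33]) (Branch 15
    (Leaf [5, 30, 7, 15, 22]) (Branch 12 (Branch 25 (Leaf [0, 25, 2, 10, 12])
    (Leaf [23, 28, 13, 15, 25])) (Leaf [9, 20, 12, 33, 35]))))) (Leaf [3, 28, 10, 13, 20]))
    (Leaf [9, 20, 7, 28, 35])) (Leaf [3, 28, 5, 13, 20])) (Leaf [3, 28, 13, 20, 21]))))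
    (Branch 10 (Branch 17 (Branch 28 (Leaf [17, 28, 0, 2, 10]) (Branch 15
    (Leaf [10, 15, 0, 2, 17]) (Branch 7 (Leaf [2, 7, 0, 10, 17]) (Branch 25
    (Leaf [0, 25, 2, 10, 17]) (Leaf [8, 28, 7, 15, 25]))))) (Leaf [19, 35, 17, 18, 20]))
    (Leaf [3, 8, 10, 18, 20]))))) (Branch 27 (Branch 17 (Branch 10 (Branch 28
    (Leaf [17, 28, 0, 2, 10]) (Branch 7 (Leaf [2, 7, 0, 10, 17]) (Branch 25
    (Leaf [0, 25, 2, 10, 17]) (Leaf [25, 30, 4, 7, 28])))) (Branch 15 (Branch 28
    (Leaf [17, 28, 0, 2, 15]) (Branch 7 (Leaf [2, 7, 0, 15, 17]) (Branch 5
    (Leaf [0, 5, 2, 15, 17]) (Branch 25 (Leaf [0, 25, 2, 15, 17]) (Leaf [5, 25, 4, 7, 28])))))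
    (Branch 7 (Branch 18 (Branch 23 (Branch 13 (Branch 26 (Leaf [2, 13, 0, 23, 26]) (Branch 34
    (Leaf [0, 11, 1, 13, 34]) (Branch 5 (Branch 16 (Leaf [5, 16, 6, 13, 23])
    (Leaf [15, 26, 8, 16, 34])) (Leaf [15, 26, 5, 8, 34])))) (Branch 5 (Branch 20
    (Leaf [17, 23, 2, 5, 20]) (Branch 31 (Branch 28 (Leaf [2, 7, 5, 28, 31])
    (Leaf [3, 28, 10, 13, 20])) (Leaf [20, 31, 3, 10, 13]))) (Branch 26 (Branch 31 (Branch 16
    (Branch 28 (Leaf [26, 31, 16, 18, 28]) (Leaf [3, 28, 5, 13, 15])) (Leaf [5, 16, 3, 13, 15]))
    (Leaf [15, 31, 3, 5, 13])) (Leaf [15, 26, 3, 5, 13])))) (Branch 25 (Branch 33 (Branch 26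
    (Leaf [7, 18, 25, 26, 33]) (Branch 5 (Branch 20 (Leaf [2, 7, 5, 17, 20]) (Branch 31
    (Leaf [7, 18, 5, 31, 33]) (Leaf [20, 31, 8, 10, 23]))) (Leaf [15, 26, 5, 8, 23])))
    (Leaf [4, 15, 23, 30, 33])) (Leaf [10, 15, 8, 23, 25]))) (Branch 5 (Branch 20
    (Leaf [2, 7, 5, 17, 20]) (Leaf [3, 8, 10, 18, 20])) (Leaf [3, 8, 5, 15, 18]))) (Branch 25
    (Branch 28 (Branch 33 (Branch 26 (Leaf [2, 27, 25, 26, 28]) (Branch 5 (Branch 9 (Branch 21
    (Leaf [2, 11, 9, 21, 28]) (Branch 20 (Leaf [17, 28, 2, 5, 20]) (Branch 18 (Branch 31
    (Leaf [28, 33, 5, 18, 31]) (Leaf [20, 31, 7, 8, 10])) (Leaf [10, 21, 3, 18, 20]))))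
    (Leaf [10, 26, 7, 8, 9])) (Leaf [15, 26, 5, 7, 8]))) (Leaf [4, 15, 7, 30, 33]))
    (Leaf [4, 15, 7, 28, 30])) (Leaf [10, 15, 7, 8, 25]))))) (Branch 7 (Branch 32 (Branch 15
    (Branch 28 (Leaf [2, 7, 0, 15, 28]) (Branch 14 (Leaf [7, 32, 14, 15, 22]) (Branch 25
    (Leaf [7, 32, 15, 22, 25]) (Branch 18 (Branch 33 (Leaf [7, 18, 0, 15, 33]) (Branch 12
    (Branch 23 (Leaf [12, 23, 0, 2, 15]) (Leaf [25, 30, 4, 23, 33]))
    (Leaf [14, 25, 4, 12, 33]))) (Leaf [17, 28, 18, 25, 35]))))) (Branch 5 (Branch 33 (Branch 20
    (Leaf [22, 33, 5, 7, 20]) (Branch 18 (Branch 10 (Leaf [7, 18, 0, 10, 33]) (Branch 31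
    (Leaf [7, 18, 5, 31, 33]) (Branch 23 (Branch 29 (Branch 14 (Leaf [1, 32, 11, 14, 29])
    (Branch 21 (Leaf [2, 33, 0, 21, 23]) (Leaf [3, 14, 21, 24, 31]))) (Leaf [3, 8, 10, 29, 31]))
    (Leaf [20, 31, 8, 10, 23])))) (Leaf [19, 30, 17, 18, 20]))) (Branch 12 (Branch 23 (Branch 10
    (Leaf [12, 23, 0, 2, 10]) (Branch 20 (Leaf [12, 23, 2, 5, 20]) (Branch 31
    (Leaf [12, 23, 2, 5, 31]) (Branch 26 (Leaf [0, 5, 2, 23, 26]) (Branch 13 (Branch 16
    (Leaf [5, 16, 6, 13, 23]) (Leaf [26, 31, 3, 16, 24])) (Leaf [20, 31, 3, 10, 13]))))))
    (Leaf [4, 15, 23, 30, 33])) (Leaf [4, 15, 12, 30, 33]))) (Branch 18 (Branch 34 (Branch 13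
    (Leaf [1, 32, 11, 13, 34]) (Branch 28 (Branch 26 (Leaf [0, 11, 18, 26, 28])
    (Leaf [15, 26, 3, 5, 13])) (Leaf [5, 30, 13, 15, 28]))) (Leaf [8, 17, 5, 15, 34]))
    (Leaf [3, 8, 5, 15, 18])))) (Leaf [19, 30, 4, 17, 32])) (Leaf [19, 30, 4, 7, 17])))
    (Branch 12 (Branch 17 (Branch 10 (Leaf [12, 17, 0, 2, 10]) (Branch 15
    (Leaf [12, 17, 0, 2, 15]) (Branch 29 (Branch 14 (Leaf [1, 12, 11, 14, 29]) (Branch 26
    (Branch 28 (Leaf [0, 11, 26, 28, 29]) (Leaf [4, 15, 27, 28, 30]))
    (Leaf [3, 14, 24, 26, 27]))) (Leaf [3, 8, 10, 27, 29])))) (Leaf [19, 30, 4, 17, 27]))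
    (Leaf [19, 30, 4, 12, 27]))))) (Branch 21 (Branch 9 (Branch 30 (Leaf [2, 11, 1, 9, 30])
    (Branch 7 (Branch 12 (Branch 24 (Leaf [7, 21, 6, 9, 24]) (Branch 10
    (Leaf [2, 11, 9, 10, 12]) (Branch 5 (Branch 15 (Leaf [0, 5, 2, 12, 15]) (Branch 23
    (Branch 13 (Leaf [2, 13, 0, 21, 23]) (Branch 20 (Leaf [12, 23, 2, 5, 20]) (Branch 31
    (Leaf [12, 23, 2, 5, 31]) (Leaf [20, 31, 3, 10, 13])))) (Leaf [4, 15, 22, 23, 30])))
    (Leaf [4, 24, 3, 5, 22])))) (Leaf [19, 30, 4, 12, 22])) (Leaf [19, 30, 4, 7, 22])))
    (Branch 12 (Branch 23 (Branch 10 (Leaf [12, 23, 0, 2, 10]) (Branch 13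
    (Leaf [2, 13, 0, 21, 23]) (Branch 20 (Leaf [0, 20, 2, 21, 23]) (Branch 31
    (Leaf [0, 31, 2, 21, 23]) (Leaf [20, 31, 3, 10, 13]))))) (Branch 5 (Branch 25 (Branch 10
    (Leaf [0, 25, 2, 10, 12]) (Branch 15 (Leaf [0, 5, 2, 12, 15]) (Branch 20 (Branch 30
    (Leaf [5, 30, 2, 12, 20]) (Leaf [4, 15, 22, 23, 30])) (Leaf [3, 23, 10, 20, 22]))))
    (Leaf [4, 35, 22, 23, 25])) (Leaf [3, 23, 4, 5, 22]))) (Leaf [19, 35, 9, 12, 22])))
    (Leaf [3, 19, 4, 21, 22])))) (Branch 21 (Branch 32 (Branch 29 (Branch 8
    (Leaf [1, 21, 0, 8, 29]) (Branch 28 (Leaf [2, 29, 0, 21, 28]) (Branch 14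
    (Leaf [21, 32, 6, 14, 29]) (Branch 12 (Branch 10 (Leaf [2, 29, 0, 10, 12]) (Branch 9
    (Branch 13 (Branch 23 (Leaf [0, 6, 13, 21, 23]) (Branch 30 (Leaf [1, 12, 2, 9, 30])
    (Leaf [23, 28, 4, 11, 30]))) (Leaf [3, 28, 10, 11, 13])) (Leaf [8, 28, 9, 10, 11])))
    (Leaf [4, 35, 11, 12, 14]))))) (Branch 12 (Branch 26 (Branch 23 (Leaf [21, 26, 0, 2, 23])
    (Branch 28 (Leaf [21, 26, 0, 2, 28]) (Branch 10 (Branch 15 (Leaf [10, 15, 0, 2, 12])
    (Branch 13 (Leaf [2, 13, 0, 10, 12]) (Branch 25 (Leaf [0, 25, 2, 10, 12])
    (Leaf [23, 28, 13, 15, 25])))) (Leaf [3, 28, 10, 11, 29])))) (Leaf [3, 19, 11, 26, 29]))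
    (Leaf [4, 29, 11, 12, 19]))) (Leaf [3, 19, 4, 11, 32])) (Leaf [3, 19, 4, 11, 21])))
    (Branch 21 (Branch 27 (Branch 32 (Branch 23 (Branch 10 (Leaf [10, 21, 0, 2, 23]) (Branch 13
    (Leaf [2, 13, 0, 21, 23]) (Branch 20 (Leaf [0, 20, 2, 21, 23]) (Branch 31
    (Leaf [0, 31, 2, 21, 23]) (Leaf [20, 31, 3, 10, 13]))))) (Branch 5 (Branch 25 (Branch 30
    (Branch 9 (Leaf [2, 27, 1, 9, 30]) (Branch 20 (Leaf [2, 27, 1, 20, 30]) (Branch 7 (Branch 10
    (Branch 12 (Leaf [0, 25, 2, 10, 12]) (Branch 33 (Leaf [0, 25, 7, 10, 33])
    (Leaf [9, 20, 12, 33, 35]))) (Branch 13 (Branch 22 (Branch 11 (Leaf [1, 32, 11, 13, 30])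
    (Branch 33 (Branch 29 (Leaf [1, 32, 22, 29, 30]) (Branch 31 (Leaf [13, 33, 30, 31, 32])
    (Leaf [11, 31, 3, 10, 29]))) (Leaf [10, 35, 20, 23, 33]))) (Leaf [3, 23, 10, 20, 22]))
    (Leaf [3, 23, 10, 13, 20]))) (Leaf [19, 35, 6, 7, 9])))) (Branch 7 (Branch 11 (Branch 22
    (Branch 33 (Branch 20 (Leaf [22, 33, 5, 7, 20]) (Branch 13 (Branch 10
    (Leaf [22, 33, 7, 10, 25]) (Branch 28 (Leaf [0, 11, 13, 21, 28]) (Branch 18 (Branch 31
    (Leaf [0, 31, 18, 21, 33]) (Branch 29 (Branch 8 (Leaf [18, 29, 0, 1, 8])
    (Leaf [20, 31, 8, 10, 23])) (Leaf [10, 30, 28, 29, 31]))) (Leaf [10, 30, 18, 20, 28]))))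
    (Leaf [4, 13, 6, 23, 30]))) (Leaf [6, 33, 4, 23, 30])) (Leaf [6, 22, 4, 23, 30]))
    (Leaf [6, 11, 4, 23, 30])) (Leaf [19, 30, 4, 6, 7]))) (Leaf [4, 35, 6, 23, 25]))
    (Leaf [3, 23, 4, 5, 6]))) (Leaf [3, 19, 4, 6, 32])) (Leaf [3, 19, 4, 6, 27]))
    (Leaf [3, 19, 4, 6, 21]))))))"

lemma certifies_cert_0: "certifies (J5_copy G36) [2, 1, 0] [] cert_0"
  unfolding cert_0_def G36_def by (simp add: adjacent_diff_graph diff_adj_def distances_36_def)

definition cert_1 :: split_tree where
  "cert_1 =
    Branch 13 (Branch 24 (Leaf [13, 24, 0, 1, 3]) (Branch 34 (Leaf [3, 34, 0, 1, 13]) (Branch 21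
    (Leaf [1, 21, 0, 3, 13]) (Branch 26 (Leaf [1, 26, 0, 3, 13]) (Branch 11
    (Leaf [0, 11, 1, 3, 13]) (Leaf [21, 26, 11, 24, 34])))))) (Branch 18 (Branch 29
    (Leaf [18, 29, 0, 1, 3]) (Branch 8 (Leaf [3, 8, 0, 1, 18]) (Branch 10
    (Leaf [1, 10, 0, 3, 18]) (Branch 21 (Leaf [1, 21, 0, 3, 18]) (Branch 11
    (Leaf [0, 11, 1, 3, 18]) (Leaf [10, 21, 8, 11, 29])))))) (Branch 24 (Branch 34
    (Leaf [3, 34, 0, 1, 24]) (Branch 21 (Leaf [1, 21, 0, 3, 24]) (Branch 26
    (Leaf [1, 26, 0, 3, 24]) (Branch 11 (Leaf [0, 11, 1, 3, 24]) (Leaf [21, 26, 11, 13, 34])))))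
    (Branch 29 (Branch 8 (Leaf [3, 8, 0, 1, 29]) (Branch 10 (Leaf [1, 10, 0, 3, 29]) (Branch 21
    (Leaf [1, 21, 0, 3, 29]) (Branch 11 (Leaf [0, 11, 1, 3, 29]) (Leaf [10, 21, 8, 11, 18])))))
    (Branch 4 (Branch 11 (Branch 22 (Leaf [11, 22, 1, 3, 4]) (Branch 14 (Leaf [3, 14, 1, 4, 11])
    (Branch 21 (Leaf [1, 21, 3, 4, 11]) (Leaf [24, 29, 14, 21, 22])))) (Branch 14 (Branch 16
    (Leaf [3, 14, 1, 4, 16]) (Branch 6 (Branch 21 (Leaf [3, 14, 4, 6, 21]) (Branch 32
    (Leaf [3, 14, 4, 6, 32]) (Branch 8 (Branch 34 (Branch 19 (Leaf [8, 19, 0, 1, 34])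
    (Leaf [18, 29, 11, 19, 21])) (Leaf [21, 32, 11, 13, 34])) (Leaf [18, 29, 8, 11, 21]))))
    (Branch 8 (Branch 19 (Branch 34 (Leaf [8, 19, 0, 1, 34]) (Leaf [13, 24, 6, 16, 34]))
    (Leaf [18, 29, 6, 16, 19])) (Leaf [18, 29, 6, 8, 16])))) (Branch 21 (Branch 32 (Branch 6
    (Leaf [21, 32, 3, 4, 6]) (Branch 16 (Branch 27 (Leaf [16, 27, 1, 3, 4])
    (Leaf [24, 29, 6, 14, 27])) (Leaf [13, 24, 6, 14, 16]))) (Leaf [13, 24, 11, 14, 32]))
    (Leaf [13, 24, 11, 14, 21])))) (Branch 5 (Branch 20 (Branch 22 (Leaf [1, 5, 3, 20, 22])
    (Branch 25 (Branch 27 (Branch 19 (Leaf [3, 19, 1, 20, 27]) (Branch 30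
    (Leaf [3, 30, 1, 20, 27]) (Branch 17 (Branch 7 (Branch 15 (Leaf [15, 20, 5, 7, 17])
    (Branch 28 (Leaf [17, 28, 5, 7, 20]) (Branch 33 (Leaf [17, 33, 5, 7, 20])
    (Leaf [28, 33, 15, 18, 30])))) (Leaf [19, 30, 4, 7, 22])) (Leaf [19, 30, 2, 4, 17]))))
    (Branch 14 (Branch 30 (Branch 7 (Branch 17 (Leaf [5, 30, 7, 17, 20]) (Branch 28
    (Leaf [5, 30, 7, 20, 28]) (Branch 10 (Branch 19 (Branch 8 (Leaf [0, 20, 7, 8, 10])
    (Branch 26 (Branch 34 (Leaf [7, 34, 0, 19, 26]) (Branch 6 (Branch 9 (Leaf [6, 26, 7, 9, 19])
    (Branch 16 (Branch 35 (Leaf [1, 6, 14, 16, 35]) (Leaf [24, 35, 9, 17, 27]))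
    (Leaf [16, 27, 9, 17, 24]))) (Leaf [29, 34, 6, 8, 27]))) (Leaf [8, 28, 26, 27, 29])))
    (Leaf [4, 29, 17, 19, 27])) (Leaf [17, 28, 10, 27, 29])))) (Branch 9 (Branch 32 (Branch 17
    (Leaf [9, 20, 17, 30, 32]) (Branch 19 (Branch 6 (Leaf [19, 30, 6, 9, 32]) (Branch 34
    (Branch 8 (Leaf [8, 19, 0, 1, 34]) (Branch 16 (Leaf [9, 34, 1, 16, 19])
    (Leaf [18, 29, 6, 8, 16]))) (Leaf [6, 17, 24, 27, 34]))) (Leaf [17, 22, 4, 7, 19])))
    (Branch 19 (Branch 11 (Leaf [19, 30, 1, 9, 11]) (Branch 34 (Branch 8
    (Leaf [8, 19, 0, 1, 34]) (Branch 21 (Leaf [1, 21, 0, 19, 34]) (Branch 26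
    (Leaf [1, 26, 0, 19, 34]) (Leaf [21, 26, 8, 11, 18])))) (Leaf [13, 24, 11, 32, 34])))
    (Leaf [7, 32, 4, 19, 22]))) (Branch 6 (Branch 35 (Branch 17 (Branch 32
    (Leaf [6, 17, 14, 32, 35]) (Leaf [7, 32, 9, 22, 24])) (Leaf [17, 22, 7, 9, 24]))
    (Leaf [24, 35, 7, 9, 22])) (Leaf [7, 27, 6, 9, 24])))) (Branch 12 (Branch 17 (Branch 23
    (Branch 28 (Branch 7 (Leaf [17, 28, 5, 7, 20]) (Branch 33 (Leaf [12, 23, 5, 20, 33])
    (Branch 15 (Branch 32 (Leaf [14, 25, 15, 17, 32]) (Leaf [4, 29, 22, 30, 32]))
    (Leaf [22, 33, 7, 15, 30])))) (Leaf [2, 27, 4, 28, 30])) (Leaf [2, 22, 4, 23, 30]))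
    (Leaf [2, 27, 4, 17, 30])) (Leaf [2, 22, 4, 12, 30]))) (Branch 17 (Branch 7 (Branch 15
    (Leaf [0, 5, 7, 15, 17]) (Branch 30 (Leaf [5, 30, 7, 17, 20]) (Branch 28
    (Leaf [17, 28, 5, 7, 20]) (Leaf [2, 13, 15, 28, 30])))) (Leaf [4, 24, 7, 14, 22]))
    (Leaf [2, 27, 4, 14, 17])))) (Branch 12 (Branch 23 (Branch 33 (Leaf [12, 23, 5, 20, 33])
    (Branch 7 (Branch 32 (Branch 8 (Leaf [7, 23, 5, 8, 20]) (Branch 10 (Branch 27
    (Leaf [3, 12, 10, 20, 27]) (Branch 15 (Branch 17 (Branch 30 (Leaf [15, 20, 17, 30, 32])
    (Branch 28 (Leaf [17, 28, 0, 7, 10]) (Leaf [4, 29, 27, 28, 30])))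
    (Leaf [4, 24, 17, 25, 27])) (Leaf [8, 33, 15, 18, 25]))) (Leaf [8, 33, 10, 18, 25])))
    (Leaf [4, 24, 22, 25, 32])) (Leaf [4, 24, 7, 22, 25]))) (Leaf [2, 22, 4, 23, 25]))
    (Leaf [2, 22, 4, 12, 25])))) (Branch 17 (Branch 21 (Branch 28 (Branch 7 (Branch 10
    (Leaf [17, 28, 0, 7, 10]) (Branch 35 (Leaf [17, 28, 0, 7, 35]) (Branch 23 (Branch 33
    (Branch 31 (Leaf [0, 31, 21, 23, 33]) (Branch 8 (Leaf [8, 33, 0, 21, 23])
    (Leaf [20, 31, 8, 10, 18]))) (Leaf [10, 35, 18, 20, 33])) (Leaf [10, 35, 2, 20, 23]))))
    (Branch 10 (Branch 35 (Branch 34 (Leaf [10, 35, 0, 17, 34]) (Branch 14 (Branch 16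
    (Leaf [1, 17, 14, 16, 35]) (Branch 6 (Branch 32 (Leaf [6, 17, 14, 32, 35]) (Branch 11
    (Branch 9 (Leaf [9, 14, 1, 11, 35]) (Branch 22 (Leaf [11, 22, 1, 14, 35])
    (Leaf [7, 32, 9, 22, 24]))) (Leaf [13, 24, 11, 32, 34]))) (Leaf [13, 24, 6, 16, 34])))
    (Branch 22 (Branch 12 (Branch 33 (Leaf [10, 35, 0, 12, 33]) (Branch 15
    (Leaf [3, 12, 5, 15, 22]) (Leaf [4, 15, 7, 14, 33]))) (Branch 25 (Branch 27
    (Leaf [17, 28, 10, 25, 27]) (Leaf [2, 27, 4, 12, 14])) (Leaf [14, 25, 2, 4, 12])))
    (Leaf [4, 24, 7, 14, 22])))) (Branch 33 (Branch 23 (Leaf [10, 21, 0, 23, 33]) (Branch 12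
    (Branch 25 (Leaf [0, 25, 10, 12, 33]) (Leaf [4, 35, 2, 23, 25]))
    (Leaf [12, 23, 2, 20, 35]))) (Leaf [7, 18, 20, 33, 35]))) (Branch 8 (Branch 23 (Branch 33
    (Leaf [8, 33, 0, 21, 23]) (Leaf [7, 18, 10, 20, 33])) (Leaf [2, 13, 10, 20, 23]))
    (Leaf [7, 18, 8, 10, 20])))) (Branch 30 (Branch 10 (Branch 35 (Branch 7
    (Leaf [10, 35, 0, 7, 17]) (Branch 34 (Leaf [10, 35, 0, 17, 34]) (Branch 25 (Branch 27
    (Leaf [10, 35, 17, 25, 27]) (Branch 6 (Branch 32 (Leaf [6, 17, 25, 32, 35]) (Branch 11
    (Branch 9 (Leaf [30, 35, 1, 9, 11]) (Branch 22 (Branch 12 (Leaf [10, 35, 12, 22, 25])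
    (Branch 14 (Leaf [11, 22, 1, 14, 35]) (Leaf [9, 14, 12, 24, 27])))
    (Leaf [7, 32, 9, 22, 24]))) (Leaf [13, 24, 11, 32, 34]))) (Branch 19 (Branch 9 (Branch 16
    (Leaf [19, 35, 9, 16, 17]) (Leaf [13, 24, 6, 16, 34])) (Leaf [7, 27, 6, 9, 24]))
    (Leaf [7, 27, 4, 6, 19])))) (Leaf [2, 7, 4, 25, 28])))) (Leaf [2, 18, 20, 28, 35]))
    (Leaf [2, 13, 10, 20, 28])) (Leaf [4, 20, 2, 28, 30]))) (Branch 19 (Branch 23 (Branch 34
    (Leaf [1, 17, 0, 19, 34]) (Branch 6 (Branch 31 (Branch 8 (Leaf [6, 31, 5, 8, 23]) (Branch 10
    (Branch 33 (Leaf [0, 31, 10, 23, 33]) (Leaf [8, 33, 18, 20, 21]))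
    (Leaf [10, 21, 8, 18, 20]))) (Leaf [13, 24, 21, 31, 34])) (Leaf [13, 24, 6, 21, 34])))
    (Leaf [4, 20, 2, 21, 23])) (Leaf [4, 20, 2, 19, 21]))) (Branch 19 (Branch 10 (Branch 35
    (Branch 34 (Leaf [19, 35, 0, 1, 34]) (Branch 7 (Branch 28 (Leaf [10, 35, 0, 7, 28])
    (Branch 25 (Branch 8 (Leaf [0, 25, 7, 8, 10]) (Branch 22 (Leaf [10, 35, 7, 22, 25])
    (Branch 32 (Branch 6 (Leaf [7, 32, 6, 25, 35]) (Branch 27 (Branch 12
    (Leaf [10, 35, 12, 25, 27]) (Branch 16 (Branch 14 (Leaf [16, 27, 1, 14, 35])
    (Leaf [12, 17, 2, 4, 14])) (Leaf [6, 17, 16, 24, 34]))) (Leaf [8, 24, 6, 27, 34])))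
    (Leaf [17, 22, 24, 32, 34])))) (Leaf [17, 28, 2, 4, 25]))) (Branch 14 (Branch 25 (Branch 22
    (Leaf [14, 25, 1, 22, 35]) (Branch 27 (Leaf [14, 25, 1, 27, 35]) (Branch 9 (Branch 16
    (Leaf [19, 35, 1, 9, 16]) (Leaf [16, 27, 17, 24, 34])) (Leaf [17, 22, 7, 9, 24]))))
    (Leaf [2, 7, 4, 17, 25])) (Leaf [2, 7, 4, 14, 17])))) (Leaf [2, 18, 17, 20, 35]))
    (Leaf [2, 18, 10, 17, 20])) (Leaf [4, 20, 2, 17, 19])))) (Branch 6 (Branch 12 (Branch 17
    (Branch 19 (Branch 34 (Leaf [1, 17, 0, 19, 34]) (Branch 26 (Branch 31 (Branch 7
    (Leaf [17, 26, 0, 7, 19]) (Branch 22 (Branch 20 (Leaf [1, 12, 19, 20, 22]) (Branch 23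
    (Branch 8 (Branch 10 (Leaf [0, 31, 8, 10, 23]) (Branch 21 (Leaf [0, 6, 8, 21, 23])
    (Branch 11 (Leaf [0, 11, 8, 23, 26]) (Leaf [10, 21, 11, 13, 34]))))
    (Leaf [7, 18, 5, 8, 20])) (Leaf [4, 20, 2, 5, 23]))) (Leaf [4, 24, 5, 7, 22])))
    (Leaf [13, 24, 5, 31, 34])) (Leaf [13, 24, 5, 26, 34]))) (Branch 20 (Branch 21 (Branch 22
    (Leaf [1, 21, 3, 20, 22]) (Branch 23 (Branch 7 (Branch 10 (Leaf [0, 20, 7, 10, 17])
    (Branch 8 (Leaf [0, 6, 8, 21, 23]) (Branch 33 (Leaf [0, 20, 21, 23, 33]) (Branch 15
    (Branch 25 (Leaf [0, 25, 7, 15, 17]) (Leaf [8, 33, 10, 18, 25]))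
    (Leaf [8, 33, 5, 15, 18]))))) (Leaf [5, 19, 4, 7, 22])) (Leaf [2, 22, 4, 5, 23])))
    (Branch 14 (Branch 23 (Branch 28 (Branch 9 (Branch 31 (Branch 11 (Branch 22 (Branch 30
    (Leaf [1, 12, 9, 11, 30]) (Branch 32 (Leaf [1, 32, 3, 20, 22]) (Branch 7 (Branch 15
    (Leaf [17, 28, 0, 7, 15]) (Branch 33 (Leaf [7, 12, 14, 31, 33]) (Leaf [5, 30, 15, 18, 33])))
    (Branch 33 (Branch 15 (Leaf [22, 33, 12, 14, 15]) (Branch 25 (Branch 16
    (Leaf [12, 16, 14, 31, 33]) (Branch 26 (Leaf [0, 25, 23, 26, 33])
    (Leaf [18, 29, 16, 19, 26]))) (Leaf [25, 30, 13, 15, 32]))) (Leaf [5, 30, 4, 7, 33])))))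
    (Leaf [2, 22, 4, 19, 21])) (Leaf [2, 11, 4, 19, 21])) (Leaf [4, 31, 2, 19, 21]))
    (Leaf [4, 9, 2, 19, 21])) (Leaf [19, 28, 2, 4, 21])) (Leaf [19, 23, 2, 4, 21]))
    (Leaf [14, 19, 2, 4, 21]))) (Branch 23 (Branch 28 (Branch 21 (Branch 8
    (Leaf [0, 6, 8, 21, 23]) (Branch 15 (Branch 31 (Branch 7 (Branch 10
    (Leaf [0, 31, 7, 10, 28]) (Branch 25 (Leaf [0, 25, 7, 15, 17]) (Leaf [20, 25, 8, 10, 18])))
    (Leaf [7, 18, 5, 8, 20])) (Leaf [20, 31, 5, 8, 18])) (Leaf [15, 20, 5, 8, 18])))
    (Leaf [4, 20, 2, 19, 21])) (Leaf [4, 20, 2, 5, 28])) (Leaf [4, 20, 2, 5, 23])))) (Branch 28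
    (Branch 25 (Branch 15 (Branch 7 (Leaf [0, 25, 7, 15, 28]) (Leaf [2, 7, 4, 5, 17]))
    (Leaf [4, 15, 2, 5, 17])) (Leaf [5, 25, 2, 4, 17])) (Leaf [17, 28, 2, 4, 5]))) (Branch 17
    (Branch 23 (Branch 14 (Branch 25 (Branch 15 (Branch 20 (Branch 22 (Branch 8
    (Leaf [0, 25, 8, 15, 23]) (Branch 10 (Leaf [3, 23, 10, 20, 22]) (Branch 27
    (Leaf [14, 25, 15, 17, 27]) (Leaf [8, 12, 10, 27, 29])))) (Leaf [2, 22, 4, 5, 12]))
    (Leaf [4, 20, 2, 5, 12])) (Leaf [4, 15, 2, 5, 12])) (Leaf [5, 25, 2, 4, 12]))
    (Leaf [5, 14, 2, 4, 12])) (Leaf [12, 23, 2, 4, 5])) (Leaf [12, 17, 2, 4, 5]))) (Branch 23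
    (Branch 8 (Branch 34 (Branch 19 (Leaf [8, 19, 0, 1, 34]) (Branch 21
    (Leaf [23, 34, 0, 8, 21]) (Branch 16 (Leaf [0, 16, 1, 8, 34]) (Leaf [16, 21, 4, 6, 19]))))
    (Leaf [13, 24, 5, 6, 34])) (Leaf [18, 29, 5, 6, 8])) (Leaf [2, 6, 4, 5, 23]))))))))"

lemma certifies_cert_1: "certifies (J5_copy G36) [3, 1, 0] [2] cert_1"
  unfolding cert_1_def G36_def by (simp add: adjacent_diff_graph diff_adj_def distances_36_def)

definition cert_2 :: split_tree where
  "cert_2 =
    Branch 6 (Branch 7 (Branch 23 (Leaf [7, 23, 4, 5, 6]) (Branch 17 (Leaf [6, 17, 4, 5, 7])
    (Branch 22 (Leaf [6, 22, 4, 5, 7]) (Branch 14 (Leaf [5, 14, 4, 6, 7]) (Branch 25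
    (Leaf [5, 25, 4, 6, 7]) (Branch 30 (Leaf [5, 30, 4, 6, 7]) (Branch 24
    (Leaf [4, 24, 5, 6, 7]) (Branch 12 (Branch 27 (Branch 20 (Branch 35
    (Leaf [1, 12, 20, 27, 35]) (Leaf [24, 35, 22, 23, 25])) (Leaf [2, 22, 20, 23, 30]))
    (Leaf [14, 25, 17, 24, 27])) (Leaf [14, 25, 12, 22, 24]))))))))) (Branch 23 (Branch 22
    (Leaf [6, 22, 4, 5, 23]) (Branch 25 (Leaf [5, 25, 4, 6, 23]) (Branch 30
    (Leaf [5, 30, 4, 6, 23]) (Branch 8 (Leaf [4, 8, 5, 6, 23]) (Branch 13
    (Leaf [4, 13, 5, 6, 23]) (Branch 24 (Leaf [4, 24, 5, 6, 23]) (Branch 9 (Branch 10 (Branch 14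
    (Branch 35 (Branch 17 (Branch 27 (Leaf [10, 35, 9, 17, 27]) (Branch 32
    (Leaf [6, 17, 9, 32, 35]) (Branch 11 (Branch 12 (Leaf [1, 12, 11, 14, 35])
    (Leaf [22, 27, 12, 24, 25])) (Leaf [3, 30, 11, 13, 32])))) (Leaf [17, 22, 7, 24, 25]))
    (Leaf [24, 35, 7, 22, 25])) (Leaf [14, 25, 7, 22, 24])) (Leaf [8, 22, 7, 10, 25]))
    (Leaf [24, 30, 7, 9, 22])))))))) (Branch 27 (Branch 19 (Leaf [1, 6, 4, 19, 27]) (Branch 25
    (Leaf [1, 6, 4, 25, 27]) (Branch 30 (Leaf [1, 6, 4, 27, 30]) (Branch 15 (Branch 9 (Branch 8
    (Leaf [1, 6, 8, 9, 27]) (Branch 10 (Branch 26 (Branch 28 (Leaf [10, 26, 9, 27, 28])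
    (Branch 35 (Leaf [1, 6, 9, 27, 35]) (Leaf [2, 7, 25, 28, 35]))) (Leaf [7, 23, 8, 25, 26]))
    (Leaf [7, 23, 8, 10, 25]))) (Branch 12 (Branch 22 (Leaf [4, 15, 5, 12, 22])
    (Leaf [19, 30, 7, 9, 22])) (Leaf [19, 30, 2, 9, 12]))) (Leaf [25, 30, 2, 15, 23])))))
    (Branch 10 (Branch 8 (Branch 18 (Leaf [1, 10, 0, 8, 18]) (Branch 29 (Leaf [1, 10, 0, 8, 29])
    (Branch 34 (Leaf [1, 10, 0, 8, 34]) (Branch 9 (Branch 11 (Leaf [1, 10, 8, 9, 11]) (Branch 21
    (Branch 32 (Leaf [21, 32, 6, 8, 9]) (Branch 19 (Leaf [8, 19, 6, 9, 21])
    (Leaf [29, 34, 11, 19, 32]))) (Leaf [18, 29, 3, 11, 21]))) (Branch 12 (Branch 30 (Branch 11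
    (Leaf [1, 12, 4, 11, 30]) (Branch 22 (Leaf [5, 30, 4, 12, 22]) (Branch 21 (Branch 32
    (Branch 19 (Leaf [21, 32, 4, 6, 19]) (Branch 17 (Leaf [6, 17, 4, 30, 32])
    (Leaf [17, 22, 7, 9, 19]))) (Leaf [11, 22, 3, 29, 32])) (Leaf [18, 29, 3, 11, 21]))))
    (Branch 28 (Branch 13 (Leaf [12, 28, 0, 10, 13]) (Branch 15 (Branch 33
    (Leaf [10, 15, 0, 12, 33]) (Branch 22 (Leaf [4, 15, 5, 12, 22]) (Leaf [22, 33, 7, 9, 30])))
    (Leaf [2, 13, 15, 23, 30]))) (Leaf [2, 7, 9, 28, 30]))) (Branch 19 (Branch 30 (Branch 11
    (Leaf [19, 30, 1, 4, 11]) (Branch 22 (Leaf [19, 30, 1, 4, 22]) (Branch 21 (Branch 32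
    (Leaf [21, 32, 4, 6, 19]) (Leaf [11, 22, 3, 29, 32])) (Leaf [18, 29, 3, 11, 21]))))
    (Leaf [2, 27, 9, 12, 30])) (Leaf [2, 27, 9, 12, 19]))))))) (Branch 26 (Branch 19 (Branch 18
    (Leaf [1, 26, 0, 18, 19]) (Branch 29 (Leaf [1, 26, 0, 19, 29]) (Branch 11 (Branch 30
    (Leaf [19, 30, 1, 4, 11]) (Branch 22 (Leaf [11, 22, 1, 4, 19]) (Branch 9
    (Leaf [4, 9, 1, 11, 19]) (Branch 12 (Leaf [1, 12, 4, 11, 19]) (Leaf [2, 22, 9, 12, 30])))))
    (Branch 21 (Branch 32 (Leaf [21, 32, 4, 6, 19]) (Branch 9 (Leaf [4, 9, 6, 19, 21])
    (Leaf [9, 29, 8, 11, 32]))) (Leaf [18, 29, 3, 11, 21]))))) (Branch 20 (Branch 9 (Branch 16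
    (Branch 14 (Leaf [1, 6, 4, 14, 16]) (Branch 24 (Leaf [1, 6, 9, 16, 24]) (Branch 35
    (Leaf [1, 6, 9, 16, 35]) (Branch 12 (Branch 22 (Leaf [5, 10, 12, 20, 22]) (Branch 17
    (Branch 32 (Branch 25 (Leaf [6, 17, 4, 25, 32]) (Leaf [24, 35, 22, 23, 25]))
    (Leaf [7, 32, 14, 22, 24])) (Leaf [7, 27, 14, 17, 24]))) (Leaf [24, 35, 12, 14, 27])))))
    (Branch 17 (Branch 18 (Leaf [0, 20, 10, 17, 18]) (Branch 15 (Branch 34
    (Leaf [0, 5, 15, 17, 34]) (Branch 32 (Branch 14 (Leaf [6, 17, 4, 14, 32]) (Branch 24
    (Leaf [6, 17, 9, 24, 32]) (Branch 35 (Leaf [6, 17, 9, 32, 35]) (Branch 12 (Branch 33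
    (Leaf [0, 5, 12, 15, 33]) (Leaf [7, 16, 14, 33, 35])) (Leaf [24, 35, 12, 14, 27])))))
    (Branch 11 (Branch 24 (Leaf [1, 26, 9, 11, 24]) (Branch 28 (Leaf [10, 26, 9, 11, 28])
    (Branch 22 (Branch 14 (Leaf [11, 22, 1, 4, 14]) (Branch 35 (Leaf [11, 22, 1, 9, 35])
    (Branch 25 (Branch 12 (Leaf [5, 25, 4, 12, 22]) (Leaf [24, 35, 12, 14, 27]))
    (Leaf [23, 28, 2, 25, 35])))) (Leaf [3, 34, 22, 24, 32])))) (Leaf [8, 19, 11, 32, 34]))))
    (Leaf [3, 8, 15, 16, 18]))) (Branch 29 (Branch 34 (Branch 24 (Leaf [0, 5, 24, 26, 34])
    (Branch 13 (Leaf [1, 10, 0, 13, 34]) (Branch 31 (Branch 14 (Branch 21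
    (Leaf [6, 31, 14, 21, 29]) (Branch 25 (Branch 22 (Leaf [14, 25, 1, 4, 22])
    (Leaf [3, 23, 21, 22, 24])) (Leaf [7, 27, 17, 24, 25]))) (Leaf [7, 16, 14, 17, 24]))
    (Leaf [13, 24, 3, 16, 31])))) (Leaf [16, 27, 17, 19, 34])) (Leaf [16, 27, 17, 19, 29]))))
    (Branch 12 (Branch 17 (Branch 22 (Leaf [5, 10, 12, 20, 22]) (Branch 30 (Branch 35 (Branch 32
    (Leaf [30, 35, 17, 20, 32]) (Leaf [7, 32, 9, 19, 22])) (Leaf [19, 35, 7, 9, 22]))
    (Leaf [19, 30, 7, 9, 22]))) (Leaf [2, 7, 9, 17, 19])) (Leaf [2, 27, 9, 12, 19]))) (Branch 12
    (Branch 17 (Branch 29 (Leaf [12, 17, 0, 10, 29]) (Branch 9 (Branch 33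
    (Leaf [0, 9, 10, 12, 33]) (Branch 30 (Branch 35 (Branch 22 (Leaf [30, 35, 1, 9, 22])
    (Branch 32 (Leaf [6, 17, 4, 30, 32]) (Leaf [20, 29, 3, 22, 32])))
    (Leaf [2, 33, 20, 23, 35])) (Leaf [2, 33, 20, 23, 30]))) (Branch 22 (Branch 25
    (Leaf [4, 10, 12, 22, 25]) (Branch 15 (Leaf [4, 15, 5, 12, 22]) (Leaf [2, 8, 15, 23, 25])))
    (Leaf [9, 20, 7, 19, 22])))) (Leaf [2, 7, 17, 19, 20])) (Leaf [2, 27, 12, 19, 20]))))
    (Branch 9 (Branch 29 (Branch 11 (Branch 14 (Leaf [4, 29, 1, 11, 14]) (Branch 19
    (Leaf [4, 9, 1, 11, 19]) (Branch 12 (Leaf [9, 29, 10, 11, 12]) (Branch 35 (Branch 24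
    (Branch 34 (Leaf [24, 35, 0, 1, 34]) (Leaf [8, 19, 26, 27, 34])) (Leaf [7, 27, 14, 24, 26]))
    (Leaf [2, 27, 12, 14, 35]))))) (Branch 24 (Branch 16 (Leaf [1, 6, 9, 16, 24])
    (Leaf [11, 16, 8, 23, 26])) (Leaf [11, 27, 3, 24, 26]))) (Leaf [3, 8, 26, 27, 29]))
    (Leaf [7, 27, 8, 9, 26])))) (Branch 20 (Branch 31 (Branch 12 (Branch 13
    (Leaf [20, 31, 5, 12, 13]) (Branch 22 (Leaf [4, 20, 5, 12, 22]) (Branch 33
    (Leaf [4, 20, 5, 12, 33]) (Branch 9 (Branch 11 (Branch 29 (Branch 14
    (Leaf [1, 12, 4, 11, 14]) (Branch 24 (Leaf [24, 29, 5, 12, 31]) (Branch 35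
    (Leaf [1, 12, 9, 11, 35]) (Leaf [24, 35, 7, 14, 22])))) (Leaf [22, 27, 3, 10, 29]))
    (Leaf [3, 23, 10, 11, 13])) (Leaf [22, 33, 7, 9, 10]))))) (Branch 9 (Branch 29 (Branch 8
    (Leaf [6, 31, 5, 8, 29]) (Branch 11 (Branch 14 (Leaf [4, 29, 1, 11, 14]) (Branch 35
    (Branch 24 (Leaf [24, 35, 1, 9, 11]) (Branch 22 (Leaf [11, 22, 1, 9, 35])
    (Leaf [22, 27, 12, 14, 24]))) (Leaf [2, 27, 12, 14, 35]))) (Branch 34 (Branch 21 (Branch 13
    (Leaf [0, 6, 13, 21, 34]) (Leaf [3, 12, 10, 11, 13])) (Leaf [10, 21, 8, 11, 23]))
    (Leaf [23, 34, 8, 10, 11])))) (Leaf [3, 12, 10, 27, 29])) (Leaf [2, 27, 9, 10, 12])))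
    (Leaf [3, 23, 2, 10, 31])) (Leaf [3, 23, 2, 10, 20])))))) (Branch 7 (Branch 17 (Branch 22
    (Leaf [17, 22, 4, 5, 7]) (Branch 28 (Leaf [17, 28, 4, 5, 7]) (Branch 14
    (Leaf [5, 14, 4, 7, 17]) (Branch 25 (Leaf [5, 25, 4, 7, 17]) (Branch 30
    (Leaf [5, 30, 4, 7, 17]) (Branch 15 (Leaf [4, 15, 5, 7, 17]) (Branch 20
    (Leaf [4, 20, 5, 7, 17]) (Branch 12 (Branch 13 (Branch 23 (Branch 10
    (Leaf [12, 23, 0, 10, 13]) (Leaf [3, 28, 2, 10, 20])) (Leaf [25, 30, 15, 22, 23]))
    (Leaf [25, 30, 13, 15, 28])) (Leaf [2, 22, 12, 14, 15]))))))))) (Branch 22 (Branch 33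
    (Leaf [22, 33, 4, 5, 7]) (Branch 12 (Leaf [7, 12, 4, 5, 22]) (Branch 23
    (Leaf [7, 23, 4, 5, 22]) (Branch 25 (Leaf [5, 25, 4, 7, 22]) (Branch 30
    (Leaf [5, 30, 4, 7, 22]) (Branch 24 (Leaf [4, 24, 5, 7, 22]) (Branch 35 (Branch 9
    (Leaf [1, 7, 9, 22, 35]) (Leaf [2, 33, 9, 12, 30])) (Leaf [24, 35, 6, 23, 25]))))))))
    (Branch 21 (Branch 8 (Branch 18 (Leaf [1, 21, 0, 8, 18]) (Branch 29 (Leaf [1, 21, 0, 8, 29])
    (Branch 15 (Leaf [0, 5, 7, 8, 15]) (Branch 26 (Leaf [0, 5, 7, 8, 26]) (Branch 25 (Branch 30
    (Branch 27 (Leaf [25, 30, 1, 4, 27]) (Leaf [6, 26, 3, 27, 29])) (Leaf [2, 18, 15, 17, 30]))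
    (Leaf [2, 18, 15, 17, 25])))))) (Branch 24 (Branch 34 (Leaf [1, 21, 0, 24, 34]) (Branch 26
    (Leaf [0, 5, 7, 24, 26]) (Branch 16 (Branch 27 (Branch 19 (Leaf [16, 27, 1, 4, 19])
    (Branch 9 (Leaf [16, 27, 1, 9, 24]) (Leaf [17, 26, 2, 9, 19]))) (Leaf [6, 26, 8, 27, 34]))
    (Leaf [6, 26, 8, 16, 34])))) (Branch 32 (Branch 26 (Branch 28 (Leaf [4, 26, 5, 7, 28])
    (Branch 9 (Branch 19 (Leaf [0, 9, 7, 19, 26]) (Branch 27 (Branch 30 (Leaf [4, 9, 1, 27, 30])
    (Branch 20 (Branch 35 (Leaf [9, 20, 1, 27, 35]) (Branch 25 (Branch 12
    (Leaf [1, 12, 4, 25, 27]) (Branch 14 (Branch 29 (Leaf [1, 26, 14, 27, 29])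
    (Leaf [19, 30, 12, 22, 29])) (Leaf [24, 35, 12, 14, 22]))) (Leaf [17, 28, 2, 25, 35])))
    (Leaf [19, 30, 2, 17, 20]))) (Branch 16 (Branch 29 (Branch 14 (Leaf [1, 26, 14, 16, 29])
    (Leaf [3, 14, 6, 24, 27])) (Leaf [24, 29, 3, 6, 27])) (Leaf [16, 27, 3, 6, 24]))))
    (Branch 10 (Branch 30 (Branch 11 (Leaf [1, 32, 4, 11, 30]) (Branch 27 (Branch 12 (Branch 25
    (Leaf [4, 10, 12, 25, 27]) (Branch 15 (Leaf [4, 15, 12, 27, 30]) (Branch 23 (Branch 13
    (Leaf [12, 23, 0, 10, 13]) (Leaf [2, 13, 15, 25, 28])) (Leaf [2, 8, 15, 23, 25]))))
    (Leaf [11, 22, 9, 12, 24])) (Leaf [8, 24, 6, 9, 27]))) (Leaf [17, 28, 2, 9, 30]))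
    (Leaf [17, 28, 2, 9, 10])))) (Branch 16 (Branch 27 (Branch 14 (Leaf [16, 27, 1, 4, 14])
    (Branch 19 (Leaf [16, 27, 1, 4, 19]) (Branch 9 (Branch 11 (Branch 35
    (Leaf [11, 16, 1, 9, 35]) (Branch 12 (Branch 25 (Leaf [1, 12, 4, 25, 27])
    (Leaf [14, 25, 2, 17, 35])) (Leaf [12, 17, 2, 14, 35]))) (Leaf [3, 14, 11, 24, 26]))
    (Leaf [17, 26, 2, 9, 19])))) (Leaf [6, 26, 3, 24, 27])) (Leaf [6, 26, 3, 16, 24])))
    (Leaf [6, 22, 3, 24, 32])))) (Branch 20 (Branch 24 (Branch 28 (Leaf [4, 20, 5, 7, 28])
    (Branch 31 (Branch 8 (Leaf [20, 31, 5, 7, 8]) (Branch 23 (Leaf [7, 23, 5, 24, 31])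
    (Branch 34 (Leaf [7, 34, 5, 24, 31]) (Leaf [23, 34, 6, 8, 21]))))
    (Leaf [3, 28, 2, 21, 31]))) (Leaf [6, 22, 3, 21, 24])) (Leaf [2, 22, 3, 20, 21])))))
    (Branch 8 (Branch 11 (Branch 18 (Leaf [0, 11, 1, 8, 18]) (Branch 29 (Leaf [0, 11, 1, 8, 29])
    (Branch 34 (Leaf [0, 11, 1, 8, 34]) (Branch 21 (Branch 19 (Leaf [1, 21, 4, 11, 19])
    (Branch 27 (Branch 9 (Leaf [1, 21, 8, 9, 11]) (Branch 30 (Leaf [11, 27, 1, 4, 30])
    (Leaf [19, 30, 6, 7, 9]))) (Leaf [29, 34, 6, 19, 27]))) (Leaf [18, 29, 3, 6, 21])))))
    (Branch 18 (Branch 10 (Leaf [1, 10, 0, 8, 18]) (Branch 21 (Leaf [1, 21, 0, 8, 18])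
    (Branch 20 (Leaf [0, 20, 1, 8, 18]) (Leaf [10, 21, 2, 3, 20])))) (Branch 21 (Branch 29
    (Leaf [1, 21, 0, 8, 29]) (Branch 16 (Branch 10 (Branch 26 (Branch 32 (Branch 9
    (Leaf [1, 26, 8, 9, 16]) (Branch 23 (Leaf [0, 5, 8, 23, 26]) (Branch 13 (Branch 28
    (Leaf [10, 21, 0, 13, 28]) (Branch 14 (Leaf [4, 13, 1, 14, 16]) (Branch 27 (Branch 30
    (Branch 20 (Leaf [1, 10, 8, 20, 27]) (Branch 25 (Leaf [1, 10, 8, 25, 27]) (Branch 15
    (Branch 17 (Leaf [13, 17, 15, 30, 32]) (Branch 19 (Leaf [16, 27, 1, 4, 19])
    (Leaf [2, 7, 17, 19, 20]))) (Leaf [2, 7, 15, 25, 28])))) (Leaf [6, 28, 7, 9, 30]))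
    (Leaf [3, 14, 6, 27, 29])))) (Branch 30 (Branch 22 (Leaf [1, 32, 4, 22, 30]) (Branch 19
    (Branch 24 (Branch 14 (Leaf [1, 26, 14, 16, 24]) (Branch 27 (Leaf [16, 27, 1, 4, 19])
    (Leaf [3, 14, 6, 27, 29]))) (Leaf [6, 22, 7, 9, 24])) (Leaf [6, 22, 7, 9, 19])))
    (Leaf [6, 11, 13, 23, 30]))))) (Leaf [6, 11, 3, 29, 32])) (Leaf [18, 29, 3, 11, 26]))
    (Leaf [18, 29, 3, 10, 11])) (Leaf [18, 29, 3, 6, 16]))) (Leaf [6, 11, 3, 18, 21]))))
    (Branch 9 (Branch 16 (Branch 19 (Leaf [4, 9, 1, 16, 19]) (Branch 27 (Branch 14
    (Leaf [16, 27, 1, 4, 14]) (Branch 24 (Leaf [16, 27, 1, 9, 24]) (Branch 35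
    (Leaf [16, 27, 1, 9, 35]) (Leaf [24, 35, 6, 7, 14])))) (Branch 29 (Branch 34 (Branch 14
    (Leaf [4, 29, 1, 14, 16]) (Branch 24 (Leaf [9, 34, 1, 16, 24]) (Branch 35
    (Leaf [9, 34, 1, 16, 35]) (Leaf [24, 35, 6, 7, 14])))) (Leaf [8, 19, 6, 27, 34]))
    (Leaf [3, 8, 6, 27, 29])))) (Branch 18 (Branch 29 (Branch 19 (Leaf [18, 29, 0, 1, 19])
    (Branch 34 (Branch 35 (Leaf [18, 34, 0, 1, 35]) (Branch 25 (Branch 14 (Branch 23 (Branch 22
    (Leaf [14, 25, 1, 4, 22]) (Branch 27 (Leaf [14, 25, 1, 4, 27]) (Branch 11
    (Leaf [4, 29, 1, 11, 14]) (Branch 24 (Branch 33 (Leaf [5, 25, 4, 23, 33]) (Branch 26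
    (Leaf [23, 34, 5, 24, 26]) (Branch 31 (Leaf [23, 34, 5, 24, 31]) (Branch 10 (Branch 20
    (Branch 13 (Leaf [0, 20, 10, 13, 23]) (Branch 28 (Leaf [0, 20, 10, 18, 28])
    (Leaf [3, 28, 11, 13, 26]))) (Leaf [19, 35, 7, 20, 22])) (Leaf [8, 33, 7, 10, 31])))))
    (Leaf [16, 27, 3, 6, 24]))))) (Leaf [8, 35, 6, 16, 23])) (Leaf [7, 16, 6, 14, 35]))
    (Leaf [8, 35, 6, 7, 25]))) (Leaf [8, 19, 6, 16, 34]))) (Leaf [3, 8, 6, 16, 29]))
    (Leaf [3, 8, 6, 16, 18]))) (Branch 25 (Branch 24 (Branch 27 (Branch 26
    (Leaf [1, 26, 24, 25, 27]) (Leaf [6, 26, 7, 8, 9])) (Leaf [7, 27, 6, 8, 9]))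
    (Leaf [8, 24, 6, 7, 9])) (Leaf [9, 25, 6, 7, 8])))))"

lemma certifies_cert_2: "certifies (J5_copy G36) [5, 4, 1, 0] [3, 2] cert_2"
  unfolding cert_2_def G36_def by (simp add: adjacent_diff_graph diff_adj_def distances_36_def)

definition cert_3 :: split_tree where
  "cert_3 =
    Branch 15 (Branch 20 (Branch 19 (Branch 18 (Leaf [0, 20, 1, 18, 19]) (Branch 22
    (Leaf [4, 20, 1, 19, 22]) (Branch 26 (Branch 29 (Leaf [1, 26, 0, 19, 29]) (Branch 6
    (Branch 21 (Branch 32 (Leaf [21, 32, 4, 6, 19]) (Leaf [5, 32, 3, 22, 29]))
    (Leaf [5, 21, 3, 22, 29])) (Leaf [18, 29, 3, 5, 6]))) (Leaf [2, 18, 3, 5, 26])))) (Branch 26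
    (Branch 31 (Branch 8 (Branch 7 (Leaf [15, 26, 0, 7, 8]) (Branch 18 (Leaf [1, 15, 0, 8, 18])
    (Branch 23 (Leaf [15, 26, 0, 8, 23]) (Branch 29 (Leaf [1, 26, 0, 8, 29]) (Branch 34
    (Leaf [1, 15, 0, 8, 34]) (Branch 6 (Branch 10 (Branch 27 (Leaf [1, 10, 8, 20, 27])
    (Branch 17 (Branch 11 (Branch 9 (Leaf [1, 10, 8, 9, 11]) (Branch 12 (Branch 33
    (Leaf [0, 20, 10, 12, 33]) (Branch 30 (Leaf [1, 12, 4, 11, 30]) (Branch 22 (Branch 35
    (Leaf [10, 35, 12, 20, 22]) (Leaf [30, 35, 7, 9, 33])) (Leaf [19, 30, 7, 9, 22]))))
    (Leaf [2, 27, 9, 12, 19]))) (Branch 21 (Branch 32 (Branch 12 (Branch 30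
    (Leaf [4, 15, 17, 30, 32]) (Branch 33 (Leaf [10, 15, 0, 12, 33]) (Branch 9
    (Leaf [21, 32, 6, 8, 9]) (Branch 22 (Branch 35 (Leaf [10, 35, 12, 20, 22])
    (Leaf [30, 35, 7, 9, 33])) (Leaf [19, 30, 7, 9, 22]))))) (Leaf [11, 27, 12, 19, 29]))
    (Leaf [29, 34, 11, 19, 32])) (Leaf [18, 29, 3, 11, 21]))) (Leaf [29, 34, 17, 19, 27])))
    (Branch 11 (Branch 22 (Branch 9 (Leaf [1, 26, 8, 9, 11]) (Branch 28 (Branch 13
    (Leaf [0, 11, 13, 26, 28]) (Branch 12 (Branch 25 (Leaf [1, 12, 4, 22, 25])
    (Leaf [2, 13, 10, 23, 25])) (Leaf [10, 19, 2, 9, 12]))) (Leaf [2, 7, 9, 10, 28])))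
    (Leaf [5, 10, 3, 22, 29])) (Leaf [18, 29, 3, 10, 11]))) (Leaf [18, 29, 3, 5, 6])))))))
    (Branch 18 (Branch 28 (Leaf [15, 26, 0, 18, 28]) (Branch 33 (Leaf [15, 26, 0, 18, 33])
    (Branch 35 (Leaf [0, 20, 1, 18, 35]) (Branch 7 (Branch 17 (Leaf [7, 18, 0, 15, 17])
    (Branch 9 (Branch 25 (Branch 22 (Leaf [1, 7, 4, 22, 25]) (Branch 24 (Leaf [0, 9, 7, 24, 26])
    (Branch 6 (Branch 32 (Leaf [7, 32, 4, 6, 25]) (Leaf [5, 32, 3, 22, 24]))
    (Leaf [6, 22, 3, 5, 24])))) (Leaf [17, 28, 2, 25, 35])) (Leaf [19, 35, 2, 9, 17])))
    (Branch 9 (Branch 25 (Branch 17 (Leaf [0, 25, 15, 17, 18]) (Branch 14 (Branch 22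
    (Leaf [14, 25, 1, 4, 22]) (Branch 24 (Branch 16 (Leaf [1, 26, 9, 16, 24]) (Branch 34
    (Leaf [1, 26, 0, 24, 34]) (Leaf [19, 35, 16, 17, 34]))) (Leaf [17, 22, 5, 7, 24])))
    (Leaf [17, 33, 7, 14, 35]))) (Leaf [28, 33, 7, 25, 35])) (Leaf [28, 33, 7, 9, 35]))))))
    (Branch 6 (Branch 13 (Branch 23 (Leaf [15, 26, 0, 13, 23]) (Branch 28
    (Leaf [15, 26, 0, 13, 28]) (Branch 34 (Leaf [1, 15, 0, 13, 34]) (Branch 25 (Branch 27
    (Leaf [1, 6, 4, 25, 27]) (Branch 32 (Leaf [4, 13, 6, 25, 32]) (Branch 11 (Branch 12
    (Leaf [0, 25, 12, 13, 15]) (Branch 14 (Leaf [4, 13, 1, 11, 14]) (Branch 30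
    (Leaf [4, 13, 1, 11, 30]) (Branch 9 (Branch 24 (Leaf [1, 26, 9, 11, 24]) (Branch 22
    (Branch 35 (Leaf [11, 22, 1, 9, 35]) (Leaf [24, 35, 12, 14, 27]))
    (Leaf [22, 27, 12, 14, 24]))) (Leaf [19, 30, 2, 9, 12]))))) (Leaf [8, 19, 11, 32, 34]))))
    (Branch 10 (Branch 35 (Branch 12 (Leaf [0, 20, 10, 12, 13]) (Branch 9 (Branch 22
    (Leaf [9, 20, 1, 22, 35]) (Branch 24 (Branch 32 (Leaf [24, 35, 6, 9, 32]) (Branch 11
    (Leaf [1, 26, 9, 11, 24]) (Leaf [8, 19, 11, 32, 34]))) (Leaf [3, 12, 5, 22, 24])))
    (Branch 30 (Branch 27 (Leaf [1, 6, 4, 27, 30]) (Leaf [2, 27, 9, 12, 19]))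
    (Leaf [19, 30, 2, 9, 12])))) (Leaf [23, 28, 2, 25, 35])) (Leaf [23, 28, 2, 10, 25]))))))
    (Branch 27 (Branch 30 (Leaf [4, 20, 1, 27, 30]) (Branch 14 (Leaf [1, 6, 4, 14, 27])
    (Branch 25 (Leaf [1, 6, 4, 25, 27]) (Branch 9 (Branch 35 (Leaf [9, 20, 1, 27, 35])
    (Branch 12 (Branch 17 (Branch 10 (Leaf [12, 17, 9, 10, 27]) (Branch 33 (Branch 23
    (Leaf [12, 23, 0, 15, 33]) (Leaf [2, 8, 10, 23, 25])) (Leaf [8, 33, 10, 18, 25])))
    (Leaf [14, 25, 2, 17, 35])) (Leaf [14, 25, 2, 12, 35]))) (Branch 12 (Branch 17 (Branch 10
    (Leaf [12, 17, 10, 20, 27]) (Branch 28 (Branch 7 (Leaf [17, 28, 0, 7, 15])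
    (Leaf [9, 25, 7, 8, 10])) (Leaf [2, 13, 10, 25, 28]))) (Leaf [19, 30, 2, 9, 17]))
    (Leaf [19, 30, 2, 9, 12])))))) (Branch 10 (Branch 7 (Branch 17 (Leaf [10, 15, 0, 7, 17])
    (Branch 28 (Leaf [10, 15, 0, 7, 28]) (Branch 9 (Branch 30 (Leaf [4, 9, 6, 7, 30]) (Branch 24
    (Leaf [6, 26, 7, 9, 24]) (Branch 22 (Leaf [9, 20, 7, 10, 22]) (Branch 11 (Branch 34
    (Branch 29 (Branch 14 (Leaf [4, 29, 1, 11, 14]) (Branch 35 (Leaf [9, 34, 1, 11, 35])
    (Branch 25 (Branch 32 (Leaf [7, 32, 4, 6, 25]) (Leaf [5, 32, 3, 22, 24]))
    (Leaf [14, 25, 2, 17, 35])))) (Leaf [19, 30, 17, 27, 29])) (Leaf [5, 27, 17, 24, 34]))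
    (Leaf [13, 18, 11, 28, 30]))))) (Leaf [2, 27, 9, 17, 19])))) (Branch 34 (Branch 17
    (Leaf [10, 15, 0, 17, 34]) (Branch 24 (Leaf [1, 26, 0, 24, 34]) (Branch 22 (Branch 14
    (Branch 25 (Leaf [14, 25, 1, 4, 22]) (Leaf [5, 25, 7, 17, 24])) (Leaf [5, 14, 7, 17, 24]))
    (Leaf [17, 22, 5, 7, 24])))) (Branch 14 (Branch 16 (Leaf [1, 6, 4, 14, 16]) (Branch 17
    (Branch 32 (Leaf [6, 17, 4, 14, 32]) (Branch 11 (Branch 29 (Leaf [1, 26, 11, 14, 29])
    (Branch 22 (Leaf [11, 22, 1, 4, 14]) (Leaf [29, 34, 19, 22, 32])))
    (Leaf [3, 34, 11, 13, 32]))) (Leaf [18, 34, 16, 17, 19]))) (Branch 12 (Branch 33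
    (Leaf [10, 15, 0, 12, 33]) (Branch 29 (Leaf [0, 31, 10, 12, 29]) (Branch 17 (Branch 9
    (Branch 22 (Leaf [9, 20, 10, 12, 22]) (Branch 21 (Branch 32 (Branch 24
    (Leaf [21, 32, 6, 9, 24]) (Leaf [24, 29, 3, 5, 22])) (Leaf [29, 34, 19, 22, 32]))
    (Leaf [29, 34, 19, 21, 22]))) (Branch 35 (Branch 22 (Leaf [10, 35, 12, 20, 22]) (Branch 32
    (Branch 30 (Leaf [6, 17, 4, 30, 32]) (Leaf [19, 30, 7, 9, 22])) (Leaf [9, 29, 19, 22, 32])))
    (Leaf [9, 14, 7, 33, 35]))) (Leaf [29, 34, 17, 19, 27])))) (Branch 9 (Branch 35 (Branch 22
    (Leaf [9, 20, 1, 22, 35]) (Branch 24 (Branch 32 (Leaf [24, 35, 6, 9, 32]) (Branch 11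
    (Leaf [1, 26, 9, 11, 24]) (Leaf [12, 32, 11, 13, 14]))) (Leaf [3, 7, 5, 22, 24])))
    (Leaf [2, 27, 12, 14, 35])) (Leaf [2, 27, 9, 12, 19])))))) (Branch 11 (Branch 25 (Branch 29
    (Branch 14 (Leaf [1, 26, 11, 14, 29]) (Branch 28 (Leaf [0, 11, 26, 28, 29]) (Branch 30
    (Leaf [4, 29, 1, 11, 30]) (Branch 9 (Branch 24 (Leaf [1, 26, 9, 11, 24]) (Branch 7
    (Branch 23 (Leaf [7, 23, 4, 6, 25]) (Branch 22 (Leaf [6, 22, 4, 7, 25])
    (Leaf [3, 23, 5, 22, 24]))) (Branch 22 (Branch 12 (Leaf [4, 15, 12, 22, 25]) (Branch 35
    (Leaf [11, 22, 1, 9, 35]) (Leaf [24, 35, 12, 14, 27]))) (Leaf [3, 7, 5, 22, 24]))))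
    (Leaf [10, 30, 2, 9, 28]))))) (Leaf [3, 8, 10, 27, 29])) (Leaf [18, 27, 8, 10, 25]))
    (Leaf [13, 18, 3, 10, 11]))))) (Leaf [3, 8, 5, 6, 18])))) (Branch 10 (Branch 12 (Branch 13
    (Leaf [0, 20, 10, 12, 13]) (Leaf [2, 13, 3, 5, 31])) (Leaf [3, 12, 2, 5, 31]))
    (Leaf [5, 10, 2, 3, 31]))) (Branch 23 (Branch 28 (Branch 13 (Leaf [23, 28, 0, 13, 15])
    (Leaf [2, 13, 3, 5, 26])) (Leaf [3, 28, 2, 5, 26])) (Leaf [3, 23, 2, 5, 26])))) (Branch 31
    (Branch 10 (Branch 21 (Branch 23 (Branch 28 (Branch 22 (Branch 33 (Leaf [22, 33, 4, 21, 23])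
    (Branch 30 (Leaf [21, 30, 4, 22, 23]) (Branch 7 (Leaf [0, 31, 7, 10, 28])
    (Leaf [5, 30, 7, 20, 33])))) (Leaf [2, 22, 3, 5, 20])) (Leaf [3, 28, 2, 5, 20]))
    (Leaf [3, 23, 2, 5, 20])) (Leaf [5, 21, 2, 3, 20])) (Leaf [5, 10, 2, 3, 20]))
    (Leaf [20, 31, 2, 3, 5]))) (Branch 26 (Branch 23 (Branch 28 (Branch 13
    (Leaf [23, 28, 0, 13, 26]) (Leaf [2, 13, 3, 5, 15])) (Leaf [3, 28, 2, 5, 15]))
    (Leaf [3, 23, 2, 5, 15])) (Leaf [15, 26, 2, 3, 5]))"

lemma certifies_cert_3: "certifies (J5_copy G36) [4, 1, 0] [5, 3, 2] cert_3"
  unfolding cert_3_def G36_def by (simp add: adjacent_diff_graph diff_adj_def distances_36_def)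

definition cert_4 :: split_tree where
  "cert_4 =
    Branch 5 (Branch 21 (Branch 34 (Branch 8 (Leaf [1, 21, 0, 8, 34]) (Branch 13
    (Leaf [1, 21, 0, 13, 34]) (Branch 19 (Leaf [1, 21, 0, 19, 34]) (Branch 24
    (Leaf [1, 21, 0, 24, 34]) (Branch 17 (Branch 35 (Leaf [1, 17, 0, 34, 35]) (Branch 15
    (Leaf [0, 5, 15, 17, 34]) (Branch 10 (Branch 7 (Leaf [7, 34, 0, 10, 17]) (Branch 18
    (Leaf [18, 34, 0, 10, 17]) (Branch 29 (Leaf [29, 34, 0, 10, 17]) (Branch 33
    (Leaf [17, 33, 0, 10, 34]) (Branch 25 (Branch 30 (Branch 27 (Leaf [25, 34, 10, 17, 27])
    (Branch 12 (Branch 20 (Branch 6 (Branch 22 (Leaf [20, 25, 10, 12, 22]) (Branch 32 (Branch 9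
    (Leaf [6, 17, 9, 30, 32]) (Leaf [19, 24, 7, 9, 22])) (Leaf [4, 29, 19, 22, 32])))
    (Leaf [4, 24, 3, 6, 27])) (Leaf [7, 18, 20, 33, 35])) (Leaf [4, 29, 12, 19, 27])))
    (Leaf [4, 15, 7, 30, 33])) (Leaf [8, 33, 7, 15, 25])))))) (Branch 20 (Branch 31 (Branch 33
    (Leaf [0, 31, 21, 33, 34]) (Branch 7 (Branch 28 (Leaf [17, 28, 5, 7, 20]) (Branch 18
    (Leaf [7, 18, 5, 17, 20]) (Branch 30 (Leaf [5, 30, 7, 17, 20])
    (Leaf [28, 33, 15, 18, 30])))) (Branch 9 (Branch 14 (Branch 30 (Branch 27
    (Leaf [1, 17, 9, 27, 30]) (Branch 29 (Branch 16 (Leaf [1, 17, 14, 16, 29]) (Branch 18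
    (Leaf [5, 30, 17, 18, 20]) (Leaf [3, 8, 15, 16, 18]))) (Leaf [3, 8, 10, 27, 29])))
    (Leaf [4, 15, 7, 30, 33])) (Leaf [4, 15, 7, 14, 33])) (Leaf [8, 33, 7, 9, 10]))))
    (Leaf [2, 13, 3, 10, 31])) (Leaf [2, 13, 3, 10, 20]))))) (Branch 30 (Branch 12 (Branch 9
    (Branch 27 (Leaf [1, 12, 9, 27, 30]) (Leaf [2, 27, 4, 17, 19])) (Leaf [4, 9, 2, 17, 19]))
    (Leaf [12, 17, 2, 4, 19])) (Leaf [19, 30, 2, 4, 17]))))))) (Branch 8 (Branch 18
    (Leaf [1, 21, 0, 8, 18]) (Branch 29 (Leaf [1, 21, 0, 8, 29]) (Branch 10 (Branch 23
    (Leaf [10, 21, 0, 8, 23]) (Branch 25 (Branch 7 (Leaf [0, 25, 7, 8, 10]) (Branch 27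
    (Leaf [1, 10, 8, 25, 27]) (Branch 6 (Branch 12 (Branch 13 (Leaf [0, 25, 10, 12, 13])
    (Branch 33 (Leaf [0, 25, 10, 12, 33]) (Branch 30 (Branch 15 (Branch 32
    (Leaf [6, 15, 8, 25, 32]) (Branch 22 (Leaf [5, 25, 12, 15, 22]) (Branch 31 (Branch 14
    (Branch 24 (Leaf [12, 21, 14, 24, 31]) (Leaf [3, 34, 22, 24, 32]))
    (Leaf [4, 29, 14, 22, 32])) (Leaf [3, 34, 13, 31, 32])))) (Branch 16 (Branch 9
    (Leaf [16, 21, 6, 8, 9]) (Branch 14 (Branch 32 (Branch 24 (Leaf [1, 6, 14, 16, 24])
    (Branch 35 (Leaf [1, 6, 14, 16, 35]) (Branch 17 (Branch 20 (Branch 22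
    (Leaf [17, 22, 20, 30, 32]) (Leaf [24, 35, 7, 9, 22])) (Leaf [2, 33, 20, 23, 35]))
    (Leaf [9, 34, 17, 24, 27])))) (Leaf [3, 34, 13, 15, 32])) (Leaf [4, 15, 7, 14, 33])))
    (Leaf [13, 18, 3, 15, 16]))) (Leaf [2, 33, 4, 23, 30])))) (Branch 14 (Branch 19 (Branch 9
    (Leaf [8, 19, 6, 9, 21]) (Branch 35 (Branch 22 (Leaf [14, 25, 1, 22, 35]) (Branch 32
    (Leaf [8, 35, 6, 25, 32]) (Leaf [4, 29, 3, 22, 32]))) (Leaf [2, 27, 9, 12, 35])))
    (Leaf [2, 27, 4, 12, 19])) (Leaf [2, 27, 4, 12, 14]))) (Leaf [4, 29, 3, 6, 27]))))
    (Branch 12 (Branch 15 (Branch 22 (Branch 33 (Leaf [22, 33, 5, 12, 15])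
    (Leaf [2, 33, 4, 23, 25])) (Leaf [2, 22, 4, 23, 25])) (Leaf [4, 15, 2, 23, 25]))
    (Leaf [12, 23, 2, 4, 25])))) (Branch 11 (Branch 20 (Branch 31 (Branch 7
    (Leaf [20, 31, 5, 7, 8]) (Branch 23 (Leaf [20, 31, 5, 8, 23]) (Branch 9
    (Leaf [1, 21, 8, 9, 11]) (Branch 28 (Branch 13 (Leaf [5, 21, 13, 20, 28]) (Branch 25
    (Branch 27 (Leaf [20, 25, 1, 8, 27]) (Branch 22 (Branch 12 (Branch 15
    (Leaf [5, 25, 12, 15, 22]) (Branch 30 (Leaf [5, 30, 12, 20, 22])
    (Leaf [2, 13, 15, 23, 30]))) (Leaf [2, 27, 9, 10, 12])) (Leaf [22, 27, 3, 10, 29])))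
    (Leaf [4, 10, 2, 23, 25]))) (Leaf [2, 7, 9, 10, 28]))))) (Leaf [2, 18, 3, 10, 31]))
    (Leaf [2, 18, 3, 10, 20])) (Leaf [18, 29, 3, 10, 11]))))) (Branch 19 (Branch 18
    (Leaf [1, 21, 0, 18, 19]) (Branch 29 (Leaf [1, 21, 0, 19, 29]) (Branch 9 (Branch 11
    (Leaf [1, 21, 9, 11, 19]) (Branch 26 (Branch 32 (Branch 6 (Leaf [21, 32, 6, 9, 19])
    (Branch 16 (Leaf [1, 26, 9, 16, 19]) (Leaf [3, 8, 6, 16, 18]))) (Leaf [3, 8, 11, 29, 32]))
    (Leaf [3, 8, 11, 18, 26]))) (Branch 10 (Branch 30 (Branch 20 (Branch 22
    (Leaf [19, 30, 1, 20, 22]) (Branch 27 (Leaf [19, 30, 1, 20, 27]) (Branch 6 (Branch 32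
    (Branch 26 (Branch 17 (Leaf [19, 30, 17, 20, 32]) (Branch 24 (Branch 7
    (Leaf [19, 24, 0, 7, 26]) (Branch 14 (Leaf [21, 32, 6, 14, 24]) (Leaf [17, 22, 4, 7, 14])))
    (Leaf [9, 34, 17, 24, 27]))) (Leaf [9, 29, 8, 26, 27])) (Leaf [4, 29, 3, 22, 32]))
    (Leaf [4, 29, 3, 6, 27])))) (Branch 7 (Branch 17 (Leaf [10, 19, 0, 7, 17]) (Branch 35
    (Branch 28 (Leaf [10, 35, 0, 7, 28]) (Branch 25 (Branch 22 (Leaf [10, 35, 7, 22, 25])
    (Branch 32 (Branch 6 (Leaf [7, 32, 6, 25, 35]) (Branch 27 (Branch 12
    (Leaf [10, 35, 12, 25, 27]) (Branch 14 (Leaf [14, 25, 1, 27, 35])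
    (Leaf [12, 17, 2, 4, 14]))) (Leaf [3, 8, 6, 27, 29]))) (Leaf [4, 20, 3, 22, 32])))
    (Leaf [17, 28, 2, 4, 25]))) (Leaf [9, 20, 2, 17, 35]))) (Branch 6 (Branch 13 (Branch 23
    (Leaf [10, 21, 0, 13, 23]) (Branch 28 (Leaf [10, 21, 0, 13, 28]) (Branch 25 (Branch 35
    (Branch 32 (Leaf [25, 30, 6, 13, 32]) (Branch 11 (Branch 12 (Leaf [0, 11, 10, 12, 13])
    (Branch 14 (Leaf [1, 21, 11, 13, 14]) (Branch 27 (Branch 17 (Leaf [10, 35, 17, 25, 27])
    (Leaf [4, 29, 14, 17, 32])) (Leaf [4, 29, 12, 14, 27])))) (Leaf [9, 29, 8, 11, 32])))
    (Leaf [23, 28, 2, 20, 35])) (Leaf [23, 28, 2, 4, 25])))) (Branch 17 (Branch 15 (Branch 22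
    (Branch 12 (Leaf [5, 30, 12, 15, 22]) (Branch 23 (Leaf [5, 30, 15, 22, 23]) (Branch 32
    (Leaf [17, 22, 15, 30, 32]) (Branch 25 (Branch 35 (Branch 11 (Branch 27
    (Leaf [25, 30, 15, 17, 27]) (Branch 14 (Leaf [11, 22, 1, 14, 35])
    (Leaf [2, 27, 4, 12, 14]))) (Leaf [4, 13, 3, 11, 32])) (Leaf [9, 20, 2, 12, 35]))
    (Leaf [12, 23, 2, 4, 25]))))) (Branch 32 (Branch 35 (Branch 14 (Leaf [15, 35, 14, 17, 32])
    (Branch 33 (Leaf [17, 33, 15, 30, 32]) (Leaf [22, 33, 4, 7, 14])))
    (Leaf [9, 20, 7, 22, 35])) (Leaf [13, 22, 3, 20, 32]))) (Branch 32 (Branch 25 (Branch 24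
    (Leaf [6, 17, 24, 25, 32]) (Branch 35 (Leaf [6, 17, 25, 32, 35]) (Branch 12 (Branch 22
    (Branch 33 (Leaf [22, 33, 10, 12, 25]) (Leaf [9, 20, 7, 33, 35])) (Leaf [24, 35, 7, 9, 22]))
    (Leaf [9, 20, 2, 12, 35])))) (Leaf [7, 18, 8, 15, 25])) (Leaf [15, 20, 3, 13, 32])))
    (Branch 35 (Branch 14 (Branch 25 (Branch 27 (Leaf [14, 25, 6, 27, 35]) (Branch 32
    (Leaf [14, 25, 6, 32, 35]) (Branch 11 (Branch 24 (Leaf [1, 21, 11, 14, 24])
    (Leaf [7, 27, 9, 17, 24])) (Leaf [9, 29, 8, 11, 32])))) (Leaf [2, 7, 4, 17, 25]))
    (Leaf [2, 7, 4, 14, 17])) (Leaf [9, 20, 2, 17, 35])))) (Branch 27 (Branch 25 (Branch 24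
    (Branch 26 (Leaf [1, 26, 24, 25, 27]) (Leaf [6, 26, 7, 8, 9])) (Leaf [8, 24, 6, 7, 9]))
    (Leaf [9, 25, 6, 7, 8])) (Leaf [4, 29, 3, 6, 27]))))) (Branch 12 (Branch 17 (Branch 28
    (Branch 7 (Leaf [17, 28, 0, 7, 10]) (Branch 13 (Leaf [12, 28, 0, 10, 13]) (Branch 22
    (Branch 33 (Branch 25 (Leaf [22, 33, 10, 12, 25]) (Branch 15 (Leaf [0, 5, 12, 15, 33])
    (Branch 23 (Leaf [12, 23, 0, 10, 33]) (Leaf [25, 30, 13, 15, 23]))))
    (Leaf [4, 9, 7, 30, 33])) (Leaf [4, 9, 7, 22, 30])))) (Leaf [4, 9, 2, 28, 30]))
    (Leaf [4, 9, 2, 17, 30])) (Leaf [4, 9, 2, 12, 30]))) (Branch 20 (Branch 27 (Branch 12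
    (Leaf [1, 12, 19, 20, 27]) (Branch 17 (Leaf [1, 17, 19, 20, 27]) (Branch 30
    (Leaf [19, 30, 1, 20, 27]) (Leaf [12, 17, 2, 4, 30])))) (Leaf [9, 29, 8, 10, 27]))
    (Leaf [2, 18, 3, 10, 20])))))) (Branch 12 (Branch 17 (Branch 32 (Branch 15 (Branch 7
    (Leaf [0, 5, 7, 15, 17]) (Branch 33 (Leaf [0, 5, 12, 15, 33]) (Branch 18
    (Leaf [0, 5, 15, 17, 18]) (Branch 9 (Branch 30 (Leaf [9, 15, 17, 30, 32]) (Branch 20
    (Branch 22 (Leaf [15, 20, 5, 12, 22]) (Leaf [19, 30, 4, 7, 22]))
    (Leaf [7, 18, 20, 30, 33]))) (Branch 22 (Branch 30 (Leaf [5, 30, 12, 15, 22])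
    (Leaf [4, 9, 7, 30, 33])) (Leaf [4, 9, 7, 19, 22])))))) (Branch 16 (Branch 24 (Branch 7
    (Leaf [0, 5, 7, 17, 24]) (Branch 9 (Leaf [1, 17, 9, 16, 24]) (Branch 26 (Branch 14
    (Leaf [1, 17, 14, 16, 24]) (Branch 23 (Leaf [0, 5, 23, 24, 26]) (Branch 25 (Branch 22
    (Branch 20 (Leaf [20, 24, 5, 12, 22]) (Branch 10 (Branch 33 (Leaf [22, 33, 10, 12, 25])
    (Leaf [4, 15, 7, 14, 33])) (Leaf [9, 20, 7, 8, 10]))) (Leaf [14, 19, 4, 7, 22]))
    (Leaf [4, 15, 2, 23, 25])))) (Leaf [2, 7, 9, 19, 26])))) (Branch 27 (Branch 9 (Branch 10
    (Leaf [12, 17, 9, 10, 27]) (Branch 30 (Leaf [27, 32, 9, 17, 30]) (Branch 23 (Branch 28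
    (Branch 26 (Leaf [16, 27, 9, 26, 28]) (Branch 11 (Branch 13 (Leaf [0, 11, 13, 21, 23])
    (Branch 20 (Branch 31 (Branch 7 (Leaf [17, 28, 5, 7, 20]) (Branch 33
    (Leaf [20, 31, 5, 12, 33]) (Branch 22 (Leaf [12, 23, 5, 20, 22])
    (Leaf [22, 33, 7, 15, 30])))) (Leaf [2, 13, 3, 10, 31])) (Leaf [2, 13, 3, 10, 20])))
    (Leaf [3, 34, 11, 24, 26]))) (Leaf [4, 15, 2, 28, 30])) (Leaf [4, 15, 2, 23, 30]))))
    (Branch 25 (Branch 10 (Leaf [12, 17, 10, 25, 27]) (Branch 35 (Leaf [27, 32, 17, 25, 35])
    (Branch 28 (Branch 11 (Branch 13 (Leaf [0, 11, 13, 21, 28]) (Branch 20 (Branch 31 (Branch 7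
    (Leaf [17, 28, 5, 7, 20]) (Branch 33 (Leaf [20, 31, 5, 12, 33]) (Leaf [8, 33, 7, 9, 10])))
    (Leaf [2, 13, 3, 10, 31])) (Leaf [2, 13, 3, 10, 20]))) (Leaf [9, 34, 8, 10, 11]))
    (Leaf [10, 35, 2, 9, 28])))) (Branch 23 (Branch 28 (Branch 13 (Leaf [23, 28, 0, 13, 21])
    (Branch 7 (Branch 10 (Leaf [17, 28, 0, 7, 10]) (Branch 20 (Leaf [17, 28, 5, 7, 20])
    (Leaf [2, 13, 3, 10, 20]))) (Branch 26 (Branch 33 (Branch 18 (Leaf [28, 33, 16, 18, 26])
    (Leaf [7, 18, 8, 15, 25])) (Leaf [8, 33, 7, 15, 25])) (Leaf [15, 26, 7, 8, 25]))))
    (Leaf [4, 15, 2, 25, 28])) (Leaf [4, 15, 2, 23, 25])))) (Branch 6 (Branch 25 (Branch 10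
    (Branch 33 (Leaf [0, 25, 10, 12, 33]) (Branch 18 (Leaf [0, 25, 10, 17, 18]) (Branch 35
    (Leaf [6, 17, 25, 32, 35]) (Branch 7 (Leaf [0, 25, 7, 10, 17]) (Branch 30 (Branch 9
    (Leaf [6, 17, 9, 30, 32]) (Branch 20 (Branch 22 (Leaf [20, 25, 10, 12, 22])
    (Leaf [19, 24, 7, 9, 22])) (Leaf [7, 18, 20, 33, 35]))) (Leaf [4, 15, 7, 30, 33]))))))
    (Leaf [10, 15, 8, 27, 34])) (Leaf [25, 34, 8, 15, 27])) (Leaf [4, 24, 3, 6, 27]))))
    (Branch 6 (Branch 23 (Branch 13 (Leaf [0, 6, 13, 21, 23]) (Leaf [3, 34, 13, 15, 16]))
    (Leaf [23, 34, 8, 15, 16])) (Leaf [3, 19, 4, 6, 16])))) (Branch 6 (Branch 11 (Branch 22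
    (Branch 31 (Branch 13 (Branch 20 (Leaf [20, 31, 5, 12, 13]) (Branch 23
    (Leaf [6, 31, 5, 13, 23]) (Branch 10 (Leaf [0, 11, 10, 12, 13]) (Leaf [2, 8, 10, 20, 23]))))
    (Branch 15 (Branch 7 (Leaf [17, 22, 5, 7, 15]) (Branch 33 (Leaf [22, 33, 5, 12, 15])
    (Branch 20 (Leaf [15, 20, 5, 12, 22]) (Branch 30 (Leaf [5, 30, 12, 15, 22])
    (Leaf [4, 20, 7, 30, 33]))))) (Leaf [3, 34, 13, 15, 32]))) (Leaf [8, 19, 31, 32, 34]))
    (Leaf [3, 19, 4, 22, 32])) (Leaf [3, 19, 4, 11, 32])) (Leaf [3, 19, 4, 6, 32]))) (Branch 30
    (Branch 9 (Branch 27 (Leaf [1, 12, 9, 27, 30]) (Leaf [2, 27, 4, 17, 19]))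
    (Leaf [4, 9, 2, 17, 19])) (Leaf [19, 30, 2, 4, 17]))) (Branch 30 (Branch 17 (Branch 9
    (Branch 27 (Leaf [1, 17, 9, 27, 30]) (Leaf [2, 27, 4, 12, 19])) (Leaf [4, 9, 2, 12, 19]))
    (Leaf [12, 17, 2, 4, 19])) (Leaf [19, 30, 2, 4, 12])))))) (Branch 20 (Branch 31 (Branch 14
    (Branch 23 (Branch 28 (Branch 6 (Branch 11 (Branch 22 (Branch 7 (Leaf [22, 28, 5, 7, 20])
    (Branch 8 (Leaf [6, 20, 5, 8, 23]) (Branch 18 (Leaf [20, 31, 5, 18, 28]) (Branch 12
    (Leaf [12, 23, 5, 20, 22]) (Branch 33 (Leaf [22, 33, 5, 20, 23]) (Branch 15
    (Leaf [15, 20, 5, 22, 23]) (Branch 30 (Branch 9 (Leaf [1, 28, 9, 11, 30]) (Branch 35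
    (Branch 16 (Leaf [1, 6, 14, 16, 35]) (Leaf [3, 8, 15, 16, 18])) (Leaf [2, 33, 9, 12, 35])))
    (Leaf [4, 15, 7, 30, 33])))))))) (Leaf [2, 22, 3, 4, 21])) (Leaf [2, 11, 3, 4, 21]))
    (Leaf [2, 6, 3, 4, 21])) (Leaf [3, 28, 2, 4, 21])) (Leaf [3, 23, 2, 4, 21]))
    (Leaf [3, 14, 2, 4, 21])) (Leaf [4, 31, 2, 3, 21])) (Leaf [4, 20, 2, 3, 21]))) (Branch 21
    (Branch 15 (Branch 20 (Branch 12 (Branch 17 (Branch 23 (Branch 28 (Branch 22 (Branch 25
    (Leaf [12, 23, 15, 22, 25]) (Branch 18 (Leaf [0, 20, 18, 21, 28]) (Branch 33
    (Leaf [22, 33, 20, 21, 23]) (Branch 35 (Leaf [21, 35, 20, 22, 23]) (Branch 7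
    (Leaf [17, 28, 0, 7, 15]) (Leaf [7, 18, 25, 33, 35])))))) (Leaf [2, 22, 3, 4, 5]))
    (Leaf [3, 28, 2, 4, 5])) (Leaf [3, 23, 2, 4, 5])) (Leaf [3, 17, 2, 4, 5]))
    (Leaf [3, 12, 2, 4, 5])) (Leaf [4, 20, 2, 3, 5])) (Leaf [4, 15, 2, 3, 5]))
    (Leaf [5, 21, 2, 3, 4]))"

lemma certifies_cert_4: "certifies (J5_copy G36) [1, 0] [4, 3, 2] cert_4"
  unfolding cert_4_def G36_def by (simp add: adjacent_diff_graph diff_adj_def distances_36_def)

definition cert_5 :: split_tree where
  "cert_5 =
    Branch 10 (Branch 21 (Leaf [10, 21, 0, 2, 3]) (Branch 23 (Leaf [3, 23, 0, 2, 10]) (Branch 28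
    (Leaf [3, 28, 0, 2, 10]) (Branch 13 (Leaf [2, 13, 0, 3, 10]) (Branch 20
    (Leaf [0, 20, 2, 3, 10]) (Leaf [23, 28, 13, 20, 21])))))) (Branch 15 (Branch 26
    (Leaf [15, 26, 0, 2, 3]) (Branch 23 (Leaf [3, 23, 0, 2, 15]) (Branch 28
    (Leaf [3, 28, 0, 2, 15]) (Branch 13 (Leaf [2, 13, 0, 3, 15]) (Branch 5
    (Leaf [0, 5, 2, 3, 15]) (Leaf [23, 28, 5, 13, 26])))))) (Branch 21 (Branch 23
    (Leaf [3, 23, 0, 2, 21]) (Branch 28 (Leaf [3, 28, 0, 2, 21]) (Branch 13
    (Leaf [2, 13, 0, 3, 21]) (Branch 20 (Leaf [0, 20, 2, 3, 21]) (Leaf [23, 28, 10, 13, 20])))))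
    (Branch 26 (Branch 23 (Leaf [3, 23, 0, 2, 26]) (Branch 28 (Leaf [3, 28, 0, 2, 26])
    (Branch 13 (Leaf [2, 13, 0, 3, 26]) (Branch 5 (Leaf [0, 5, 2, 3, 26])
    (Leaf [23, 28, 5, 13, 15]))))) (Branch 4 (Branch 5 (Branch 20 (Leaf [4, 20, 2, 3, 5])
    (Branch 12 (Leaf [3, 12, 2, 4, 5]) (Branch 23 (Leaf [3, 23, 2, 4, 5]) (Branch 22
    (Leaf [2, 22, 3, 4, 5]) (Leaf [12, 23, 10, 20, 22]))))) (Branch 13 (Branch 8 (Branch 33
    (Branch 25 (Branch 12 (Leaf [2, 33, 4, 12, 25]) (Branch 23 (Leaf [2, 33, 4, 23, 25])
    (Branch 22 (Branch 7 (Leaf [22, 33, 4, 7, 25]) (Branch 28 (Branch 17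
    (Leaf [17, 28, 2, 4, 25]) (Branch 30 (Leaf [25, 30, 2, 4, 28]) (Leaf [5, 30, 7, 15, 17])))
    (Leaf [15, 26, 5, 7, 28]))) (Leaf [12, 23, 5, 15, 22])))) (Branch 17 (Branch 19
    (Leaf [0, 4, 2, 17, 19]) (Branch 16 (Branch 6 (Leaf [4, 13, 3, 6, 16]) (Branch 14
    (Leaf [17, 33, 4, 14, 16]) (Branch 29 (Branch 31 (Leaf [3, 8, 16, 29, 31]) (Branch 18
    (Branch 35 (Leaf [0, 16, 18, 33, 35]) (Branch 22 (Branch 32 (Leaf [4, 29, 3, 22, 32])
    (Leaf [14, 25, 6, 32, 35])) (Leaf [14, 25, 1, 22, 35]))) (Leaf [6, 31, 18, 19, 21])))
    (Leaf [14, 19, 6, 21, 29])))) (Branch 9 (Branch 18 (Branch 29 (Branch 35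
    (Leaf [2, 18, 0, 17, 35]) (Branch 30 (Leaf [4, 9, 2, 17, 30]) (Branch 6 (Branch 27
    (Leaf [4, 29, 3, 6, 27]) (Branch 12 (Branch 14 (Leaf [12, 17, 2, 4, 14])
    (Leaf [16, 27, 1, 14, 35])) (Leaf [25, 30, 12, 15, 27]))) (Branch 14 (Branch 27
    (Leaf [4, 29, 14, 17, 27]) (Leaf [1, 6, 25, 27, 35])) (Leaf [1, 6, 14, 16, 35])))))
    (Leaf [1, 26, 16, 19, 29])) (Leaf [1, 26, 16, 18, 19])) (Leaf [1, 26, 9, 16, 19]))))
    (Branch 7 (Branch 18 (Branch 27 (Branch 35 (Leaf [7, 18, 0, 33, 35]) (Branch 32 (Branch 6
    (Leaf [27, 32, 3, 4, 6]) (Branch 11 (Leaf [4, 13, 3, 11, 32]) (Branch 14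
    (Leaf [7, 32, 4, 14, 33]) (Branch 24 (Branch 29 (Branch 12 (Branch 19
    (Leaf [4, 29, 12, 19, 27]) (Branch 34 (Branch 22 (Leaf [3, 34, 22, 24, 32])
    (Leaf [11, 22, 1, 14, 35])) (Leaf [6, 11, 19, 21, 34]))) (Leaf [1, 12, 11, 14, 35]))
    (Leaf [1, 21, 11, 14, 29])) (Leaf [1, 21, 11, 14, 24]))))) (Leaf [15, 35, 17, 25, 32])))
    (Leaf [10, 15, 17, 25, 27])) (Leaf [5, 25, 15, 17, 18])) (Leaf [5, 25, 7, 15, 17]))))
    (Branch 7 (Branch 23 (Branch 12 (Branch 35 (Leaf [12, 23, 0, 2, 35]) (Branch 25
    (Leaf [12, 23, 2, 4, 25]) (Branch 30 (Leaf [12, 23, 2, 4, 30]) (Branch 19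
    (Leaf [0, 4, 2, 12, 19]) (Branch 32 (Branch 6 (Leaf [4, 13, 3, 6, 32]) (Branch 11
    (Leaf [4, 13, 3, 11, 32]) (Branch 29 (Branch 27 (Branch 22 (Leaf [4, 29, 3, 22, 32])
    (Branch 14 (Leaf [2, 27, 4, 12, 14]) (Leaf [11, 22, 1, 14, 35]))) (Leaf [1, 6, 25, 27, 35]))
    (Leaf [1, 21, 11, 19, 29])))) (Leaf [25, 30, 15, 32, 33])))))) (Branch 22 (Branch 20
    (Branch 30 (Leaf [4, 20, 7, 22, 30]) (Leaf [5, 30, 12, 15, 33])) (Leaf [15, 20, 5, 12, 33]))
    (Leaf [22, 33, 5, 12, 15]))) (Leaf [15, 26, 5, 23, 33])) (Leaf [15, 26, 5, 7, 33])))
    (Branch 7 (Branch 23 (Branch 34 (Branch 6 (Branch 16 (Leaf [4, 13, 3, 6, 16]) (Branch 32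
    (Leaf [4, 13, 3, 6, 32]) (Branch 25 (Leaf [7, 23, 4, 6, 25]) (Branch 27 (Branch 29
    (Leaf [4, 29, 3, 6, 27]) (Leaf [1, 26, 8, 16, 29])) (Leaf [27, 32, 8, 15, 25])))))
    (Branch 29 (Branch 25 (Branch 12 (Leaf [12, 23, 2, 4, 25]) (Branch 22
    (Leaf [7, 23, 4, 22, 25]) (Branch 33 (Leaf [2, 33, 4, 23, 25]) (Leaf [22, 33, 5, 12, 15]))))
    (Branch 27 (Branch 32 (Branch 11 (Leaf [3, 34, 11, 13, 32]) (Branch 22
    (Leaf [4, 29, 3, 22, 32]) (Branch 12 (Branch 35 (Leaf [12, 23, 0, 2, 35]) (Branch 14
    (Leaf [2, 27, 4, 12, 14]) (Leaf [11, 22, 1, 14, 35]))) (Leaf [5, 25, 12, 15, 22]))))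
    (Leaf [6, 15, 8, 25, 32])) (Leaf [1, 6, 8, 25, 27]))) (Leaf [6, 26, 5, 8, 29])))
    (Leaf [15, 26, 5, 8, 34])) (Leaf [15, 26, 5, 8, 23])) (Leaf [15, 26, 5, 7, 8]))) (Branch 23
    (Branch 28 (Branch 34 (Branch 35 (Leaf [23, 28, 0, 2, 35]) (Branch 25
    (Leaf [23, 28, 2, 4, 25]) (Branch 30 (Leaf [23, 28, 2, 4, 30]) (Branch 12 (Branch 32
    (Branch 6 (Branch 11 (Leaf [6, 11, 3, 4, 32]) (Branch 14 (Leaf [3, 14, 4, 6, 32])
    (Leaf [1, 21, 11, 13, 14]))) (Branch 27 (Branch 14 (Leaf [2, 27, 4, 12, 14]) (Branch 24
    (Branch 11 (Leaf [3, 34, 11, 24, 32]) (Leaf [1, 21, 11, 13, 14]))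
    (Leaf [13, 24, 6, 14, 21]))) (Leaf [1, 6, 25, 27, 35]))) (Leaf [25, 30, 13, 15, 32]))
    (Leaf [5, 25, 12, 13, 15]))))) (Leaf [15, 26, 5, 13, 34])) (Leaf [15, 26, 5, 13, 28]))
    (Leaf [15, 26, 5, 13, 23])))) (Branch 11 (Branch 22 (Branch 32 (Branch 24
    (Leaf [11, 22, 3, 24, 32]) (Branch 29 (Leaf [11, 22, 3, 29, 32]) (Branch 19 (Branch 9
    (Leaf [11, 22, 9, 19, 32]) (Branch 34 (Leaf [11, 22, 19, 32, 34]) (Branch 20
    (Leaf [3, 19, 20, 22, 32]) (Branch 16 (Branch 6 (Branch 13 (Leaf [16, 32, 3, 6, 13])
    (Branch 18 (Leaf [3, 19, 6, 16, 18]) (Branch 8 (Branch 23 (Branch 31 (Branch 33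
    (Leaf [8, 33, 16, 23, 31]) (Leaf [10, 21, 18, 20, 33])) (Leaf [10, 21, 13, 31, 34]))
    (Leaf [10, 21, 13, 20, 23])) (Leaf [1, 10, 8, 18, 20])))) (Leaf [9, 34, 6, 21, 24]))
    (Leaf [9, 34, 1, 16, 24]))))) (Branch 16 (Branch 6 (Branch 13 (Leaf [16, 32, 3, 6, 13])
    (Branch 5 (Branch 20 (Leaf [2, 22, 3, 5, 20]) (Branch 18 (Leaf [5, 16, 3, 6, 18])
    (Leaf [1, 21, 18, 19, 20]))) (Branch 23 (Branch 28 (Branch 34 (Branch 8
    (Leaf [23, 34, 6, 8, 16]) (Branch 31 (Branch 18 (Leaf [3, 28, 16, 18, 31])
    (Leaf [15, 26, 5, 8, 18])) (Leaf [5, 10, 8, 29, 31]))) (Leaf [15, 26, 5, 13, 34]))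
    (Leaf [15, 26, 5, 13, 28])) (Leaf [15, 26, 5, 13, 23])))) (Leaf [4, 29, 6, 19, 21]))
    (Leaf [4, 29, 1, 16, 19]))))) (Branch 14 (Branch 35 (Branch 17 (Leaf [0, 14, 2, 17, 35])
    (Branch 25 (Branch 28 (Leaf [0, 25, 2, 28, 35]) (Branch 7 (Leaf [14, 25, 7, 22, 35])
    (Branch 5 (Branch 20 (Leaf [2, 22, 3, 5, 20]) (Leaf [17, 28, 7, 10, 20]))
    (Leaf [17, 28, 4, 5, 7])))) (Leaf [4, 15, 17, 25, 32]))) (Branch 25 (Branch 12 (Branch 24
    (Leaf [11, 22, 12, 14, 24]) (Branch 29 (Leaf [11, 22, 12, 14, 29]) (Branch 9 (Branch 19
    (Leaf [0, 9, 2, 12, 19]) (Branch 6 (Branch 16 (Branch 27 (Branch 31 (Branch 5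
    (Leaf [3, 12, 2, 5, 31]) (Branch 18 (Leaf [6, 31, 3, 16, 18]) (Branch 8
    (Leaf [16, 27, 6, 8, 9]) (Leaf [15, 26, 5, 8, 18])))) (Leaf [21, 32, 19, 29, 31]))
    (Leaf [1, 26, 19, 27, 29])) (Leaf [1, 26, 16, 19, 29])) (Leaf [21, 32, 4, 6, 19])))
    (Branch 16 (Branch 6 (Branch 13 (Leaf [3, 14, 6, 13, 16]) (Branch 17 (Branch 19
    (Leaf [12, 17, 0, 2, 19]) (Branch 31 (Branch 5 (Leaf [3, 12, 2, 5, 31]) (Branch 18
    (Leaf [6, 31, 3, 16, 18]) (Branch 8 (Branch 23 (Branch 34 (Leaf [23, 34, 6, 8, 16])
    (Leaf [15, 26, 5, 13, 34])) (Leaf [15, 26, 5, 13, 23])) (Leaf [15, 26, 5, 8, 18]))))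
    (Leaf [21, 32, 19, 29, 31]))) (Leaf [24, 35, 9, 17, 32]))) (Leaf [21, 32, 6, 9, 24]))
    (Leaf [24, 35, 1, 9, 16]))))) (Branch 19 (Branch 9 (Branch 17 (Leaf [0, 9, 2, 17, 19])
    (Branch 30 (Branch 7 (Leaf [19, 30, 7, 9, 22]) (Branch 20 (Branch 28
    (Leaf [2, 11, 9, 28, 30]) (Branch 5 (Leaf [2, 22, 3, 5, 20]) (Leaf [17, 28, 4, 5, 7])))
    (Leaf [10, 35, 7, 17, 20]))) (Leaf [4, 15, 17, 30, 32]))) (Branch 27 (Branch 6 (Branch 24
    (Leaf [3, 14, 6, 24, 27]) (Branch 16 (Branch 17 (Branch 18 (Leaf [6, 17, 16, 18, 19])
    (Branch 34 (Leaf [6, 17, 16, 19, 34]) (Branch 20 (Leaf [2, 27, 17, 19, 20]) (Branch 28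
    (Branch 31 (Branch 5 (Leaf [3, 28, 2, 5, 31]) (Branch 13 (Leaf [6, 31, 3, 13, 16])
    (Leaf [15, 20, 5, 12, 13]))) (Leaf [21, 32, 24, 31, 34])) (Leaf [10, 21, 18, 20, 28])))))
    (Leaf [24, 35, 9, 17, 32])) (Leaf [1, 26, 9, 16, 24]))) (Branch 24 (Branch 7
    (Leaf [14, 25, 7, 22, 24]) (Leaf [7, 32, 6, 9, 35])) (Leaf [21, 32, 6, 9, 24])))
    (Leaf [10, 35, 9, 12, 27]))) (Branch 6 (Branch 27 (Branch 29 (Leaf [3, 14, 6, 27, 29])
    (Branch 31 (Branch 16 (Branch 17 (Branch 13 (Leaf [6, 31, 3, 13, 16]) (Branch 18
    (Leaf [6, 31, 3, 16, 18]) (Branch 30 (Branch 20 (Leaf [2, 27, 17, 20, 30])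
    (Leaf [1, 21, 18, 19, 20])) (Leaf [12, 32, 13, 15, 30])))) (Leaf [4, 29, 17, 19, 32]))
    (Leaf [1, 26, 16, 19, 29])) (Leaf [10, 19, 12, 29, 31]))) (Leaf [1, 12, 4, 19, 27]))
    (Leaf [21, 32, 4, 6, 19])))) (Branch 27 (Branch 6 (Branch 29 (Leaf [3, 14, 6, 27, 29])
    (Branch 17 (Branch 33 (Branch 24 (Leaf [3, 14, 6, 24, 27]) (Branch 5 (Branch 20
    (Leaf [3, 17, 2, 5, 20]) (Branch 18 (Branch 16 (Leaf [5, 16, 3, 6, 18]) (Branch 8
    (Leaf [3, 8, 5, 6, 18]) (Leaf [1, 26, 8, 16, 29]))) (Leaf [20, 25, 1, 18, 35]))) (Branch 7
    (Branch 19 (Leaf [2, 7, 0, 17, 19]) (Branch 16 (Branch 13 (Leaf [3, 14, 6, 13, 16])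
    (Branch 12 (Branch 31 (Leaf [2, 33, 12, 14, 31]) (Leaf [21, 32, 19, 29, 31]))
    (Leaf [5, 25, 12, 13, 15]))) (Leaf [4, 29, 1, 16, 19]))) (Leaf [5, 25, 7, 24, 26]))))
    (Leaf [4, 15, 25, 32, 33])) (Leaf [4, 15, 17, 25, 32]))) (Leaf [4, 35, 6, 25, 32]))
    (Leaf [4, 35, 1, 25, 27])))) (Branch 6 (Branch 33 (Branch 17 (Branch 19 (Branch 7
    (Leaf [2, 7, 0, 17, 19]) (Branch 29 (Leaf [2, 29, 0, 17, 19]) (Branch 16 (Branch 27
    (Branch 9 (Leaf [0, 9, 2, 17, 19]) (Branch 24 (Leaf [16, 27, 3, 6, 24])
    (Leaf [9, 14, 7, 24, 26]))) (Leaf [4, 29, 1, 14, 27])) (Leaf [4, 29, 1, 14, 16]))))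
    (Branch 16 (Branch 27 (Branch 24 (Leaf [16, 27, 3, 6, 24]) (Branch 29
    (Leaf [16, 27, 3, 6, 29]) (Branch 31 (Branch 18 (Leaf [3, 33, 16, 18, 31]) (Branch 20
    (Branch 5 (Leaf [20, 31, 2, 3, 5]) (Branch 13 (Leaf [6, 31, 3, 13, 16]) (Branch 8 (Branch 23
    (Branch 34 (Leaf [23, 34, 6, 8, 16]) (Leaf [15, 26, 5, 13, 34])) (Leaf [15, 26, 5, 13, 23]))
    (Leaf [15, 26, 5, 8, 18])))) (Leaf [1, 21, 18, 19, 20]))) (Leaf [24, 29, 14, 21, 31]))))
    (Leaf [14, 19, 1, 4, 27])) (Leaf [14, 19, 1, 4, 16]))) (Leaf [4, 15, 14, 17, 32]))
    (Leaf [21, 32, 4, 14, 33])) (Leaf [21, 32, 4, 6, 14])))) (Branch 14 (Branch 19 (Branch 9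
    (Branch 12 (Leaf [0, 9, 2, 12, 19]) (Branch 17 (Leaf [0, 9, 2, 17, 19]) (Branch 25
    (Branch 30 (Branch 5 (Branch 32 (Leaf [19, 30, 9, 11, 32]) (Branch 28
    (Leaf [2, 11, 9, 28, 30]) (Branch 34 (Branch 6 (Branch 13 (Leaf [3, 34, 5, 6, 13])
    (Branch 16 (Leaf [9, 34, 6, 16, 19]) (Leaf [15, 26, 13, 16, 28]))) (Branch 23 (Branch 20
    (Leaf [3, 23, 2, 5, 20]) (Branch 35 (Leaf [0, 25, 2, 23, 35]) (Leaf [10, 35, 12, 20, 22])))
    (Leaf [6, 22, 4, 21, 23]))) (Leaf [17, 22, 15, 32, 34])))) (Leaf [4, 15, 5, 12, 22]))
    (Leaf [1, 12, 4, 22, 30])) (Leaf [1, 12, 4, 22, 25])))) (Branch 24 (Branch 32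
    (Leaf [3, 14, 11, 24, 32]) (Branch 25 (Branch 35 (Branch 12 (Leaf [24, 35, 11, 12, 14])
    (Branch 17 (Leaf [19, 35, 0, 2, 17]) (Branch 23 (Leaf [0, 25, 2, 23, 35]) (Branch 5
    (Branch 6 (Branch 7 (Leaf [3, 7, 5, 6, 24]) (Leaf [17, 22, 7, 9, 10]))
    (Leaf [6, 22, 4, 21, 23])) (Leaf [12, 23, 4, 5, 22]))))) (Leaf [1, 32, 9, 22, 35]))
    (Leaf [4, 15, 22, 25, 32]))) (Leaf [1, 21, 9, 22, 24]))) (Leaf [1, 21, 4, 19, 22]))
    (Leaf [1, 21, 4, 14, 22]))) (Branch 14 (Branch 19 (Branch 12 (Branch 35
    (Leaf [19, 35, 0, 2, 12]) (Branch 17 (Leaf [12, 17, 0, 2, 19]) (Branch 29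
    (Leaf [2, 29, 0, 12, 19]) (Branch 30 (Branch 9 (Leaf [19, 30, 2, 9, 12]) (Branch 24
    (Branch 27 (Branch 22 (Leaf [22, 27, 12, 14, 24]) (Leaf [11, 22, 1, 9, 35]))
    (Leaf [10, 35, 9, 17, 27])) (Leaf [1, 21, 9, 11, 24]))) (Leaf [4, 29, 1, 11, 30])))))
    (Branch 30 (Branch 9 (Branch 17 (Leaf [19, 30, 2, 9, 17]) (Branch 20 (Branch 28
    (Leaf [9, 20, 2, 28, 30]) (Branch 23 (Branch 13 (Leaf [2, 13, 20, 23, 30])
    (Leaf [12, 28, 10, 11, 13])) (Leaf [23, 28, 4, 11, 21]))) (Branch 27 (Branch 28
    (Leaf [2, 27, 9, 28, 30]) (Branch 18 (Branch 7 (Branch 22 (Leaf [19, 30, 7, 9, 22])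
    (Branch 33 (Branch 25 (Branch 35 (Leaf [0, 25, 18, 33, 35]) (Leaf [10, 35, 12, 20, 22]))
    (Leaf [20, 25, 10, 12, 22])) (Leaf [22, 33, 10, 12, 20]))) (Leaf [17, 28, 7, 10, 20]))
    (Leaf [17, 28, 10, 18, 20]))) (Leaf [12, 17, 10, 20, 27])))) (Branch 28 (Branch 22
    (Branch 27 (Branch 24 (Branch 35 (Branch 29 (Branch 17 (Leaf [24, 29, 14, 17, 27])
    (Branch 32 (Leaf [24, 29, 14, 22, 32]) (Branch 25 (Leaf [2, 27, 25, 28, 35])
    (Leaf [4, 15, 17, 25, 32])))) (Leaf [9, 29, 10, 11, 12])) (Leaf [10, 35, 9, 11, 12]))
    (Leaf [10, 24, 9, 11, 12])) (Leaf [11, 27, 9, 10, 12])) (Leaf [11, 22, 9, 10, 12]))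
    (Leaf [12, 28, 9, 10, 11]))) (Leaf [1, 12, 4, 11, 30]))) (Leaf [1, 21, 4, 11, 19]))
    (Leaf [1, 21, 4, 11, 14])))))))"

lemma certifies_cert_5: "certifies (J5_copy G36) [3, 2, 0] [1] cert_5"
  unfolding cert_5_def G36_def by (simp add: adjacent_diff_graph diff_adj_def distances_36_def)

definition cert_6 :: split_tree where
  "cert_6 =
    Branch 12 (Leaf [0, 4, 2, 12, 19]) (Branch 17 (Leaf [0, 4, 2, 17, 19]) (Branch 21
    (Leaf [0, 4, 2, 19, 21]) (Branch 24 (Branch 26 (Branch 18 (Leaf [2, 18, 0, 19, 26])
    (Branch 29 (Leaf [2, 29, 0, 19, 26]) (Branch 16 (Branch 6 (Branch 14
    (Leaf [14, 19, 4, 6, 16]) (Branch 27 (Leaf [16, 27, 4, 6, 19]) (Branch 32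
    (Leaf [16, 32, 4, 6, 19]) (Leaf [27, 32, 14, 17, 29])))) (Leaf [18, 29, 3, 6, 21]))
    (Leaf [18, 29, 1, 3, 16])))) (Branch 29 (Branch 13 (Branch 18 (Branch 10 (Branch 8
    (Leaf [18, 29, 0, 8, 10]) (Branch 23 (Leaf [2, 13, 0, 10, 23]) (Branch 11 (Branch 34
    (Leaf [0, 11, 10, 13, 34]) (Branch 6 (Branch 16 (Leaf [4, 18, 6, 16, 19])
    (Leaf [23, 34, 8, 16, 26])) (Leaf [23, 34, 6, 8, 21]))) (Leaf [21, 26, 8, 11, 23]))))
    (Branch 6 (Branch 16 (Leaf [4, 18, 6, 16, 19]) (Branch 27 (Leaf [4, 29, 6, 19, 27])
    (Branch 20 (Branch 25 (Branch 7 (Leaf [19, 25, 4, 6, 7]) (Branch 23 (Leaf [2, 6, 4, 23, 25])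
    (Branch 5 (Branch 8 (Leaf [18, 29, 5, 6, 8]) (Branch 34 (Leaf [13, 24, 5, 6, 34])
    (Leaf [23, 34, 8, 16, 26]))) (Branch 8 (Branch 33 (Branch 15 (Leaf [0, 25, 8, 15, 18])
    (Branch 30 (Branch 28 (Leaf [28, 33, 18, 20, 30]) (Leaf [17, 28, 5, 7, 15]))
    (Leaf [7, 27, 15, 17, 30]))) (Leaf [7, 23, 5, 26, 33])) (Leaf [7, 23, 5, 8, 26])))))
    (Leaf [12, 17, 10, 25, 27])) (Leaf [3, 12, 10, 20, 27])))) (Branch 32 (Branch 11
    (Leaf [4, 29, 11, 19, 32]) (Branch 22 (Leaf [4, 29, 19, 22, 32]) (Branch 20 (Branch 9
    (Branch 5 (Branch 23 (Leaf [4, 20, 2, 5, 23]) (Branch 8 (Branch 15 (Leaf [0, 5, 8, 15, 18])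
    (Branch 31 (Leaf [5, 32, 8, 29, 31]) (Branch 33 (Branch 30 (Leaf [5, 30, 18, 20, 33])
    (Leaf [12, 23, 15, 22, 30])) (Leaf [12, 23, 10, 31, 33])))) (Leaf [10, 21, 8, 11, 23])))
    (Branch 15 (Branch 34 (Leaf [0, 32, 13, 15, 34]) (Branch 23 (Leaf [2, 13, 0, 15, 23])
    (Branch 35 (Branch 8 (Branch 33 (Branch 7 (Leaf [0, 9, 7, 33, 35]) (Branch 25
    (Leaf [0, 25, 8, 15, 18]) (Leaf [7, 12, 10, 22, 25]))) (Leaf [23, 34, 5, 26, 33]))
    (Leaf [23, 34, 5, 6, 8])) (Leaf [11, 22, 1, 34, 35])))) (Leaf [3, 12, 5, 15, 22])))
    (Leaf [11, 22, 9, 10, 12])) (Leaf [1, 10, 3, 20, 22])))) (Branch 9 (Branch 20 (Branch 35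
    (Branch 23 (Leaf [0, 20, 2, 23, 35]) (Branch 33 (Leaf [0, 20, 18, 33, 35]) (Branch 31
    (Branch 16 (Leaf [18, 29, 16, 19, 31]) (Branch 8 (Branch 15 (Branch 34
    (Leaf [18, 34, 0, 8, 15]) (Leaf [23, 34, 16, 26, 33])) (Leaf [15, 26, 16, 23, 33]))
    (Leaf [8, 33, 16, 23, 26]))) (Leaf [10, 21, 23, 31, 33])))) (Branch 14 (Branch 25 (Branch 34
    (Branch 5 (Branch 23 (Leaf [5, 25, 2, 4, 23]) (Branch 31 (Leaf [13, 24, 5, 31, 34])
    (Branch 8 (Branch 33 (Leaf [8, 33, 5, 18, 20]) (Leaf [12, 23, 10, 31, 33]))
    (Leaf [6, 31, 8, 21, 23])))) (Branch 7 (Branch 22 (Leaf [14, 19, 4, 7, 22]) (Branch 33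
    (Leaf [14, 25, 4, 7, 33]) (Branch 15 (Branch 8 (Leaf [0, 25, 7, 8, 15]) (Branch 31
    (Branch 16 (Leaf [15, 31, 13, 14, 16]) (Branch 23 (Leaf [0, 25, 13, 15, 23])
    (Leaf [8, 33, 16, 23, 26]))) (Leaf [5, 10, 12, 31, 33]))) (Leaf [22, 33, 5, 12, 15]))))
    (Branch 8 (Branch 15 (Leaf [0, 25, 8, 15, 18]) (Branch 30 (Branch 28
    (Leaf [2, 13, 20, 28, 30]) (Leaf [17, 28, 5, 7, 15])) (Leaf [7, 32, 15, 17, 30])))
    (Leaf [6, 26, 5, 7, 8])))) (Leaf [6, 17, 32, 34, 35])) (Leaf [6, 17, 25, 32, 35]))
    (Leaf [6, 17, 14, 32, 35]))) (Branch 22 (Branch 27 (Branch 7 (Leaf [19, 24, 7, 9, 22])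
    (Branch 28 (Branch 30 (Branch 35 (Leaf [30, 35, 9, 27, 28]) (Leaf [10, 35, 7, 17, 20]))
    (Leaf [10, 30, 7, 17, 20])) (Leaf [17, 28, 7, 10, 20]))) (Leaf [1, 10, 3, 20, 27]))
    (Leaf [1, 10, 3, 20, 22]))) (Branch 27 (Branch 30 (Branch 35 (Branch 28
    (Leaf [4, 29, 27, 28, 30]) (Branch 7 (Branch 33 (Leaf [7, 18, 0, 33, 35]) (Branch 22
    (Leaf [19, 30, 4, 7, 22]) (Leaf [22, 33, 9, 10, 12]))) (Leaf [17, 28, 7, 9, 10])))
    (Leaf [6, 17, 9, 32, 35])) (Leaf [6, 17, 9, 30, 32])) (Leaf [12, 17, 9, 10, 27]))))))
    (Branch 16 (Branch 20 (Branch 6 (Leaf [4, 29, 6, 16, 19]) (Branch 8 (Branch 31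
    (Leaf [8, 19, 16, 29, 31]) (Branch 28 (Branch 15 (Leaf [2, 13, 0, 15, 28]) (Branch 5
    (Leaf [4, 20, 2, 5, 28]) (Leaf [6, 15, 3, 5, 18]))) (Leaf [3, 28, 18, 21, 31])))
    (Leaf [3, 8, 6, 18, 21]))) (Leaf [1, 21, 3, 18, 20])) (Leaf [1, 26, 3, 16, 18]))) (Branch 11
    (Branch 16 (Branch 6 (Leaf [4, 29, 6, 16, 19]) (Branch 32 (Leaf [4, 29, 11, 19, 32])
    (Leaf [21, 32, 3, 6, 13]))) (Leaf [1, 26, 3, 13, 16])) (Leaf [1, 21, 3, 11, 13])))
    (Branch 11 (Branch 16 (Branch 22 (Branch 27 (Branch 6 (Leaf [16, 27, 4, 6, 19]) (Branch 32
    (Leaf [11, 22, 4, 19, 32]) (Leaf [21, 32, 3, 6, 29]))) (Leaf [1, 26, 3, 27, 29]))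
    (Leaf [1, 21, 3, 22, 29])) (Leaf [1, 26, 3, 16, 29])) (Leaf [1, 21, 3, 11, 29]))))
    (Branch 11 (Branch 22 (Branch 32 (Leaf [11, 22, 4, 19, 32]) (Branch 6 (Branch 7
    (Leaf [6, 22, 4, 7, 19]) (Branch 9 (Branch 26 (Leaf [2, 11, 9, 19, 26]) (Branch 14
    (Branch 16 (Branch 27 (Leaf [16, 27, 4, 6, 14]) (Leaf [1, 26, 3, 24, 27]))
    (Leaf [1, 26, 3, 16, 24])) (Leaf [7, 32, 14, 17, 24]))) (Leaf [7, 32, 9, 17, 24])))
    (Leaf [21, 32, 3, 6, 24]))) (Leaf [1, 21, 3, 22, 24])) (Leaf [1, 21, 3, 11, 24])))))"

lemma certifies_cert_6: "certifies (J5_copy G36) [19, 4, 2, 0] [3, 1] cert_6"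
  unfolding cert_6_def G36_def by (simp add: adjacent_diff_graph diff_adj_def distances_36_def)

definition cert_7 :: split_tree where
  "cert_7 =
    Branch 10 (Branch 12 (Leaf [2, 29, 0, 10, 12]) (Branch 17 (Leaf [2, 29, 0, 10, 17])
    (Branch 28 (Leaf [2, 29, 0, 10, 28]) (Branch 8 (Branch 18 (Leaf [18, 29, 0, 8, 10])
    (Branch 21 (Leaf [10, 21, 0, 8, 29]) (Branch 26 (Leaf [10, 26, 0, 8, 29]) (Branch 16
    (Branch 5 (Branch 6 (Leaf [5, 16, 6, 8, 29]) (Leaf [3, 19, 6, 18, 21]))
    (Leaf [3, 28, 5, 18, 26])) (Leaf [3, 19, 1, 16, 18]))))) (Branch 23 (Branch 21
    (Leaf [10, 21, 0, 2, 23]) (Branch 13 (Leaf [2, 13, 0, 10, 23]) (Branch 20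
    (Leaf [0, 20, 2, 10, 23]) (Leaf [1, 21, 3, 13, 20])))) (Branch 16 (Branch 11 (Branch 14
    (Branch 21 (Leaf [2, 11, 4, 14, 21]) (Branch 6 (Leaf [4, 29, 6, 14, 16]) (Branch 13
    (Branch 34 (Leaf [0, 11, 10, 13, 34]) (Leaf [8, 19, 6, 21, 34]))
    (Leaf [8, 13, 6, 21, 23])))) (Branch 22 (Branch 27 (Branch 30 (Branch 32
    (Leaf [11, 22, 4, 30, 32]) (Branch 6 (Leaf [4, 29, 6, 27, 30]) (Branch 34 (Branch 9
    (Branch 13 (Leaf [0, 11, 10, 13, 34]) (Branch 31 (Branch 24 (Branch 26
    (Leaf [9, 34, 16, 24, 26]) (Branch 5 (Leaf [5, 16, 24, 31, 34]) (Leaf [6, 26, 3, 5, 13])))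
    (Leaf [6, 17, 14, 24, 32])) (Leaf [12, 32, 13, 14, 31]))) (Leaf [6, 17, 9, 19, 32]))
    (Leaf [8, 19, 6, 32, 34])))) (Branch 15 (Branch 7 (Branch 33 (Leaf [10, 15, 0, 7, 33])
    (Branch 5 (Leaf [4, 15, 5, 7, 22]) (Branch 20 (Branch 9 (Leaf [9, 20, 7, 10, 22]) (Branch 35
    (Leaf [10, 35, 7, 20, 22]) (Leaf [30, 35, 9, 12, 33]))) (Leaf [8, 33, 5, 20, 23]))))
    (Branch 9 (Branch 6 (Branch 24 (Leaf [16, 27, 6, 9, 24]) (Branch 35
    (Leaf [16, 27, 6, 9, 35]) (Leaf [24, 35, 7, 14, 17]))) (Branch 5 (Branch 24 (Branch 35
    (Branch 32 (Leaf [24, 35, 9, 11, 32]) (Branch 34 (Branch 31 (Leaf [5, 16, 24, 31, 34])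
    (Branch 33 (Leaf [0, 16, 33, 34, 35]) (Leaf [7, 12, 30, 31, 33])))
    (Leaf [6, 17, 19, 32, 34]))) (Leaf [6, 17, 7, 14, 35])) (Leaf [6, 17, 7, 14, 24]))
    (Leaf [7, 23, 5, 6, 8]))) (Leaf [19, 30, 7, 9, 17]))) (Branch 7 (Branch 25
    (Leaf [4, 10, 7, 22, 25]) (Branch 5 (Branch 18 (Branch 26 (Branch 33
    (Leaf [0, 5, 18, 26, 33]) (Leaf [14, 25, 12, 15, 33])) (Leaf [15, 26, 8, 23, 25]))
    (Leaf [18, 23, 8, 15, 25])) (Leaf [5, 25, 8, 15, 23]))) (Leaf [14, 30, 7, 15, 17]))))
    (Branch 9 (Branch 24 (Branch 34 (Branch 6 (Leaf [9, 34, 6, 16, 24]) (Branch 21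
    (Leaf [11, 22, 9, 21, 24]) (Branch 26 (Leaf [11, 16, 9, 24, 26]) (Branch 13
    (Leaf [0, 11, 10, 13, 34]) (Branch 31 (Branch 5 (Leaf [5, 16, 24, 31, 34])
    (Leaf [6, 26, 3, 5, 13])) (Leaf [6, 31, 13, 14, 21])))))) (Leaf [8, 19, 1, 27, 34]))
    (Leaf [3, 14, 1, 24, 27])) (Leaf [8, 19, 1, 9, 27]))) (Branch 24 (Branch 9 (Branch 35
    (Branch 6 (Leaf [24, 35, 6, 9, 16]) (Branch 32 (Leaf [24, 35, 9, 11, 32]) (Branch 15
    (Branch 34 (Branch 21 (Leaf [0, 11, 21, 24, 34]) (Branch 13 (Leaf [10, 15, 0, 13, 34])
    (Leaf [21, 32, 3, 6, 13]))) (Leaf [1, 32, 19, 22, 34])) (Leaf [12, 32, 14, 15, 22]))))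
    (Leaf [1, 12, 14, 22, 35])) (Leaf [1, 12, 9, 19, 22])) (Leaf [3, 14, 1, 22, 24]))))
    (Branch 9 (Branch 18 (Branch 34 (Branch 6 (Branch 14 (Leaf [4, 29, 6, 14, 16]) (Branch 24
    (Leaf [9, 34, 6, 16, 24]) (Branch 35 (Leaf [9, 18, 6, 16, 35])
    (Leaf [24, 35, 11, 12, 14])))) (Branch 21 (Branch 13 (Leaf [10, 21, 0, 13, 34]) (Branch 24
    (Branch 14 (Branch 26 (Leaf [24, 29, 14, 16, 26]) (Leaf [1, 26, 3, 11, 13]))
    (Leaf [3, 14, 1, 11, 13])) (Leaf [13, 24, 1, 3, 11]))) (Leaf [6, 11, 8, 21, 23])))
    (Leaf [8, 19, 1, 11, 34])) (Leaf [3, 8, 1, 11, 18])) (Leaf [8, 19, 1, 9, 11]))) (Branch 18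
    (Branch 34 (Branch 33 (Leaf [18, 34, 0, 10, 33]) (Branch 15 (Branch 26 (Branch 13
    (Leaf [10, 15, 0, 13, 34]) (Branch 11 (Branch 24 (Branch 14 (Leaf [24, 29, 11, 14, 26])
    (Leaf [3, 14, 1, 13, 16])) (Leaf [13, 24, 1, 3, 16])) (Leaf [11, 16, 1, 3, 13])))
    (Leaf [8, 33, 16, 23, 26])) (Leaf [8, 33, 15, 16, 23]))) (Leaf [8, 19, 1, 16, 34]))
    (Leaf [3, 8, 1, 16, 18])))))))) (Branch 20 (Branch 28 (Branch 21 (Leaf [2, 29, 0, 21, 28])
    (Branch 26 (Leaf [2, 29, 0, 26, 28]) (Branch 5 (Leaf [4, 20, 2, 5, 28]) (Branch 30
    (Leaf [4, 20, 2, 28, 30]) (Branch 35 (Leaf [0, 20, 2, 28, 35]) (Branch 13 (Branch 15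
    (Leaf [2, 13, 0, 15, 28]) (Branch 18 (Branch 22 (Branch 17 (Branch 25
    (Leaf [17, 28, 2, 4, 25]) (Branch 16 (Branch 14 (Leaf [2, 16, 4, 14, 17]) (Branch 31
    (Leaf [13, 18, 16, 28, 31]) (Branch 24 (Branch 34 (Leaf [0, 16, 17, 24, 34]) (Branch 6
    (Branch 8 (Leaf [18, 29, 6, 8, 16]) (Leaf [8, 19, 21, 31, 34])) (Leaf [6, 31, 19, 21, 34])))
    (Leaf [3, 14, 21, 24, 31])))) (Branch 9 (Branch 34 (Branch 24 (Branch 27
    (Leaf [9, 34, 17, 24, 27]) (Branch 12 (Branch 14 (Leaf [12, 17, 2, 4, 14])
    (Leaf [16, 27, 1, 14, 35])) (Leaf [1, 12, 25, 27, 35]))) (Leaf [1, 26, 3, 16, 24]))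
    (Leaf [19, 35, 1, 16, 34])) (Leaf [19, 35, 1, 9, 16])))) (Branch 7 (Branch 25
    (Leaf [22, 28, 4, 7, 25]) (Branch 32 (Branch 14 (Leaf [7, 32, 4, 14, 22]) (Branch 16
    (Branch 31 (Leaf [13, 18, 16, 28, 31]) (Branch 24 (Branch 9 (Leaf [7, 32, 9, 22, 24])
    (Branch 11 (Branch 34 (Leaf [13, 24, 11, 32, 34]) (Branch 6 (Branch 8
    (Leaf [18, 29, 6, 8, 16]) (Leaf [8, 19, 21, 31, 34])) (Leaf [6, 31, 19, 21, 34])))
    (Leaf [19, 30, 1, 9, 11]))) (Leaf [3, 14, 21, 24, 31]))) (Leaf [15, 35, 14, 16, 17])))
    (Leaf [25, 30, 15, 17, 32]))) (Leaf [5, 30, 7, 15, 17]))) (Branch 9 (Branch 24 (Branch 32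
    (Branch 7 (Branch 12 (Branch 17 (Leaf [0, 9, 7, 17, 24]) (Branch 11
    (Leaf [12, 32, 9, 11, 24]) (Branch 14 (Branch 25 (Leaf [14, 25, 2, 4, 12]) (Branch 27
    (Leaf [2, 27, 4, 12, 14]) (Leaf [25, 30, 15, 17, 27]))) (Leaf [11, 22, 1, 14, 35]))))
    (Leaf [3, 12, 5, 15, 22])) (Leaf [3, 7, 5, 15, 22])) (Leaf [5, 32, 3, 15, 22]))
    (Leaf [15, 24, 3, 5, 22])) (Leaf [19, 30, 1, 9, 22]))) (Leaf [15, 26, 3, 5, 18]))) (Branch 6
    (Branch 24 (Branch 16 (Branch 23 (Leaf [4, 24, 6, 16, 23]) (Leaf [3, 23, 5, 13, 26]))
    (Leaf [1, 26, 3, 13, 16])) (Leaf [13, 24, 3, 5, 26])) (Leaf [6, 26, 3, 5, 13]))))))))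
    (Branch 23 (Branch 5 (Leaf [4, 20, 2, 5, 23]) (Branch 21 (Leaf [0, 4, 2, 21, 23]) (Branch 30
    (Leaf [4, 20, 2, 23, 30]) (Branch 35 (Leaf [0, 20, 2, 23, 35]) (Branch 24 (Branch 26
    (Leaf [2, 24, 0, 23, 26]) (Branch 13 (Branch 15 (Leaf [2, 13, 0, 15, 23]) (Branch 7
    (Branch 12 (Branch 25 (Leaf [12, 23, 2, 4, 25]) (Branch 27 (Branch 14
    (Leaf [2, 27, 4, 12, 14]) (Branch 22 (Branch 9 (Leaf [22, 27, 9, 12, 24]) (Branch 16
    (Branch 11 (Branch 6 (Leaf [4, 13, 6, 16, 23]) (Branch 34 (Branch 32
    (Leaf [13, 24, 11, 32, 34]) (Leaf [9, 14, 6, 32, 35])) (Leaf [9, 34, 6, 19, 21])))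
    (Leaf [19, 30, 1, 9, 11])) (Leaf [1, 26, 9, 16, 19]))) (Leaf [14, 25, 1, 22, 35])))
    (Leaf [25, 30, 15, 27, 28]))) (Branch 22 (Branch 14 (Leaf [4, 24, 7, 14, 22]) (Branch 25
    (Leaf [4, 24, 7, 22, 25]) (Branch 27 (Branch 11 (Branch 33 (Branch 6 (Branch 16
    (Leaf [6, 33, 4, 16, 23]) (Branch 9 (Leaf [7, 27, 6, 9, 24]) (Leaf [1, 26, 9, 16, 19])))
    (Branch 32 (Branch 34 (Leaf [13, 24, 11, 32, 34]) (Branch 16 (Branch 31
    (Leaf [13, 24, 16, 23, 31]) (Leaf [6, 31, 19, 21, 34])) (Leaf [1, 6, 14, 16, 35])))
    (Leaf [14, 25, 6, 32, 35]))) (Leaf [15, 35, 12, 14, 33])) (Leaf [1, 12, 11, 14, 35]))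
    (Leaf [12, 28, 10, 25, 27])))) (Leaf [3, 12, 5, 15, 22]))) (Leaf [15, 26, 5, 7, 28])))
    (Leaf [3, 28, 5, 13, 26]))) (Branch 6 (Branch 25 (Leaf [2, 6, 4, 23, 25]) (Branch 7
    (Branch 27 (Branch 14 (Leaf [7, 27, 4, 6, 14]) (Branch 16 (Branch 33
    (Leaf [6, 33, 4, 16, 23]) (Branch 13 (Leaf [4, 13, 6, 16, 23]) (Branch 12 (Branch 15
    (Leaf [12, 23, 0, 2, 15]) (Leaf [5, 25, 13, 15, 28])) (Leaf [13, 33, 10, 12, 25]))))
    (Leaf [24, 35, 1, 14, 16]))) (Leaf [10, 35, 25, 27, 28])) (Leaf [10, 35, 7, 25, 28])))
    (Leaf [5, 21, 3, 6, 24]))))))) (Branch 12 (Branch 5 (Leaf [4, 20, 2, 5, 12]) (Branch 30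
    (Leaf [4, 20, 2, 12, 30]) (Branch 35 (Leaf [0, 20, 2, 12, 35]) (Branch 13 (Branch 15
    (Leaf [2, 13, 0, 12, 15]) (Branch 18 (Branch 22 (Branch 7 (Branch 33 (Branch 21
    (Leaf [0, 20, 18, 21, 33]) (Branch 26 (Leaf [7, 18, 0, 26, 33]) (Branch 8 (Branch 24
    (Branch 9 (Leaf [7, 12, 9, 22, 24]) (Branch 11 (Branch 16 (Branch 6
    (Leaf [18, 29, 6, 8, 16]) (Branch 32 (Branch 34 (Leaf [29, 34, 8, 11, 32])
    (Leaf [9, 34, 6, 19, 21])) (Leaf [21, 32, 6, 9, 19]))) (Leaf [19, 35, 1, 9, 16]))
    (Leaf [19, 30, 1, 9, 11]))) (Leaf [3, 23, 5, 24, 26])) (Leaf [15, 26, 5, 8, 23]))))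
    (Leaf [5, 30, 15, 23, 33])) (Leaf [5, 30, 7, 15, 28])) (Leaf [3, 23, 5, 15, 22]))
    (Leaf [3, 28, 5, 15, 18]))) (Branch 11 (Branch 14 (Leaf [2, 11, 4, 12, 14]) (Branch 15
    (Branch 25 (Branch 22 (Leaf [2, 22, 12, 15, 25]) (Branch 27 (Leaf [2, 27, 12, 15, 25])
    (Branch 7 (Branch 17 (Leaf [2, 7, 15, 17, 25]) (Leaf [1, 17, 14, 27, 35]))
    (Leaf [1, 7, 14, 22, 35])))) (Leaf [23, 28, 10, 13, 25])) (Leaf [3, 23, 5, 13, 15])))
    (Leaf [3, 30, 1, 11, 13])))))) (Branch 31 (Branch 25 (Branch 9 (Branch 17 (Branch 5
    (Leaf [5, 25, 2, 4, 17]) (Branch 30 (Leaf [25, 30, 2, 4, 17]) (Branch 15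
    (Leaf [0, 25, 2, 15, 17]) (Branch 7 (Leaf [2, 7, 4, 17, 25]) (Leaf [5, 30, 7, 15, 28])))))
    (Branch 11 (Branch 8 (Branch 21 (Leaf [9, 29, 8, 11, 21]) (Branch 26
    (Leaf [9, 29, 8, 11, 26]) (Branch 32 (Leaf [9, 29, 8, 11, 32]) (Branch 5 (Branch 18
    (Leaf [20, 31, 5, 8, 18]) (Branch 6 (Leaf [6, 31, 5, 8, 29]) (Leaf [3, 19, 6, 18, 21])))
    (Branch 18 (Branch 15 (Leaf [0, 25, 8, 15, 18]) (Branch 16 (Leaf [18, 29, 8, 16, 31])
    (Branch 14 (Branch 33 (Branch 22 (Branch 7 (Leaf [22, 33, 4, 7, 14])
    (Leaf [17, 28, 5, 7, 15])) (Leaf [5, 32, 3, 15, 22])) (Leaf [5, 16, 15, 23, 33]))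
    (Leaf [16, 32, 14, 15, 17])))) (Leaf [3, 28, 5, 18, 26])))))) (Branch 14 (Branch 21
    (Leaf [4, 31, 2, 14, 21]) (Branch 32 (Leaf [4, 29, 11, 14, 32]) (Branch 6 (Branch 27
    (Leaf [14, 25, 4, 6, 27]) (Branch 16 (Leaf [4, 29, 6, 14, 16]) (Branch 34 (Branch 24
    (Branch 5 (Leaf [6, 31, 5, 24, 34]) (Branch 26 (Leaf [24, 29, 11, 14, 26])
    (Leaf [5, 16, 8, 23, 26]))) (Leaf [16, 27, 1, 3, 24])) (Leaf [1, 10, 8, 27, 34]))))
    (Branch 13 (Branch 34 (Branch 16 (Leaf [14, 34, 13, 16, 31]) (Leaf [16, 21, 6, 8, 23]))
    (Leaf [23, 34, 6, 8, 21])) (Leaf [21, 32, 3, 6, 13]))))) (Branch 16 (Branch 22 (Branch 15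
    (Branch 7 (Leaf [4, 15, 7, 22, 25]) (Branch 32 (Leaf [4, 15, 22, 25, 32]) (Branch 24
    (Branch 35 (Branch 6 (Leaf [24, 35, 6, 9, 16]) (Branch 13 (Branch 34
    (Leaf [0, 16, 13, 15, 34]) (Leaf [8, 19, 6, 32, 34])) (Leaf [3, 14, 6, 13, 32])))
    (Leaf [7, 32, 14, 17, 35])) (Leaf [7, 32, 14, 17, 24])))) (Branch 5 (Branch 7
    (Leaf [5, 25, 4, 7, 22]) (Branch 24 (Branch 30 (Branch 32 (Leaf [24, 30, 9, 11, 32])
    (Leaf [7, 32, 14, 15, 17])) (Leaf [14, 30, 7, 15, 17])) (Leaf [15, 24, 7, 14, 17])))
    (Branch 7 (Branch 26 (Branch 33 (Leaf [4, 26, 7, 25, 33]) (Leaf [8, 33, 5, 15, 23]))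
    (Leaf [15, 26, 5, 8, 23])) (Leaf [8, 17, 5, 7, 15])))) (Branch 24 (Branch 26
    (Leaf [11, 16, 9, 24, 26]) (Branch 35 (Branch 6 (Leaf [24, 35, 6, 9, 16]) (Branch 32
    (Leaf [24, 35, 9, 11, 32]) (Branch 34 (Branch 5 (Leaf [5, 16, 24, 31, 34])
    (Leaf [6, 26, 5, 8, 23])) (Leaf [1, 32, 19, 22, 34])))) (Leaf [1, 12, 14, 22, 35])))
    (Leaf [3, 14, 1, 22, 24]))) (Branch 13 (Branch 24 (Branch 34 (Branch 5
    (Leaf [13, 24, 5, 31, 34]) (Branch 26 (Leaf [9, 34, 11, 24, 26]) (Leaf [5, 16, 8, 23, 26])))
    (Leaf [8, 19, 1, 16, 34])) (Leaf [3, 14, 1, 16, 24])) (Leaf [3, 14, 1, 13, 16])))))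
    (Branch 18 (Branch 13 (Branch 8 (Branch 21 (Leaf [18, 29, 0, 8, 21]) (Branch 5
    (Leaf [20, 31, 5, 8, 18]) (Branch 15 (Leaf [0, 25, 8, 15, 18]) (Branch 16
    (Leaf [18, 29, 8, 16, 31]) (Branch 34 (Branch 33 (Branch 35 (Leaf [0, 20, 18, 33, 35])
    (Branch 32 (Leaf [8, 13, 31, 32, 34]) (Branch 14 (Branch 22 (Branch 7
    (Leaf [22, 33, 4, 7, 14]) (Leaf [17, 28, 5, 7, 15])) (Leaf [5, 32, 3, 15, 22]))
    (Leaf [11, 16, 1, 14, 35])))) (Leaf [5, 16, 15, 23, 33])) (Leaf [1, 21, 11, 19, 34]))))))
    (Branch 34 (Branch 21 (Leaf [0, 31, 13, 21, 34]) (Leaf [10, 21, 8, 11, 23]))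
    (Leaf [8, 19, 1, 11, 34]))) (Leaf [1, 10, 3, 11, 13])) (Leaf [3, 19, 1, 11, 18]))))
    (Branch 27 (Branch 22 (Branch 17 (Leaf [2, 27, 4, 17, 25]) (Branch 7 (Branch 15
    (Leaf [4, 15, 7, 22, 25]) (Branch 24 (Leaf [4, 24, 7, 22, 25]) (Branch 30
    (Leaf [4, 20, 7, 22, 30]) (Branch 33 (Branch 16 (Branch 18 (Branch 26
    (Leaf [26, 31, 16, 18, 33]) (Branch 5 (Leaf [5, 16, 18, 31, 33]) (Branch 6
    (Leaf [7, 27, 4, 6, 25]) (Leaf [6, 26, 3, 5, 24])))) (Leaf [17, 28, 15, 18, 30]))
    (Leaf [19, 24, 9, 16, 17])) (Leaf [10, 30, 9, 12, 33]))))) (Leaf [17, 28, 7, 9, 10])))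
    (Leaf [10, 19, 9, 12, 22])) (Leaf [12, 28, 9, 10, 27]))) (Branch 22 (Branch 27 (Branch 33
    (Branch 7 (Branch 5 (Leaf [22, 33, 4, 5, 7]) (Branch 14 (Leaf [22, 33, 4, 7, 14]) (Branch 35
    (Leaf [22, 33, 7, 20, 35]) (Branch 11 (Branch 18 (Branch 15 (Leaf [7, 18, 0, 15, 33])
    (Branch 26 (Leaf [7, 18, 0, 26, 33]) (Branch 8 (Branch 24 (Branch 16
    (Leaf [18, 29, 8, 16, 31]) (Branch 32 (Leaf [11, 31, 8, 29, 32]) (Branch 9 (Branch 17
    (Leaf [7, 27, 9, 17, 24]) (Leaf [16, 32, 14, 15, 17])) (Leaf [1, 26, 9, 16, 19]))))
    (Leaf [3, 23, 5, 24, 26])) (Leaf [15, 26, 5, 8, 23])))) (Leaf [10, 35, 18, 25, 28]))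
    (Leaf [1, 12, 11, 14, 35]))))) (Branch 8 (Branch 9 (Branch 26 (Leaf [9, 29, 8, 26, 27])
    (Leaf [10, 26, 7, 25, 28])) (Leaf [9, 25, 7, 10, 28])) (Leaf [8, 28, 7, 10, 25])))
    (Leaf [12, 23, 10, 25, 33])) (Leaf [12, 28, 10, 25, 27])) (Leaf [12, 23, 10, 22, 25])))
    (Branch 18 (Branch 33 (Branch 21 (Leaf [0, 20, 18, 21, 33]) (Branch 35
    (Leaf [0, 20, 18, 33, 35]) (Branch 24 (Branch 8 (Branch 26 (Leaf [18, 29, 0, 8, 26])
    (Branch 15 (Leaf [8, 33, 0, 15, 18]) (Branch 5 (Leaf [8, 33, 5, 18, 20]) (Branch 7
    (Branch 30 (Leaf [4, 20, 7, 30, 33]) (Branch 22 (Branch 14 (Leaf [22, 33, 4, 7, 14])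
    (Branch 25 (Leaf [22, 33, 4, 7, 25]) (Branch 11 (Branch 6 (Branch 9 (Leaf [8, 24, 6, 7, 9])
    (Branch 16 (Leaf [18, 29, 6, 8, 16]) (Leaf [1, 26, 9, 16, 19]))) (Branch 32 (Branch 34
    (Leaf [29, 34, 8, 11, 32]) (Leaf [6, 31, 19, 21, 34])) (Leaf [23, 32, 6, 25, 35])))
    (Leaf [1, 12, 11, 14, 35])))) (Leaf [5, 30, 12, 15, 22]))) (Leaf [5, 10, 7, 28, 31])))))
    (Leaf [10, 21, 8, 23, 31])) (Leaf [3, 23, 21, 24, 31])))) (Leaf [12, 23, 10, 31, 33]))
    (Leaf [3, 28, 10, 18, 31])))))) (Branch 18 (Branch 22 (Branch 27 (Branch 13 (Branch 5
    (Branch 12 (Leaf [2, 22, 4, 5, 12]) (Branch 23 (Leaf [2, 22, 4, 5, 23]) (Branch 33 (Branch 7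
    (Leaf [22, 33, 4, 5, 7]) (Branch 17 (Branch 8 (Branch 14 (Leaf [4, 29, 14, 17, 27])
    (Branch 35 (Leaf [2, 18, 0, 17, 35]) (Branch 25 (Leaf [5, 25, 2, 4, 17]) (Branch 6
    (Leaf [18, 29, 5, 6, 8]) (Leaf [14, 25, 6, 7, 35]))))) (Leaf [7, 23, 8, 10, 20]))
    (Leaf [10, 19, 7, 17, 20]))) (Leaf [12, 23, 10, 20, 33])))) (Branch 7 (Branch 33 (Branch 15
    (Leaf [7, 18, 0, 15, 33]) (Branch 26 (Leaf [7, 18, 0, 26, 33]) (Branch 35
    (Leaf [7, 18, 0, 33, 35]) (Branch 14 (Leaf [22, 33, 4, 7, 14]) (Branch 25
    (Leaf [22, 33, 4, 7, 25]) (Branch 30 (Leaf [22, 33, 4, 7, 30]) (Branch 34 (Branch 6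
    (Branch 8 (Leaf [29, 34, 6, 8, 27]) (Branch 23 (Branch 16 (Leaf [6, 33, 4, 16, 23])
    (Branch 9 (Branch 17 (Branch 24 (Leaf [9, 34, 17, 24, 27]) (Leaf [1, 26, 14, 16, 24]))
    (Leaf [15, 35, 14, 16, 17])) (Leaf [1, 26, 8, 9, 16]))) (Leaf [20, 25, 8, 10, 23])))
    (Branch 24 (Branch 32 (Branch 9 (Leaf [7, 32, 9, 22, 24]) (Branch 11
    (Leaf [13, 24, 11, 32, 34]) (Leaf [19, 30, 1, 9, 11]))) (Leaf [14, 25, 6, 32, 35]))
    (Leaf [6, 26, 3, 5, 24]))) (Branch 11 (Branch 16 (Branch 8 (Branch 6
    (Leaf [18, 29, 6, 8, 16]) (Branch 21 (Leaf [18, 29, 8, 11, 21]) (Branch 31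
    (Leaf [18, 29, 8, 16, 31]) (Leaf [6, 31, 19, 21, 34])))) (Leaf [15, 26, 5, 8, 34]))
    (Leaf [19, 35, 1, 16, 34])) (Leaf [19, 35, 1, 11, 34]))))))))) (Branch 12 (Branch 23
    (Branch 15 (Leaf [12, 23, 0, 2, 15]) (Branch 35 (Leaf [12, 23, 0, 2, 35]) (Branch 21
    (Leaf [2, 13, 0, 21, 23]) (Branch 26 (Leaf [2, 13, 0, 23, 26]) (Branch 14
    (Leaf [2, 22, 4, 12, 14]) (Branch 34 (Branch 16 (Branch 32 (Branch 6
    (Leaf [23, 34, 6, 13, 16]) (Branch 24 (Branch 9 (Leaf [22, 27, 9, 12, 24]) (Branch 11
    (Leaf [13, 24, 11, 32, 34]) (Leaf [6, 11, 9, 19, 21]))) (Leaf [3, 14, 6, 21, 24])))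
    (Leaf [15, 35, 14, 32, 33])) (Leaf [15, 26, 14, 16, 33])) (Leaf [15, 26, 5, 33, 34])))))))
    (Leaf [5, 10, 20, 23, 33])) (Leaf [5, 10, 12, 20, 33]))) (Branch 8 (Branch 17 (Branch 28
    (Branch 26 (Leaf [0, 27, 8, 26, 29]) (Branch 14 (Leaf [4, 29, 14, 17, 27]) (Branch 35
    (Leaf [17, 28, 0, 2, 35]) (Branch 25 (Leaf [17, 28, 2, 4, 25]) (Branch 6 (Branch 16
    (Leaf [18, 29, 6, 8, 16]) (Branch 9 (Leaf [9, 29, 6, 8, 27]) (Leaf [1, 26, 9, 16, 19])))
    (Leaf [14, 25, 6, 7, 35])))))) (Leaf [5, 10, 7, 20, 28])) (Leaf [5, 10, 7, 17, 20]))
    (Leaf [5, 10, 7, 8, 20])))) (Leaf [1, 10, 3, 13, 20])) (Leaf [3, 19, 1, 20, 27]))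
    (Leaf [3, 19, 1, 20, 22])) (Leaf [3, 19, 1, 18, 20])))"

lemma certifies_cert_7: "certifies (J5_copy G36) [29, 4, 2, 0] [19, 3, 1] cert_7"
  unfolding cert_7_def G36_def by (simp add: adjacent_diff_graph diff_adj_def distances_36_def)

definition cert_8 :: split_tree where
  "cert_8 =
    Branch 11 (Branch 16 (Branch 22 (Branch 27 (Branch 14 (Branch 6 (Leaf [16, 27, 4, 6, 14])
    (Branch 21 (Leaf [2, 11, 4, 14, 21]) (Branch 32 (Leaf [11, 22, 4, 14, 32])
    (Leaf [21, 32, 6, 19, 29])))) (Branch 23 (Branch 21 (Leaf [0, 4, 2, 21, 23]) (Branch 5
    (Leaf [2, 22, 4, 5, 23]) (Branch 25 (Leaf [2, 22, 4, 23, 25]) (Branch 6 (Branch 31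
    (Branch 10 (Leaf [0, 31, 2, 10, 23]) (Branch 33 (Leaf [6, 33, 4, 16, 23]) (Branch 8
    (Leaf [4, 8, 6, 16, 23]) (Branch 13 (Leaf [4, 13, 6, 16, 23]) (Branch 18 (Branch 12
    (Branch 15 (Leaf [12, 23, 0, 2, 15]) (Branch 26 (Branch 28 (Leaf [26, 31, 16, 18, 28])
    (Leaf [3, 28, 5, 13, 15])) (Leaf [15, 26, 3, 5, 13]))) (Leaf [13, 33, 10, 12, 25]))
    (Leaf [1, 10, 8, 18, 25])))))) (Leaf [3, 14, 21, 29, 31])) (Leaf [3, 14, 6, 21, 29])))))
    (Branch 25 (Branch 17 (Leaf [2, 27, 4, 17, 25]) (Branch 32 (Branch 24
    (Leaf [4, 24, 22, 25, 32]) (Branch 35 (Leaf [4, 35, 22, 25, 32]) (Branch 6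
    (Leaf [27, 32, 4, 6, 25]) (Branch 7 (Leaf [7, 32, 4, 22, 25]) (Leaf [24, 35, 6, 7, 14])))))
    (Leaf [14, 19, 17, 29, 32]))) (Branch 30 (Branch 12 (Leaf [2, 11, 4, 12, 30]) (Branch 17
    (Leaf [2, 27, 4, 17, 30]) (Branch 32 (Leaf [11, 22, 4, 30, 32]) (Branch 6 (Branch 31
    (Branch 24 (Branch 34 (Leaf [6, 31, 16, 24, 34]) (Leaf [29, 34, 17, 19, 32]))
    (Leaf [24, 29, 14, 17, 32])) (Leaf [14, 19, 12, 29, 31])) (Leaf [3, 14, 6, 29, 32])))))
    (Branch 31 (Branch 6 (Branch 5 (Branch 28 (Leaf [4, 31, 2, 5, 28]) (Branch 7
    (Leaf [6, 22, 4, 5, 7]) (Branch 15 (Branch 17 (Leaf [4, 15, 2, 5, 17]) (Branch 9 (Branch 10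
    (Branch 24 (Branch 8 (Leaf [11, 27, 8, 9, 10]) (Branch 26 (Leaf [6, 26, 9, 16, 24])
    (Leaf [7, 23, 8, 25, 26]))) (Leaf [14, 25, 7, 17, 24])) (Leaf [17, 28, 7, 10, 25]))
    (Leaf [19, 30, 7, 9, 17]))) (Leaf [25, 30, 7, 15, 28])))) (Branch 18 (Branch 8
    (Leaf [6, 31, 8, 16, 18]) (Branch 26 (Branch 33 (Leaf [26, 31, 16, 18, 33]) (Branch 20
    (Branch 15 (Branch 10 (Branch 17 (Leaf [0, 16, 15, 17, 18]) (Branch 32 (Branch 12
    (Leaf [10, 15, 0, 2, 12]) (Branch 35 (Branch 7 (Leaf [7, 32, 20, 22, 35]) (Branch 9
    (Leaf [9, 20, 22, 32, 35]) (Leaf [19, 30, 7, 9, 17]))) (Leaf [14, 25, 12, 33, 35])))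
    (Leaf [14, 19, 17, 29, 32]))) (Leaf [8, 33, 10, 23, 25])) (Leaf [8, 33, 5, 15, 23]))
    (Leaf [5, 30, 20, 23, 33]))) (Leaf [5, 25, 8, 23, 26]))) (Branch 20 (Branch 26 (Branch 10
    (Branch 17 (Leaf [0, 20, 2, 10, 17]) (Branch 32 (Branch 35 (Branch 7
    (Leaf [7, 32, 20, 22, 35]) (Branch 9 (Leaf [9, 20, 22, 32, 35]) (Leaf [19, 30, 7, 9, 17])))
    (Leaf [1, 17, 18, 25, 35])) (Leaf [14, 19, 17, 29, 32]))) (Branch 8 (Branch 33 (Branch 7
    (Leaf [8, 33, 0, 7, 26]) (Branch 9 (Leaf [16, 27, 6, 8, 9]) (Branch 17 (Branch 28 (Branch 13
    (Leaf [26, 31, 13, 16, 28]) (Branch 15 (Leaf [17, 28, 0, 2, 15])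
    (Leaf [10, 15, 13, 23, 25]))) (Leaf [10, 30, 7, 9, 28])) (Leaf [10, 19, 7, 9, 17]))))
    (Leaf [18, 23, 10, 25, 33])) (Leaf [18, 23, 8, 10, 25]))) (Leaf [18, 29, 3, 5, 26]))
    (Leaf [3, 19, 1, 18, 20])))) (Branch 13 (Branch 21 (Branch 32 (Branch 28
    (Leaf [4, 13, 11, 21, 28]) (Branch 8 (Branch 9 (Leaf [21, 32, 8, 9, 11]) (Branch 18
    (Leaf [0, 11, 8, 18, 21]) (Branch 20 (Branch 35 (Branch 7 (Leaf [7, 32, 20, 22, 35])
    (Leaf [19, 30, 6, 7, 9])) (Leaf [1, 6, 18, 25, 35])) (Leaf [1, 28, 18, 20, 30])))) (Branch 5
    (Branch 7 (Branch 24 (Branch 26 (Leaf [0, 5, 7, 24, 26]) (Leaf [6, 26, 8, 23, 25]))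
    (Leaf [8, 24, 6, 23, 25])) (Leaf [7, 23, 6, 8, 25])) (Leaf [23, 29, 5, 6, 8]))))
    (Leaf [3, 14, 6, 29, 32])) (Leaf [3, 14, 6, 21, 29])) (Leaf [25, 30, 6, 13, 23])))
    (Branch 12 (Branch 21 (Branch 28 (Leaf [0, 4, 2, 21, 28]) (Branch 5 (Leaf [2, 22, 4, 5, 12])
    (Leaf [3, 28, 5, 29, 31]))) (Leaf [3, 14, 21, 29, 31])) (Leaf [14, 19, 12, 29, 31])))))))
    (Leaf [3, 19, 1, 27, 29])) (Leaf [3, 19, 1, 22, 29])) (Leaf [3, 19, 1, 16, 29]))
    (Leaf [3, 19, 1, 11, 29])"

lemma certifies_cert_8: "certifies (J5_copy G36) [4, 2, 0] [29, 19, 3, 1] cert_8"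
  unfolding cert_8_def G36_def by (simp add: adjacent_diff_graph diff_adj_def distances_36_def)

definition cert_9 :: split_tree where
  "cert_9 =
    Branch 11 (Branch 16 (Branch 22 (Branch 27 (Branch 5 (Branch 15 (Branch 12
    (Leaf [0, 5, 2, 12, 15]) (Branch 17 (Leaf [0, 5, 2, 15, 17]) (Branch 23
    (Leaf [0, 5, 2, 15, 23]) (Branch 28 (Leaf [0, 5, 2, 15, 28]) (Branch 33 (Branch 7
    (Leaf [22, 33, 5, 7, 15]) (Branch 34 (Leaf [22, 33, 5, 15, 34]) (Branch 18
    (Leaf [0, 5, 15, 18, 33]) (Branch 25 (Branch 30 (Branch 32 (Leaf [25, 30, 15, 22, 32])
    (Branch 19 (Branch 14 (Branch 31 (Leaf [15, 31, 14, 16, 33]) (Branch 35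
    (Leaf [15, 35, 14, 16, 33]) (Branch 20 (Branch 21 (Leaf [2, 22, 19, 20, 21])
    (Leaf [3, 28, 18, 21, 31])) (Leaf [7, 18, 17, 20, 35])))) (Leaf [7, 32, 4, 14, 17]))
    (Leaf [4, 34, 17, 19, 32]))) (Leaf [17, 28, 4, 7, 30])) (Leaf [17, 28, 4, 7, 25])))))
    (Branch 25 (Branch 30 (Branch 7 (Leaf [5, 25, 7, 15, 22]) (Branch 32
    (Leaf [25, 30, 15, 22, 32]) (Branch 14 (Branch 19 (Branch 6 (Branch 9
    (Leaf [16, 27, 6, 9, 19]) (Branch 24 (Leaf [16, 27, 6, 14, 24]) (Branch 35
    (Leaf [16, 27, 6, 14, 35]) (Leaf [24, 35, 7, 9, 17])))) (Branch 21 (Branch 13 (Branch 24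
    (Leaf [13, 24, 11, 14, 21]) (Leaf [4, 24, 3, 6, 32])) (Leaf [4, 13, 3, 6, 32]))
    (Leaf [21, 32, 3, 4, 6]))) (Leaf [7, 32, 4, 17, 19])) (Leaf [17, 33, 4, 7, 14]))))
    (Leaf [12, 23, 4, 30, 33])) (Leaf [12, 23, 4, 25, 33]))))))) (Branch 20 (Branch 12
    (Leaf [2, 22, 5, 12, 20]) (Branch 23 (Leaf [2, 22, 5, 20, 23]) (Branch 30 (Branch 17
    (Leaf [5, 30, 2, 17, 20]) (Branch 7 (Leaf [5, 30, 7, 20, 22]) (Branch 14 (Branch 6
    (Branch 24 (Leaf [16, 27, 6, 14, 24]) (Branch 29 (Leaf [16, 27, 6, 14, 29]) (Branch 35
    (Leaf [16, 27, 6, 14, 35]) (Branch 9 (Branch 32 (Leaf [6, 11, 9, 30, 32]) (Branch 19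
    (Leaf [16, 27, 6, 9, 19]) (Leaf [4, 29, 17, 19, 32]))) (Leaf [24, 35, 7, 9, 17])))))
    (Branch 21 (Branch 19 (Leaf [2, 22, 19, 20, 21]) (Leaf [6, 17, 4, 7, 19]))
    (Leaf [3, 23, 4, 6, 21]))) (Leaf [4, 15, 7, 14, 17])))) (Branch 33 (Branch 7
    (Leaf [22, 33, 5, 7, 20]) (Branch 17 (Branch 28 (Leaf [17, 28, 2, 5, 20])
    (Leaf [4, 15, 7, 28, 30])) (Leaf [4, 15, 7, 17, 30]))) (Leaf [12, 23, 4, 30, 33])))))
    (Branch 13 (Branch 18 (Branch 8 (Branch 6 (Leaf [5, 16, 6, 8, 18]) (Branch 21
    (Leaf [0, 11, 8, 18, 21]) (Branch 32 (Branch 24 (Branch 14 (Leaf [13, 24, 11, 14, 32])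
    (Leaf [3, 14, 4, 6, 21])) (Leaf [4, 24, 3, 6, 21])) (Leaf [21, 32, 3, 4, 6])))) (Branch 12
    (Branch 10 (Leaf [2, 13, 0, 10, 12]) (Branch 31 (Leaf [2, 13, 5, 12, 31]) (Branch 7
    (Branch 23 (Branch 29 (Branch 14 (Leaf [13, 29, 11, 12, 14]) (Branch 19
    (Leaf [0, 11, 12, 19, 29]) (Branch 21 (Leaf [0, 11, 13, 21, 23]) (Branch 24 (Branch 34
    (Branch 32 (Leaf [5, 32, 22, 24, 34]) (Branch 17 (Leaf [7, 34, 0, 17, 24])
    (Leaf [14, 19, 4, 17, 32]))) (Leaf [8, 19, 21, 31, 34])) (Leaf [3, 14, 21, 24, 31])))))
    (Leaf [3, 8, 10, 29, 31])) (Leaf [20, 31, 8, 10, 23])) (Leaf [20, 31, 7, 8, 10]))))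
    (Branch 33 (Branch 26 (Leaf [0, 5, 18, 26, 33]) (Branch 31 (Leaf [5, 16, 18, 31, 33])
    (Branch 35 (Leaf [0, 16, 18, 33, 35]) (Branch 7 (Branch 10 (Leaf [7, 18, 0, 10, 33])
    (Branch 23 (Branch 29 (Branch 21 (Leaf [0, 11, 13, 21, 23]) (Branch 24
    (Leaf [7, 23, 5, 22, 24]) (Branch 6 (Leaf [5, 16, 6, 13, 23]) (Branch 14 (Branch 9
    (Branch 34 (Branch 30 (Leaf [22, 33, 7, 9, 30]) (Branch 32 (Leaf [14, 34, 11, 13, 32])
    (Branch 17 (Leaf [16, 27, 14, 17, 29]) (Leaf [30, 35, 17, 20, 32]))))
    (Leaf [3, 34, 6, 21, 24])) (Leaf [3, 9, 6, 21, 24])) (Leaf [4, 24, 6, 14, 21])))))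
    (Leaf [3, 8, 10, 29, 31])) (Leaf [20, 31, 8, 10, 23]))) (Branch 10 (Branch 25
    (Leaf [0, 25, 10, 18, 33]) (Leaf [15, 26, 7, 8, 25])) (Leaf [20, 31, 7, 8, 10]))))))
    (Branch 14 (Branch 25 (Branch 30 (Branch 32 (Leaf [14, 30, 11, 13, 32]) (Branch 34
    (Branch 35 (Branch 23 (Leaf [2, 22, 23, 25, 35]) (Branch 7 (Leaf [14, 25, 7, 22, 35])
    (Branch 10 (Leaf [0, 11, 10, 13, 34]) (Leaf [7, 23, 8, 10, 20]))))
    (Leaf [12, 32, 20, 33, 35])) (Leaf [8, 33, 15, 32, 34]))) (Leaf [4, 15, 12, 30, 33]))
    (Leaf [4, 15, 12, 25, 33])) (Leaf [4, 15, 12, 14, 33]))))) (Branch 8 (Branch 19 (Branch 35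
    (Branch 10 (Branch 21 (Branch 9 (Leaf [11, 27, 8, 9, 10]) (Branch 28
    (Leaf [0, 11, 10, 13, 28]) (Branch 17 (Leaf [10, 19, 0, 2, 17]) (Branch 25 (Branch 6
    (Leaf [8, 35, 6, 25, 27]) (Branch 7 (Leaf [0, 25, 7, 8, 10]) (Branch 24 (Branch 14
    (Leaf [13, 24, 11, 14, 21]) (Leaf [4, 15, 7, 14, 17])) (Leaf [6, 17, 7, 9, 24]))))
    (Leaf [17, 28, 15, 18, 25]))))) (Leaf [1, 21, 3, 18, 20])) (Leaf [1, 10, 3, 18, 20]))
    (Leaf [3, 35, 1, 18, 20])) (Leaf [3, 19, 1, 18, 20])) (Leaf [3, 8, 1, 18, 20]))) (Branch 18
    (Branch 30 (Branch 10 (Branch 21 (Branch 32 (Branch 9 (Leaf [11, 22, 9, 30, 32]) (Branch 28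
    (Leaf [0, 11, 10, 18, 28]) (Branch 19 (Leaf [0, 11, 18, 19, 21]) (Branch 23
    (Leaf [10, 21, 0, 2, 23]) (Branch 17 (Leaf [2, 18, 0, 10, 17]) (Branch 33
    (Leaf [10, 21, 0, 18, 33]) (Branch 7 (Branch 25 (Branch 35 (Leaf [7, 32, 22, 25, 35])
    (Branch 12 (Leaf [0, 25, 2, 10, 12]) (Leaf [9, 20, 12, 33, 35])))
    (Leaf [23, 28, 13, 15, 25])) (Leaf [4, 9, 7, 17, 19])))))))) (Leaf [1, 32, 3, 13, 20]))
    (Leaf [1, 21, 3, 13, 20])) (Leaf [1, 10, 3, 13, 20])) (Leaf [3, 30, 1, 13, 20]))
    (Leaf [13, 18, 1, 3, 20]))))) (Branch 6 (Branch 14 (Branch 24 (Leaf [16, 27, 6, 14, 24])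
    (Branch 29 (Leaf [16, 27, 6, 14, 29]) (Branch 35 (Leaf [16, 27, 6, 14, 35]) (Branch 26
    (Branch 31 (Branch 13 (Leaf [6, 26, 13, 14, 16]) (Branch 33 (Leaf [26, 31, 14, 16, 33])
    (Branch 7 (Branch 28 (Leaf [2, 7, 0, 26, 28]) (Branch 15 (Branch 25
    (Leaf [14, 25, 7, 15, 22]) (Branch 12 (Leaf [2, 22, 12, 14, 15])
    (Leaf [4, 35, 12, 25, 33]))) (Leaf [3, 28, 5, 13, 15]))) (Branch 12 (Branch 15
    (Leaf [2, 22, 12, 14, 15]) (Leaf [4, 15, 5, 7, 33])) (Leaf [7, 12, 4, 5, 33])))))
    (Leaf [24, 29, 3, 5, 31])) (Leaf [24, 29, 3, 5, 26]))))) (Branch 9 (Branch 8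
    (Leaf [16, 27, 6, 8, 9]) (Branch 24 (Leaf [16, 27, 6, 9, 24]) (Branch 35
    (Leaf [16, 27, 6, 9, 35]) (Branch 7 (Branch 30 (Leaf [7, 27, 6, 9, 30]) (Branch 26
    (Branch 28 (Leaf [2, 7, 0, 26, 28]) (Branch 33 (Leaf [0, 9, 7, 26, 33]) (Branch 12
    (Branch 23 (Branch 13 (Leaf [6, 26, 13, 16, 23]) (Branch 15 (Leaf [12, 23, 0, 2, 15])
    (Leaf [3, 28, 5, 13, 15]))) (Leaf [5, 30, 4, 23, 33])) (Leaf [4, 35, 12, 14, 33]))))
    (Branch 13 (Branch 23 (Branch 34 (Leaf [23, 34, 6, 13, 16]) (Leaf [3, 34, 5, 24, 26]))
    (Leaf [8, 24, 5, 23, 26])) (Leaf [13, 24, 3, 5, 26])))) (Branch 17 (Branch 33 (Branch 26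
    (Branch 28 (Leaf [28, 33, 9, 16, 26]) (Branch 30 (Leaf [2, 27, 9, 17, 30])
    (Leaf [5, 30, 4, 7, 28]))) (Leaf [8, 24, 5, 7, 26])) (Leaf [5, 14, 4, 7, 33]))
    (Leaf [5, 14, 4, 7, 17])))))) (Branch 34 (Branch 8 (Leaf [16, 27, 6, 8, 34]) (Branch 24
    (Leaf [16, 27, 6, 24, 34]) (Branch 13 (Branch 23 (Leaf [23, 34, 6, 13, 16]) (Branch 21
    (Leaf [16, 21, 6, 13, 34]) (Branch 31 (Leaf [6, 31, 13, 16, 34])
    (Leaf [5, 21, 8, 23, 31])))) (Branch 26 (Branch 31 (Branch 20 (Branch 33
    (Leaf [26, 31, 16, 33, 34]) (Branch 7 (Branch 12 (Branch 30 (Leaf [2, 22, 12, 20, 30])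
    (Branch 28 (Leaf [2, 7, 0, 26, 28]) (Branch 23 (Branch 15 (Leaf [12, 23, 0, 2, 15])
    (Leaf [3, 28, 5, 13, 15])) (Leaf [5, 30, 4, 23, 33])))) (Leaf [5, 14, 4, 12, 33]))
    (Leaf [5, 14, 4, 7, 33]))) (Leaf [1, 5, 3, 13, 20])) (Leaf [13, 24, 3, 5, 31]))
    (Leaf [13, 24, 3, 5, 26]))))) (Branch 26 (Branch 7 (Branch 28 (Leaf [2, 7, 0, 26, 28])
    (Branch 15 (Branch 23 (Leaf [15, 26, 0, 2, 23]) (Branch 33 (Leaf [15, 26, 0, 7, 33])
    (Branch 25 (Branch 30 (Leaf [25, 30, 7, 15, 22]) (Leaf [5, 30, 4, 23, 33]))
    (Leaf [5, 25, 4, 23, 33])))) (Branch 13 (Branch 18 (Branch 8 (Leaf [6, 26, 8, 16, 18])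
    (Branch 23 (Leaf [6, 26, 13, 16, 23]) (Leaf [23, 34, 5, 8, 15]))) (Leaf [3, 28, 5, 15, 18]))
    (Leaf [3, 28, 5, 13, 15])))) (Branch 17 (Branch 33 (Branch 18 (Leaf [0, 16, 18, 26, 33])
    (Branch 19 (Leaf [17, 26, 0, 2, 19]) (Branch 20 (Branch 10 (Leaf [0, 20, 2, 10, 17])
    (Branch 35 (Leaf [0, 20, 2, 17, 35]) (Branch 31 (Branch 28 (Branch 13
    (Leaf [26, 31, 13, 16, 28]) (Branch 15 (Leaf [17, 28, 0, 2, 15]) (Leaf [13, 18, 3, 5, 15])))
    (Leaf [10, 35, 7, 9, 28])) (Leaf [5, 10, 3, 18, 31])))) (Leaf [3, 19, 1, 18, 20]))))
    (Leaf [5, 14, 4, 7, 33])) (Leaf [5, 14, 4, 7, 17]))) (Branch 13 (Branch 24 (Branch 23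
    (Leaf [13, 24, 6, 16, 23]) (Branch 8 (Branch 29 (Leaf [16, 27, 6, 8, 29]) (Branch 18
    (Branch 31 (Leaf [6, 31, 8, 16, 18]) (Leaf [26, 31, 3, 5, 29])) (Leaf [18, 29, 3, 5, 26])))
    (Leaf [23, 34, 5, 8, 26]))) (Leaf [3, 34, 5, 24, 26])) (Leaf [3, 34, 5, 13, 26]))))))
    (Branch 21 (Branch 13 (Branch 24 (Branch 23 (Leaf [13, 24, 11, 21, 23])
    (Leaf [3, 23, 4, 5, 6])) (Leaf [4, 24, 3, 5, 6])) (Leaf [4, 13, 3, 5, 6]))
    (Leaf [5, 21, 3, 4, 6])))) (Branch 20 (Branch 24 (Branch 29 (Branch 14 (Branch 19 (Branch 21
    (Leaf [0, 20, 2, 19, 21]) (Branch 6 (Leaf [24, 29, 6, 14, 16]) (Leaf [21, 27, 3, 4, 6])))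
    (Leaf [3, 19, 1, 4, 27])) (Leaf [3, 14, 1, 4, 27])) (Leaf [4, 29, 1, 3, 27]))
    (Leaf [4, 24, 1, 3, 27])) (Leaf [4, 20, 1, 3, 27]))) (Branch 20 (Branch 19 (Branch 21
    (Leaf [0, 20, 2, 19, 21]) (Leaf [1, 21, 3, 4, 22])) (Leaf [3, 19, 1, 4, 22]))
    (Leaf [4, 20, 1, 3, 22]))) (Branch 27 (Branch 24 (Branch 29 (Branch 14 (Branch 6
    (Leaf [24, 29, 6, 14, 27]) (Leaf [1, 6, 3, 4, 16])) (Leaf [3, 14, 1, 4, 16]))
    (Leaf [4, 29, 1, 3, 16])) (Leaf [4, 24, 1, 3, 16])) (Leaf [16, 27, 1, 3, 4]))) (Branch 22
    (Branch 24 (Branch 29 (Branch 14 (Branch 21 (Leaf [24, 29, 14, 21, 22])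
    (Leaf [1, 21, 3, 4, 11])) (Leaf [3, 14, 1, 4, 11])) (Leaf [4, 29, 1, 3, 11]))
    (Leaf [4, 24, 1, 3, 11])) (Leaf [11, 22, 1, 3, 4]))"

lemma certifies_cert_9: "certifies (J5_copy G36) [2, 0] [4, 3, 1] cert_9"
  unfolding cert_9_def G36_def by (simp add: adjacent_diff_graph diff_adj_def distances_36_def)

definition cert_10 :: split_tree where
  "cert_10 =
    Branch 5 (Branch 6 (Branch 22 (Leaf [6, 22, 3, 4, 5]) (Branch 16 (Leaf [5, 16, 3, 4, 6])
    (Branch 21 (Leaf [5, 21, 3, 4, 6]) (Branch 13 (Leaf [4, 13, 3, 5, 6]) (Branch 24
    (Leaf [4, 24, 3, 5, 6]) (Branch 29 (Leaf [4, 29, 3, 5, 6]) (Branch 23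
    (Leaf [3, 23, 4, 5, 6]) (Branch 11 (Branch 26 (Branch 19 (Branch 34
    (Leaf [0, 11, 19, 26, 34]) (Leaf [23, 34, 21, 22, 24])) (Leaf [1, 21, 19, 22, 29]))
    (Leaf [13, 24, 16, 23, 26])) (Leaf [13, 24, 11, 21, 23]))))))))) (Branch 22 (Branch 21
    (Leaf [5, 21, 3, 4, 22]) (Branch 24 (Leaf [4, 24, 3, 5, 22]) (Branch 29
    (Leaf [4, 29, 3, 5, 22]) (Branch 7 (Leaf [3, 7, 4, 5, 22]) (Branch 12
    (Leaf [3, 12, 4, 5, 22]) (Branch 23 (Leaf [3, 23, 4, 5, 22]) (Branch 8 (Branch 9 (Branch 13
    (Branch 34 (Branch 16 (Branch 26 (Leaf [9, 34, 8, 16, 26]) (Branch 31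
    (Leaf [5, 16, 8, 31, 34]) (Branch 10 (Branch 11 (Leaf [0, 11, 10, 13, 34])
    (Leaf [21, 26, 11, 23, 24])) (Leaf [2, 29, 10, 12, 31])))) (Leaf [16, 21, 6, 23, 24]))
    (Leaf [23, 34, 6, 21, 24])) (Leaf [13, 24, 6, 21, 23])) (Leaf [7, 21, 6, 9, 24]))
    (Leaf [23, 29, 6, 8, 21])))))))) (Branch 26 (Branch 18 (Leaf [0, 5, 3, 18, 26]) (Branch 24
    (Leaf [0, 5, 3, 24, 26]) (Branch 29 (Leaf [0, 5, 3, 26, 29]) (Branch 14 (Branch 8 (Branch 7
    (Leaf [0, 5, 7, 8, 26]) (Branch 9 (Branch 25 (Branch 27 (Leaf [9, 25, 8, 26, 27]) (Branch 34
    (Leaf [0, 5, 8, 26, 34]) (Leaf [1, 6, 24, 27, 34]))) (Leaf [6, 22, 7, 24, 25]))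
    (Leaf [6, 22, 7, 9, 24]))) (Branch 11 (Branch 21 (Leaf [3, 14, 4, 11, 21])
    (Leaf [18, 29, 6, 8, 21])) (Leaf [18, 29, 1, 8, 11]))) (Leaf [24, 29, 1, 14, 22])))))
    (Branch 35 (Branch 9 (Branch 7 (Branch 17 (Leaf [0, 9, 7, 17, 35]) (Branch 28
    (Leaf [0, 9, 7, 28, 35]) (Branch 33 (Leaf [0, 9, 7, 33, 35]) (Branch 8 (Branch 10
    (Leaf [0, 9, 7, 8, 10]) (Branch 20 (Branch 31 (Leaf [20, 31, 5, 7, 8]) (Branch 18
    (Leaf [7, 18, 5, 8, 20]) (Leaf [28, 33, 10, 18, 31]))) (Leaf [17, 28, 2, 10, 20])))
    (Branch 11 (Branch 29 (Branch 10 (Leaf [0, 11, 3, 10, 29]) (Branch 21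
    (Leaf [4, 29, 3, 11, 21]) (Branch 20 (Branch 31 (Branch 18 (Leaf [20, 31, 3, 5, 18])
    (Branch 16 (Leaf [5, 16, 3, 29, 31]) (Leaf [16, 21, 6, 8, 18]))) (Leaf [10, 21, 2, 28, 31]))
    (Leaf [17, 28, 2, 10, 20])))) (Branch 27 (Branch 12 (Leaf [11, 27, 9, 12, 35]) (Branch 14
    (Branch 21 (Leaf [3, 14, 4, 11, 21]) (Branch 32 (Leaf [3, 14, 4, 11, 32])
    (Leaf [21, 32, 6, 8, 29]))) (Leaf [1, 12, 14, 22, 29]))) (Leaf [1, 6, 8, 27, 29])))
    (Branch 18 (Branch 29 (Branch 10 (Leaf [18, 29, 0, 3, 10]) (Branch 21
    (Leaf [18, 29, 0, 3, 21]) (Branch 20 (Branch 31 (Leaf [20, 31, 3, 5, 18])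
    (Leaf [10, 21, 2, 28, 31])) (Leaf [17, 28, 2, 10, 20])))) (Leaf [1, 26, 8, 11, 29]))
    (Leaf [1, 26, 8, 11, 18]))))))) (Branch 25 (Branch 18 (Branch 17 (Leaf [0, 25, 17, 18, 35])
    (Branch 28 (Leaf [0, 25, 18, 28, 35]) (Branch 10 (Branch 29 (Leaf [18, 29, 0, 3, 10])
    (Branch 21 (Leaf [10, 21, 0, 3, 18]) (Branch 8 (Leaf [3, 8, 0, 10, 18]) (Branch 11
    (Leaf [0, 11, 3, 10, 18]) (Leaf [1, 21, 8, 11, 29]))))) (Branch 20 (Branch 31
    (Leaf [20, 31, 3, 5, 18]) (Branch 8 (Leaf [3, 8, 5, 18, 20]) (Leaf [8, 28, 7, 10, 31])))
    (Leaf [17, 28, 2, 10, 20]))))) (Branch 19 (Branch 8 (Branch 15 (Branch 13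
    (Leaf [0, 5, 3, 13, 15]) (Branch 23 (Leaf [0, 5, 8, 15, 23]) (Branch 34
    (Leaf [0, 5, 8, 15, 34]) (Branch 11 (Branch 21 (Leaf [4, 9, 11, 19, 21]) (Branch 16
    (Branch 31 (Branch 24 (Leaf [5, 16, 3, 24, 31]) (Leaf [23, 34, 21, 22, 24]))
    (Leaf [6, 31, 13, 21, 23])) (Leaf [6, 26, 13, 16, 23]))) (Leaf [23, 34, 11, 13, 26])))))
    (Branch 16 (Branch 17 (Leaf [19, 35, 9, 16, 17]) (Branch 14 (Branch 33
    (Leaf [4, 35, 14, 16, 33]) (Branch 31 (Branch 13 (Leaf [5, 16, 3, 13, 31]) (Branch 23
    (Leaf [5, 16, 8, 23, 31]) (Branch 34 (Leaf [5, 16, 8, 31, 34]) (Branch 11 (Branch 32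
    (Leaf [4, 35, 11, 14, 32]) (Leaf [6, 15, 13, 32, 34])) (Leaf [23, 34, 11, 13, 26])))))
    (Branch 10 (Branch 23 (Leaf [0, 25, 8, 10, 23]) (Branch 27 (Leaf [9, 25, 8, 10, 27])
    (Branch 21 (Branch 13 (Leaf [10, 21, 0, 3, 13]) (Branch 34 (Leaf [10, 21, 0, 8, 34])
    (Branch 24 (Branch 11 (Leaf [4, 24, 3, 11, 21]) (Leaf [23, 34, 11, 13, 26]))
    (Leaf [22, 27, 1, 24, 34])))) (Leaf [2, 33, 21, 23, 31])))) (Leaf [7, 18, 10, 31, 33]))))
    (Leaf [2, 7, 14, 15, 17]))) (Branch 28 (Branch 33 (Branch 23 (Leaf [4, 35, 23, 25, 33])
    (Branch 12 (Leaf [5, 25, 4, 12, 33]) (Branch 30 (Branch 13 (Branch 20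
    (Leaf [5, 30, 13, 20, 28]) (Branch 24 (Branch 21 (Leaf [13, 24, 0, 3, 21])
    (Leaf [2, 22, 20, 21, 23])) (Leaf [6, 26, 16, 23, 24]))) (Leaf [6, 15, 13, 16, 23]))
    (Leaf [2, 22, 12, 15, 30])))) (Leaf [15, 26, 16, 18, 33])) (Leaf [15, 26, 16, 18, 28]))))
    (Branch 11 (Branch 16 (Branch 28 (Leaf [11, 16, 9, 28, 35]) (Branch 21
    (Leaf [4, 9, 11, 19, 21]) (Branch 31 (Branch 29 (Leaf [5, 16, 3, 29, 31])
    (Leaf [18, 29, 6, 8, 21])) (Leaf [8, 28, 18, 21, 31])))) (Leaf [1, 6, 8, 16, 18]))
    (Leaf [1, 26, 8, 11, 18]))) (Branch 11 (Branch 16 (Branch 28 (Leaf [11, 16, 9, 28, 35])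
    (Branch 8 (Branch 32 (Leaf [8, 35, 9, 11, 32]) (Branch 29 (Branch 34 (Branch 21
    (Leaf [29, 34, 0, 8, 21]) (Branch 31 (Leaf [5, 16, 3, 29, 31]) (Leaf [19, 28, 2, 21, 31])))
    (Leaf [1, 32, 19, 22, 34])) (Leaf [1, 32, 19, 22, 29]))) (Branch 21 (Branch 24
    (Leaf [3, 9, 11, 21, 24]) (Branch 14 (Leaf [3, 14, 4, 11, 21]) (Leaf [1, 7, 14, 22, 24])))
    (Leaf [8, 19, 6, 18, 21])))) (Leaf [1, 6, 16, 18, 19])) (Leaf [1, 26, 11, 18, 19]))))
    (Branch 8 (Branch 28 (Branch 10 (Branch 13 (Leaf [3, 28, 0, 10, 13]) (Branch 11
    (Leaf [8, 28, 9, 10, 11]) (Branch 34 (Branch 23 (Leaf [23, 34, 0, 8, 10])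
    (Leaf [6, 26, 13, 23, 25])) (Leaf [1, 26, 11, 13, 34])))) (Branch 23 (Branch 15
    (Leaf [0, 5, 8, 15, 23]) (Leaf [10, 15, 7, 22, 25])) (Leaf [10, 26, 2, 23, 25])))
    (Leaf [2, 7, 25, 26, 28])) (Leaf [6, 26, 7, 8, 25])))) (Branch 19 (Branch 30 (Branch 11
    (Branch 12 (Leaf [19, 30, 4, 11, 12]) (Branch 21 (Leaf [3, 19, 4, 11, 21]) (Branch 32
    (Leaf [3, 19, 4, 11, 32]) (Branch 8 (Branch 10 (Branch 28 (Branch 13
    (Leaf [0, 11, 3, 10, 13]) (Branch 23 (Leaf [23, 28, 4, 11, 30]) (Branch 34
    (Leaf [0, 11, 8, 10, 34]) (Leaf [23, 34, 6, 13, 21])))) (Leaf [21, 26, 2, 9, 28]))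
    (Leaf [2, 22, 9, 10, 12])) (Leaf [21, 32, 6, 8, 9]))))) (Branch 8 (Branch 28 (Branch 7
    (Leaf [5, 30, 4, 7, 28]) (Branch 10 (Branch 13 (Leaf [3, 28, 0, 10, 13]) (Branch 34
    (Branch 23 (Leaf [23, 34, 0, 8, 10]) (Branch 21 (Leaf [10, 21, 0, 8, 34])
    (Leaf [21, 26, 11, 13, 23]))) (Leaf [1, 26, 11, 13, 34]))) (Branch 33 (Branch 20 (Branch 12
    (Leaf [5, 30, 12, 20, 33]) (Leaf [2, 11, 9, 10, 12])) (Leaf [9, 20, 7, 10, 22]))
    (Leaf [22, 33, 7, 9, 10])))) (Leaf [2, 11, 9, 26, 28])) (Leaf [1, 26, 8, 9, 11])))
    (Leaf [2, 22, 1, 9, 30])) (Leaf [2, 22, 1, 9, 19]))) (Branch 9 (Branch 14 (Branch 20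
    (Branch 25 (Branch 18 (Branch 31 (Leaf [20, 31, 3, 5, 18]) (Branch 13
    (Leaf [13, 18, 3, 5, 20]) (Branch 10 (Leaf [0, 20, 3, 10, 18]) (Branch 28
    (Leaf [3, 28, 5, 18, 20]) (Leaf [2, 13, 10, 28, 31]))))) (Branch 16 (Branch 11 (Branch 21
    (Leaf [3, 14, 4, 11, 21]) (Branch 32 (Leaf [3, 14, 4, 11, 32]) (Branch 34 (Branch 8
    (Branch 10 (Leaf [9, 34, 8, 10, 11]) (Branch 15 (Leaf [0, 5, 8, 15, 34]) (Branch 31
    (Leaf [5, 16, 8, 31, 34]) (Branch 28 (Branch 30 (Leaf [4, 9, 11, 28, 30]) (Branch 17
    (Branch 19 (Leaf [4, 9, 16, 17, 19]) (Leaf [6, 31, 18, 19, 21]))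
    (Leaf [2, 18, 15, 17, 30]))) (Leaf [2, 18, 10, 28, 31]))))) (Branch 29 (Branch 19 (Branch 31
    (Leaf [29, 34, 16, 19, 31]) (Leaf [6, 31, 8, 18, 21])) (Leaf [8, 19, 6, 18, 21]))
    (Leaf [18, 29, 6, 8, 21]))) (Leaf [1, 32, 22, 34, 35])))) (Branch 8 (Branch 19 (Branch 30
    (Branch 34 (Branch 31 (Leaf [5, 16, 8, 31, 34]) (Branch 28 (Branch 13
    (Leaf [5, 30, 13, 20, 28]) (Branch 21 (Leaf [8, 19, 0, 21, 34]) (Branch 7
    (Leaf [5, 25, 4, 7, 28]) (Branch 23 (Branch 33 (Leaf [5, 30, 20, 23, 33]) (Branch 10
    (Leaf [23, 34, 0, 8, 10]) (Leaf [7, 18, 10, 31, 33]))) (Leaf [21, 26, 11, 13, 23])))))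
    (Leaf [26, 35, 11, 18, 28]))) (Leaf [18, 34, 1, 11, 35])) (Leaf [30, 35, 1, 11, 18]))
    (Leaf [19, 35, 1, 11, 18])) (Leaf [8, 35, 1, 11, 18]))) (Leaf [1, 6, 16, 18, 35])))
    (Leaf [2, 22, 1, 25, 35])) (Leaf [2, 22, 1, 20, 35])) (Leaf [2, 22, 1, 14, 35]))
    (Leaf [2, 22, 1, 9, 35])))))) (Branch 6 (Branch 16 (Branch 27 (Leaf [16, 27, 3, 4, 6])
    (Branch 24 (Leaf [4, 24, 3, 6, 16]) (Branch 29 (Leaf [4, 29, 3, 6, 16]) (Branch 14
    (Leaf [3, 14, 4, 6, 16]) (Leaf [24, 29, 1, 14, 27]))))) (Branch 21 (Branch 32
    (Leaf [21, 32, 3, 4, 6]) (Branch 11 (Leaf [6, 11, 3, 4, 21]) (Branch 22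
    (Leaf [6, 22, 3, 4, 21]) (Branch 24 (Leaf [4, 24, 3, 6, 21]) (Branch 29
    (Leaf [4, 29, 3, 6, 21]) (Branch 23 (Leaf [3, 23, 4, 6, 21]) (Branch 34 (Branch 8
    (Leaf [0, 6, 8, 21, 34]) (Leaf [1, 32, 8, 11, 29])) (Leaf [23, 34, 5, 22, 24]))))))))
    (Branch 20 (Branch 27 (Branch 24 (Leaf [4, 24, 3, 6, 27]) (Branch 29
    (Leaf [4, 29, 3, 6, 27]) (Branch 14 (Leaf [3, 14, 4, 6, 27]) (Leaf [24, 29, 1, 14, 16]))))
    (Branch 32 (Branch 11 (Leaf [6, 11, 3, 4, 32]) (Branch 13 (Leaf [4, 13, 3, 6, 32])
    (Branch 14 (Leaf [3, 14, 4, 6, 32]) (Leaf [1, 21, 11, 13, 14])))) (Branch 9 (Branch 14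
    (Branch 7 (Branch 25 (Leaf [14, 25, 4, 6, 7]) (Branch 17 (Leaf [6, 17, 4, 7, 14]) (Branch 24
    (Leaf [4, 24, 6, 7, 14]) (Leaf [27, 32, 17, 24, 25])))) (Branch 28 (Branch 8 (Branch 23
    (Branch 25 (Leaf [4, 8, 6, 23, 25]) (Branch 10 (Leaf [0, 20, 8, 10, 23]) (Branch 12
    (Branch 17 (Branch 35 (Branch 22 (Leaf [4, 35, 12, 14, 22]) (Branch 33
    (Leaf [4, 35, 12, 14, 33]) (Branch 15 (Branch 18 (Leaf [0, 20, 17, 18, 35]) (Branch 26
    (Leaf [15, 26, 0, 8, 23]) (Leaf [10, 26, 18, 25, 33]))) (Leaf [7, 32, 15, 22, 25]))))
    (Leaf [2, 27, 1, 25, 35])) (Leaf [2, 7, 10, 17, 25])) (Leaf [2, 27, 10, 12, 25]))))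
    (Branch 31 (Branch 12 (Branch 33 (Leaf [4, 31, 12, 14, 33]) (Branch 15 (Branch 26 (Branch 13
    (Leaf [15, 26, 0, 3, 13]) (Branch 34 (Leaf [15, 26, 0, 8, 34]) (Branch 11 (Branch 24
    (Leaf [0, 11, 3, 24, 26]) (Leaf [13, 24, 1, 16, 34])) (Leaf [11, 16, 1, 13, 34]))))
    (Leaf [5, 16, 23, 26, 33])) (Leaf [5, 16, 15, 23, 33]))) (Branch 15 (Branch 13
    (Leaf [3, 28, 0, 13, 15]) (Branch 26 (Branch 11 (Leaf [8, 28, 9, 11, 26]) (Branch 10
    (Branch 34 (Leaf [10, 15, 0, 8, 34]) (Leaf [23, 34, 11, 13, 21]))
    (Leaf [12, 23, 10, 11, 13]))) (Leaf [2, 13, 5, 23, 26]))) (Leaf [12, 23, 2, 5, 15])))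
    (Leaf [5, 21, 2, 23, 31]))) (Branch 29 (Branch 10 (Leaf [3, 28, 0, 10, 29]) (Branch 26
    (Leaf [3, 28, 0, 26, 29]) (Branch 24 (Branch 23 (Branch 25 (Leaf [4, 24, 6, 23, 25])
    (Leaf [10, 26, 7, 8, 25])) (Leaf [7, 23, 5, 8, 26])) (Leaf [8, 24, 5, 7, 26]))))
    (Leaf [16, 27, 1, 8, 29]))) (Branch 15 (Branch 26 (Branch 13 (Leaf [15, 26, 0, 3, 13])
    (Branch 18 (Leaf [15, 26, 0, 3, 18]) (Branch 11 (Branch 24 (Leaf [3, 9, 11, 24, 26])
    (Branch 29 (Leaf [3, 14, 11, 26, 29]) (Branch 8 (Branch 34 (Leaf [9, 34, 8, 11, 26])
    (Leaf [13, 24, 1, 16, 34])) (Leaf [18, 29, 1, 8, 16])))) (Leaf [13, 18, 11, 21, 28]))))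
    (Leaf [2, 7, 5, 26, 28])) (Leaf [2, 7, 5, 15, 28])))) (Branch 24 (Branch 29 (Branch 35
    (Branch 7 (Leaf [24, 35, 6, 7, 9]) (Branch 26 (Leaf [24, 29, 0, 3, 26]) (Branch 28
    (Branch 33 (Branch 12 (Leaf [0, 9, 12, 33, 35]) (Branch 13 (Branch 23
    (Leaf [0, 20, 23, 33, 35]) (Branch 15 (Leaf [3, 28, 0, 13, 15]) (Leaf [12, 23, 2, 5, 15])))
    (Leaf [1, 26, 13, 14, 16]))) (Leaf [5, 14, 7, 26, 33])) (Leaf [2, 7, 5, 26, 28]))))
    (Leaf [2, 16, 1, 14, 35])) (Leaf [16, 27, 1, 14, 29])) (Leaf [16, 27, 1, 14, 24])))
    (Branch 8 (Branch 19 (Branch 24 (Branch 30 (Branch 35 (Branch 7 (Leaf [19, 30, 4, 6, 7])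
    (Branch 10 (Branch 13 (Leaf [0, 20, 3, 10, 13]) (Branch 23 (Leaf [0, 20, 8, 10, 23])
    (Branch 15 (Branch 26 (Branch 34 (Leaf [10, 15, 0, 8, 34]) (Branch 11
    (Leaf [0, 11, 3, 24, 26]) (Leaf [11, 16, 1, 13, 34]))) (Leaf [5, 16, 13, 23, 26]))
    (Leaf [5, 16, 13, 15, 23])))) (Branch 28 (Branch 12 (Branch 17 (Branch 33
    (Leaf [30, 35, 12, 20, 33]) (Branch 13 (Leaf [12, 28, 13, 20, 30]) (Branch 18
    (Leaf [0, 20, 17, 18, 19]) (Branch 26 (Branch 34 (Leaf [19, 24, 0, 17, 34]) (Branch 11
    (Leaf [0, 11, 3, 24, 26]) (Leaf [11, 16, 1, 13, 34]))) (Leaf [5, 16, 18, 26, 33])))))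
    (Leaf [2, 7, 9, 10, 17])) (Leaf [2, 27, 9, 10, 12])) (Leaf [10, 21, 2, 9, 28]))))
    (Leaf [2, 16, 1, 9, 35])) (Leaf [2, 27, 1, 9, 30])) (Leaf [16, 27, 1, 9, 24]))
    (Leaf [2, 16, 1, 9, 19])) (Leaf [16, 27, 1, 8, 9]))))) (Branch 19 (Branch 23 (Branch 27
    (Leaf [3, 19, 4, 6, 27]) (Branch 30 (Branch 7 (Leaf [19, 30, 4, 6, 7]) (Branch 22
    (Leaf [6, 22, 4, 23, 30]) (Branch 33 (Leaf [6, 33, 4, 23, 30]) (Leaf [22, 33, 5, 7, 20]))))
    (Leaf [2, 27, 1, 20, 30]))) (Leaf [5, 21, 2, 20, 23])) (Leaf [1, 21, 2, 19, 20])))))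
    (Branch 7 (Branch 17 (Branch 19 (Leaf [0, 4, 7, 17, 19]) (Branch 18 (Branch 15
    (Leaf [7, 18, 0, 15, 17]) (Branch 35 (Leaf [7, 18, 0, 17, 35]) (Branch 9 (Branch 20
    (Branch 24 (Leaf [0, 9, 7, 17, 24]) (Branch 30 (Leaf [4, 9, 7, 17, 30]) (Branch 28
    (Branch 25 (Leaf [17, 28, 4, 7, 25]) (Branch 32 (Branch 22 (Leaf [4, 20, 3, 22, 32])
    (Leaf [24, 35, 1, 22, 25])) (Leaf [24, 35, 6, 25, 32]))) (Leaf [5, 30, 2, 15, 28]))))
    (Leaf [19, 35, 1, 2, 20])) (Leaf [19, 35, 1, 2, 9])))) (Branch 20 (Branch 35
    (Leaf [0, 20, 7, 17, 35]) (Branch 25 (Branch 14 (Leaf [14, 25, 4, 7, 17]) (Branch 27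
    (Leaf [7, 27, 4, 17, 25]) (Branch 32 (Leaf [7, 32, 4, 17, 25]) (Leaf [27, 32, 6, 14, 35]))))
    (Leaf [1, 6, 18, 25, 35]))) (Leaf [2, 18, 1, 19, 20])))) (Branch 15 (Branch 25 (Branch 8
    (Leaf [0, 25, 7, 8, 15]) (Branch 28 (Leaf [0, 25, 7, 15, 28]) (Branch 13 (Branch 26
    (Leaf [15, 26, 0, 3, 13]) (Branch 23 (Leaf [3, 23, 0, 13, 15]) (Leaf [23, 28, 2, 5, 26])))
    (Branch 34 (Branch 26 (Branch 31 (Branch 18 (Leaf [15, 26, 0, 3, 18]) (Branch 19
    (Leaf [7, 34, 0, 19, 26]) (Branch 16 (Branch 29 (Leaf [26, 31, 3, 16, 29])
    (Leaf [18, 29, 5, 6, 8])) (Leaf [8, 19, 1, 16, 18])))) (Leaf [2, 13, 5, 28, 31]))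
    (Leaf [2, 13, 5, 26, 28])) (Leaf [8, 13, 5, 6, 34]))))) (Branch 35 (Branch 28
    (Leaf [15, 35, 0, 7, 28]) (Branch 20 (Branch 10 (Branch 18 (Leaf [0, 20, 3, 10, 18])
    (Branch 8 (Leaf [0, 20, 7, 8, 10]) (Leaf [5, 25, 6, 8, 18]))) (Leaf [17, 28, 2, 10, 25]))
    (Leaf [17, 28, 2, 5, 20]))) (Leaf [1, 17, 2, 25, 35]))) (Branch 28 (Branch 25 (Branch 30
    (Leaf [25, 30, 4, 7, 28]) (Leaf [5, 30, 2, 15, 17])) (Leaf [5, 25, 2, 15, 17]))
    (Leaf [17, 28, 2, 5, 15])))) (Branch 8 (Branch 24 (Branch 26 (Branch 13
    (Leaf [13, 24, 0, 3, 26]) (Branch 23 (Leaf [8, 24, 0, 23, 26]) (Branch 34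
    (Leaf [3, 34, 0, 24, 26]) (Leaf [23, 34, 5, 6, 13])))) (Branch 28 (Branch 13 (Branch 15
    (Leaf [3, 28, 0, 13, 15]) (Branch 23 (Branch 33 (Branch 12 (Branch 35
    (Leaf [12, 23, 0, 33, 35]) (Branch 25 (Leaf [12, 23, 4, 25, 33]) (Branch 30
    (Leaf [12, 23, 4, 30, 33]) (Branch 9 (Branch 27 (Branch 22 (Leaf [22, 27, 9, 12, 24])
    (Leaf [5, 25, 7, 15, 22])) (Leaf [7, 27, 6, 25, 35])) (Leaf [30, 35, 6, 7, 9])))))
    (Branch 25 (Branch 30 (Leaf [25, 30, 4, 23, 33]) (Leaf [5, 30, 2, 12, 15]))
    (Leaf [5, 25, 2, 12, 15]))) (Leaf [15, 26, 5, 7, 33])) (Leaf [15, 26, 2, 5, 23])))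
    (Branch 23 (Branch 34 (Branch 15 (Leaf [23, 34, 0, 8, 15]) (Branch 33 (Branch 12 (Branch 17
    (Branch 16 (Leaf [0, 16, 17, 24, 34]) (Branch 27 (Leaf [0, 27, 17, 24, 34]) (Branch 35
    (Leaf [24, 35, 0, 17, 34]) (Branch 14 (Branch 25 (Leaf [14, 25, 4, 12, 33])
    (Leaf [2, 27, 1, 25, 35])) (Leaf [13, 35, 1, 14, 16]))))) (Leaf [2, 7, 5, 15, 17]))
    (Leaf [2, 13, 5, 12, 15])) (Leaf [15, 26, 5, 7, 33]))) (Leaf [6, 26, 5, 13, 34]))
    (Leaf [6, 26, 5, 13, 23]))) (Leaf [2, 7, 5, 26, 28]))) (Branch 23 (Branch 26 (Branch 25
    (Leaf [0, 25, 8, 23, 26]) (Leaf [5, 25, 6, 7, 24])) (Leaf [6, 26, 5, 7, 24]))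
    (Leaf [7, 23, 5, 6, 24]))) (Branch 24 (Branch 23 (Branch 26 (Branch 25
    (Leaf [0, 25, 23, 24, 26]) (Leaf [5, 25, 6, 7, 8])) (Leaf [6, 26, 5, 7, 8]))
    (Leaf [7, 23, 5, 6, 8])) (Leaf [8, 24, 5, 6, 7])))))"

lemma certifies_cert_10: "certifies (J5_copy G36) [4, 3, 0] [2, 1] cert_10"
  unfolding cert_10_def G36_def by (simp add: adjacent_diff_graph diff_adj_def distances_36_def)

definition cert_11 :: split_tree where
  "cert_11 =
    Branch 14 (Branch 19 (Branch 25 (Branch 30 (Branch 18 (Branch 21 (Leaf [3, 19, 0, 18, 21])
    (Branch 28 (Branch 10 (Leaf [3, 28, 0, 10, 18]) (Branch 15 (Leaf [3, 28, 0, 15, 18])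
    (Branch 35 (Leaf [0, 25, 18, 28, 35]) (Branch 5 (Branch 20 (Leaf [3, 28, 5, 18, 20])
    (Branch 31 (Leaf [3, 28, 5, 18, 31]) (Branch 9 (Branch 22 (Branch 27 (Branch 12
    (Leaf [22, 27, 9, 12, 19]) (Leaf [20, 31, 2, 10, 12])) (Leaf [2, 27, 1, 20, 35]))
    (Leaf [2, 22, 1, 20, 35])) (Leaf [9, 20, 1, 2, 35])))) (Branch 23 (Branch 17 (Branch 16
    (Leaf [0, 16, 17, 18, 19]) (Branch 29 (Leaf [18, 29, 0, 17, 19]) (Branch 34
    (Leaf [18, 34, 0, 17, 19]) (Branch 8 (Branch 13 (Branch 24 (Branch 11 (Branch 32
    (Leaf [13, 24, 3, 11, 32]) (Branch 6 (Leaf [18, 23, 6, 8, 25]) (Leaf [16, 32, 6, 34, 35])))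
    (Leaf [11, 16, 1, 34, 35])) (Leaf [24, 35, 1, 16, 34])) (Leaf [13, 35, 1, 16, 34]))
    (Leaf [29, 34, 1, 8, 16]))))) (Leaf [4, 15, 2, 5, 17])) (Leaf [5, 21, 2, 4, 23]))))))
    (Branch 5 (Branch 20 (Branch 31 (Leaf [20, 31, 3, 5, 18]) (Leaf [4, 31, 2, 21, 28]))
    (Leaf [4, 20, 2, 21, 28])) (Leaf [5, 21, 2, 4, 28])))) (Branch 29 (Branch 21
    (Leaf [3, 19, 0, 21, 29]) (Branch 26 (Leaf [3, 19, 0, 26, 29]) (Branch 31 (Branch 12
    (Leaf [0, 31, 12, 19, 29]) (Branch 16 (Leaf [3, 14, 16, 29, 31]) (Branch 8 (Branch 5
    (Leaf [3, 8, 5, 29, 31]) (Branch 23 (Branch 15 (Leaf [0, 25, 8, 15, 23])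
    (Leaf [4, 15, 2, 5, 12])) (Leaf [12, 23, 2, 4, 5]))) (Leaf [1, 26, 8, 16, 18])))) (Branch 23
    (Branch 28 (Branch 10 (Leaf [3, 28, 0, 10, 29]) (Branch 8 (Branch 33 (Branch 35
    (Leaf [0, 25, 23, 33, 35]) (Branch 20 (Branch 5 (Leaf [8, 33, 5, 20, 23]) (Branch 13
    (Leaf [23, 28, 13, 20, 30]) (Branch 34 (Branch 12 (Leaf [12, 23, 20, 30, 33]) (Branch 17
    (Leaf [29, 34, 0, 17, 19]) (Leaf [12, 17, 2, 4, 5]))) (Leaf [5, 10, 13, 31, 34]))))
    (Leaf [2, 18, 1, 20, 35]))) (Leaf [10, 21, 18, 31, 33])) (Leaf [10, 21, 8, 18, 31])))
    (Leaf [4, 31, 2, 21, 28])) (Leaf [4, 31, 2, 21, 23]))))) (Branch 8 (Branch 7 (Branch 26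
    (Leaf [8, 19, 0, 7, 26]) (Branch 10 (Leaf [0, 25, 7, 8, 10]) (Branch 15
    (Leaf [0, 25, 7, 8, 15]) (Branch 9 (Branch 17 (Leaf [19, 30, 7, 9, 17]) (Branch 20 (Branch 5
    (Branch 31 (Leaf [20, 31, 5, 7, 8]) (Branch 28 (Leaf [8, 28, 5, 7, 20]) (Branch 33
    (Leaf [8, 33, 5, 7, 20]) (Leaf [28, 33, 10, 18, 31])))) (Leaf [4, 15, 2, 5, 17]))
    (Leaf [2, 18, 10, 17, 20]))) (Branch 28 (Branch 35 (Leaf [0, 25, 7, 28, 35]) (Branch 20
    (Branch 17 (Leaf [0, 20, 7, 17, 19]) (Leaf [10, 35, 2, 9, 17])) (Leaf [9, 20, 1, 2, 35])))
    (Leaf [10, 26, 2, 9, 28])))))) (Branch 23 (Branch 10 (Leaf [0, 25, 8, 10, 23]) (Branch 15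
    (Leaf [0, 25, 8, 15, 23]) (Branch 33 (Branch 35 (Leaf [0, 25, 23, 33, 35]) (Branch 20
    (Branch 5 (Leaf [8, 33, 5, 20, 23]) (Branch 12 (Leaf [12, 23, 20, 30, 33])
    (Leaf [4, 15, 2, 5, 12]))) (Leaf [2, 18, 1, 20, 35]))) (Branch 5 (Branch 20 (Branch 31
    (Leaf [20, 31, 5, 8, 23]) (Leaf [7, 18, 10, 31, 33])) (Leaf [7, 18, 10, 20, 33]))
    (Leaf [4, 15, 5, 7, 33]))))) (Branch 21 (Branch 34 (Leaf [8, 19, 0, 21, 34]) (Branch 6
    (Branch 24 (Leaf [0, 6, 3, 21, 24]) (Branch 9 (Leaf [8, 19, 6, 9, 21]) (Branch 22 (Branch 20
    (Leaf [3, 19, 20, 21, 22]) (Branch 35 (Branch 16 (Branch 27 (Leaf [16, 27, 6, 14, 35])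
    (Leaf [9, 34, 1, 24, 27])) (Leaf [9, 34, 1, 16, 24])) (Leaf [9, 20, 1, 2, 35])))
    (Leaf [1, 7, 9, 22, 24])))) (Branch 5 (Branch 24 (Branch 13 (Leaf [13, 24, 0, 3, 21])
    (Branch 26 (Leaf [21, 26, 0, 3, 24]) (Branch 11 (Leaf [0, 11, 3, 21, 24])
    (Leaf [23, 34, 11, 13, 26])))) (Branch 16 (Branch 27 (Branch 9 (Branch 26
    (Leaf [16, 27, 8, 9, 26]) (Branch 11 (Leaf [8, 19, 9, 11, 21]) (Leaf [23, 34, 11, 24, 26])))
    (Branch 11 (Branch 22 (Branch 13 (Leaf [0, 11, 3, 13, 21]) (Branch 20
    (Leaf [5, 21, 3, 20, 22]) (Branch 26 (Branch 10 (Leaf [10, 26, 8, 25, 27])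
    (Leaf [2, 13, 10, 20, 23])) (Leaf [6, 26, 7, 9, 24])))) (Leaf [9, 34, 1, 22, 24]))
    (Leaf [9, 34, 1, 11, 24]))) (Leaf [1, 6, 24, 27, 34])) (Leaf [4, 24, 6, 16, 23])))
    (Leaf [7, 23, 4, 5, 6])))) (Branch 5 (Branch 20 (Branch 31 (Branch 13
    (Leaf [20, 31, 3, 5, 13]) (Branch 6 (Branch 22 (Branch 33 (Branch 34
    (Leaf [6, 31, 5, 8, 34]) (Branch 32 (Leaf [3, 19, 20, 22, 32]) (Branch 15
    (Leaf [15, 20, 3, 5, 22]) (Branch 24 (Leaf [20, 24, 3, 5, 22]) (Branch 16 (Branch 26
    (Leaf [26, 31, 14, 16, 33]) (Branch 17 (Branch 27 (Leaf [19, 30, 17, 20, 27])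
    (Leaf [1, 26, 24, 27, 34])) (Leaf [13, 17, 15, 32, 34]))) (Leaf [23, 34, 13, 15, 16]))))))
    (Leaf [2, 33, 4, 21, 23])) (Leaf [2, 22, 4, 21, 23])) (Leaf [2, 6, 4, 21, 23])))
    (Leaf [4, 31, 2, 21, 23])) (Leaf [4, 20, 2, 21, 23])) (Leaf [5, 21, 2, 4, 23])))))
    (Branch 11 (Branch 16 (Branch 21 (Branch 24 (Leaf [0, 11, 3, 21, 24]) (Branch 34
    (Leaf [0, 11, 19, 21, 34]) (Branch 27 (Branch 6 (Branch 9 (Leaf [16, 21, 6, 9, 19])
    (Branch 35 (Leaf [16, 27, 6, 14, 35]) (Branch 20 (Branch 22 (Branch 12 (Branch 5
    (Leaf [5, 21, 3, 20, 22]) (Branch 15 (Leaf [22, 27, 12, 14, 15]) (Leaf [18, 34, 5, 8, 15])))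
    (Leaf [1, 12, 2, 9, 35])) (Leaf [24, 35, 1, 9, 22])) (Leaf [9, 20, 1, 2, 35])))) (Branch 5
    (Branch 32 (Branch 9 (Leaf [21, 32, 9, 11, 19]) (Branch 22 (Branch 20
    (Leaf [5, 21, 3, 20, 22]) (Branch 7 (Branch 35 (Leaf [14, 25, 7, 22, 35]) (Branch 10
    (Branch 17 (Leaf [7, 27, 10, 17, 25]) (Leaf [2, 18, 17, 20, 35]))
    (Leaf [1, 10, 8, 18, 20]))) (Leaf [8, 24, 6, 7, 9]))) (Leaf [9, 34, 1, 22, 24])))
    (Leaf [29, 34, 6, 8, 32])) (Leaf [18, 29, 5, 6, 8]))) (Leaf [29, 34, 1, 8, 27])))) (Branch 6
    (Branch 13 (Leaf [3, 14, 6, 13, 16]) (Branch 24 (Leaf [3, 14, 6, 16, 24]) (Branch 20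
    (Branch 31 (Branch 34 (Leaf [6, 31, 16, 19, 34]) (Branch 22 (Branch 27 (Branch 10
    (Leaf [22, 27, 3, 10, 20]) (Branch 9 (Leaf [16, 27, 6, 9, 19]) (Branch 7
    (Leaf [19, 30, 7, 20, 22]) (Branch 17 (Branch 15 (Leaf [16, 27, 14, 15, 17]) (Branch 32
    (Leaf [27, 32, 17, 19, 20]) (Leaf [8, 13, 15, 32, 34]))) (Leaf [2, 7, 9, 10, 17])))))
    (Leaf [29, 34, 1, 8, 27])) (Leaf [1, 21, 22, 24, 34]))) (Leaf [18, 29, 8, 21, 31]))
    (Leaf [1, 21, 8, 18, 20])))) (Leaf [18, 29, 6, 8, 21]))) (Leaf [18, 29, 1, 8, 16]))
    (Leaf [18, 29, 1, 8, 11]))))) (Branch 9 (Branch 11 (Branch 22 (Branch 12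
    (Leaf [11, 22, 9, 12, 19]) (Leaf [1, 12, 2, 4, 30])) (Leaf [2, 22, 1, 4, 30]))
    (Leaf [2, 11, 1, 4, 30])) (Leaf [4, 9, 1, 2, 30]))) (Branch 35 (Branch 22 (Branch 27
    (Branch 12 (Leaf [22, 27, 12, 14, 35]) (Leaf [1, 12, 2, 4, 25])) (Leaf [2, 27, 1, 4, 25]))
    (Leaf [2, 22, 1, 4, 25])) (Leaf [4, 35, 1, 2, 25]))) (Branch 30 (Branch 9 (Branch 11
    (Branch 22 (Branch 12 (Leaf [11, 22, 9, 12, 30]) (Leaf [1, 12, 2, 4, 19]))
    (Leaf [2, 22, 1, 4, 19])) (Leaf [2, 11, 1, 4, 19])) (Leaf [4, 9, 1, 2, 19]))
    (Leaf [19, 30, 1, 2, 4]))) (Branch 25 (Branch 35 (Branch 22 (Branch 27 (Branch 12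
    (Leaf [22, 27, 12, 25, 35]) (Leaf [1, 12, 2, 4, 14])) (Leaf [2, 27, 1, 4, 14]))
    (Leaf [2, 22, 1, 4, 14])) (Leaf [4, 35, 1, 2, 14])) (Leaf [14, 25, 1, 2, 4]))"

lemma certifies_cert_11: "certifies (J5_copy G36) [3, 0] [4, 2, 1] cert_11"
  unfolding cert_11_def G36_def by (simp add: adjacent_diff_graph diff_adj_def distances_36_def)

definition cert_12 :: split_tree where
  "cert_12 =
    Branch 4 (Branch 20 (Branch 5 (Branch 7 (Branch 22 (Leaf [4, 20, 5, 7, 22]) (Branch 28
    (Leaf [4, 20, 5, 7, 28]) (Branch 33 (Leaf [4, 20, 5, 7, 33]) (Branch 24 (Branch 6
    (Leaf [4, 24, 5, 6, 7]) (Branch 26 (Leaf [0, 5, 7, 24, 26]) (Branch 31 (Branch 8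
    (Leaf [20, 31, 5, 7, 8]) (Branch 12 (Leaf [7, 12, 5, 24, 31]) (Branch 23
    (Leaf [7, 23, 5, 24, 31]) (Branch 34 (Leaf [7, 34, 5, 24, 31]) (Branch 21 (Branch 14
    (Leaf [5, 14, 7, 24, 31]) (Branch 11 (Branch 29 (Branch 19 (Leaf [0, 11, 19, 21, 29])
    (Branch 32 (Branch 30 (Leaf [11, 31, 29, 30, 32]) (Branch 9 (Leaf [21, 32, 9, 11, 24])
    (Leaf [19, 30, 1, 2, 9]))) (Leaf [1, 32, 19, 22, 34]))) (Leaf [1, 12, 14, 22, 29]))
    (Leaf [23, 34, 8, 11, 26]))) (Leaf [23, 34, 6, 8, 21])))))) (Branch 10 (Branch 21 (Branch 8
    (Leaf [0, 20, 7, 8, 10]) (Branch 11 (Branch 14 (Leaf [4, 24, 11, 14, 21]) (Branch 23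
    (Leaf [4, 24, 11, 21, 23]) (Branch 12 (Branch 34 (Leaf [0, 11, 21, 24, 34]) (Branch 30
    (Branch 32 (Leaf [12, 32, 4, 11, 30]) (Leaf [14, 34, 31, 32, 33]))
    (Leaf [2, 33, 23, 30, 31]))) (Leaf [2, 33, 12, 14, 31])))) (Branch 13 (Branch 34
    (Leaf [10, 21, 0, 13, 34]) (Leaf [1, 26, 8, 11, 34])) (Leaf [1, 26, 3, 11, 13]))))
    (Leaf [3, 28, 2, 21, 31])) (Leaf [3, 28, 2, 10, 31]))))) (Branch 11 (Branch 14 (Branch 21
    (Branch 32 (Leaf [21, 32, 4, 11, 14]) (Leaf [1, 32, 3, 22, 24])) (Leaf [1, 21, 3, 22, 24]))
    (Leaf [3, 14, 1, 22, 24])) (Leaf [11, 22, 1, 3, 24])))))) (Branch 12 (Branch 22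
    (Leaf [4, 20, 5, 12, 22]) (Branch 33 (Leaf [4, 20, 5, 12, 33]) (Branch 30 (Branch 13
    (Leaf [5, 30, 12, 13, 20]) (Branch 27 (Leaf [4, 20, 12, 27, 30]) (Branch 24 (Branch 29
    (Branch 11 (Leaf [4, 29, 11, 12, 30]) (Branch 16 (Branch 14 (Branch 26
    (Leaf [24, 29, 14, 16, 26]) (Leaf [1, 26, 3, 11, 13])) (Leaf [3, 14, 1, 11, 13]))
    (Leaf [11, 16, 1, 3, 13]))) (Leaf [22, 27, 1, 3, 29])) (Leaf [22, 27, 1, 3, 24]))))
    (Branch 9 (Branch 29 (Branch 15 (Branch 13 (Leaf [0, 5, 12, 13, 15]) (Branch 11 (Branch 10
    (Leaf [9, 29, 10, 11, 12]) (Branch 14 (Leaf [4, 29, 11, 12, 14]) (Branch 24 (Branch 31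
    (Leaf [24, 29, 5, 12, 31]) (Leaf [2, 13, 3, 10, 31])) (Leaf [1, 7, 14, 22, 24]))))
    (Leaf [3, 30, 1, 11, 13]))) (Leaf [22, 33, 7, 15, 30])) (Leaf [3, 30, 1, 22, 29]))
    (Leaf [2, 22, 1, 9, 30]))))) (Branch 9 (Branch 23 (Branch 22 (Leaf [4, 20, 5, 22, 23])
    (Branch 10 (Branch 13 (Leaf [0, 20, 10, 13, 23]) (Branch 24 (Branch 6
    (Leaf [4, 24, 5, 6, 23]) (Branch 26 (Leaf [0, 5, 23, 24, 26]) (Branch 11 (Branch 16
    (Branch 21 (Leaf [4, 24, 11, 21, 23]) (Branch 31 (Leaf [5, 16, 23, 24, 31])
    (Leaf [6, 31, 3, 13, 21]))) (Leaf [1, 6, 3, 13, 16])) (Leaf [1, 26, 3, 11, 13]))))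
    (Branch 11 (Branch 14 (Branch 21 (Branch 32 (Leaf [21, 32, 4, 11, 14])
    (Leaf [1, 32, 3, 22, 24])) (Leaf [1, 21, 3, 22, 24])) (Leaf [3, 14, 1, 22, 24]))
    (Leaf [13, 24, 1, 3, 11])))) (Branch 31 (Branch 8 (Leaf [20, 31, 5, 8, 23]) (Branch 13
    (Leaf [20, 31, 5, 13, 23]) (Branch 25 (Branch 11 (Branch 6 (Leaf [5, 25, 4, 6, 23])
    (Branch 16 (Branch 24 (Leaf [5, 16, 23, 24, 31]) (Branch 14 (Branch 21 (Branch 32
    (Leaf [21, 32, 4, 11, 14]) (Leaf [13, 24, 3, 6, 32])) (Leaf [13, 24, 3, 6, 21]))
    (Leaf [3, 14, 1, 22, 24]))) (Leaf [1, 6, 3, 13, 16]))) (Leaf [3, 12, 10, 11, 13]))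
    (Leaf [8, 22, 7, 10, 25])))) (Leaf [3, 12, 2, 10, 31])))) (Branch 25 (Branch 31 (Branch 28
    (Branch 13 (Leaf [20, 31, 5, 13, 28]) (Branch 18 (Leaf [20, 31, 5, 18, 28]) (Branch 11
    (Branch 16 (Branch 30 (Leaf [4, 9, 11, 28, 30]) (Branch 15 (Branch 27
    (Leaf [4, 15, 25, 27, 28]) (Branch 29 (Leaf [5, 16, 28, 29, 31])
    (Leaf [1, 12, 27, 29, 30]))) (Leaf [2, 13, 12, 15, 30]))) (Leaf [13, 18, 1, 3, 16]))
    (Leaf [13, 18, 1, 3, 11])))) (Branch 18 (Branch 8 (Leaf [20, 31, 5, 8, 18]) (Branch 33
    (Leaf [20, 31, 5, 18, 33]) (Branch 16 (Branch 6 (Branch 19 (Leaf [4, 9, 6, 16, 19])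
    (Branch 35 (Leaf [9, 18, 6, 16, 35]) (Branch 14 (Branch 29 (Leaf [6, 31, 14, 16, 29])
    (Branch 27 (Leaf [16, 27, 4, 6, 14]) (Leaf [1, 12, 19, 27, 29])))
    (Leaf [2, 33, 12, 14, 35])))) (Branch 34 (Branch 13 (Leaf [5, 16, 13, 31, 34]) (Branch 24
    (Leaf [5, 16, 24, 31, 34]) (Branch 11 (Branch 21 (Branch 32 (Branch 27 (Branch 14
    (Leaf [21, 32, 4, 11, 14]) (Branch 17 (Leaf [27, 32, 4, 17, 25]) (Leaf [6, 17, 7, 14, 24])))
    (Leaf [1, 6, 3, 24, 27])) (Leaf [13, 24, 3, 6, 32])) (Leaf [13, 24, 3, 6, 21]))
    (Leaf [13, 24, 1, 3, 11])))) (Branch 21 (Branch 19 (Leaf [0, 20, 18, 19, 21]) (Branch 11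
    (Branch 32 (Branch 24 (Leaf [21, 32, 9, 11, 24]) (Branch 30 (Leaf [4, 9, 11, 30, 32])
    (Branch 15 (Branch 22 (Leaf [4, 15, 22, 25, 32]) (Leaf [3, 34, 1, 22, 24]))
    (Leaf [2, 33, 12, 15, 30])))) (Leaf [8, 19, 6, 32, 34])) (Leaf [8, 19, 1, 11, 34])))
    (Leaf [23, 34, 6, 8, 21])))) (Branch 29 (Branch 15 (Branch 26 (Branch 19
    (Leaf [18, 29, 0, 19, 26]) (Branch 34 (Branch 13 (Leaf [15, 26, 5, 13, 34]) (Branch 24
    (Leaf [26, 31, 5, 24, 34]) (Leaf [13, 24, 1, 3, 16]))) (Leaf [8, 19, 1, 16, 34])))
    (Leaf [8, 33, 16, 23, 26])) (Leaf [8, 33, 15, 16, 23])) (Leaf [3, 8, 1, 16, 29])))))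
    (Branch 11 (Branch 16 (Branch 8 (Branch 26 (Leaf [11, 16, 8, 9, 26]) (Branch 29
    (Leaf [5, 16, 8, 29, 31]) (Branch 34 (Leaf [5, 16, 8, 31, 34]) (Branch 27 (Branch 6
    (Leaf [16, 27, 6, 8, 9]) (Branch 10 (Leaf [11, 27, 8, 9, 10]) (Branch 22 (Branch 21
    (Branch 19 (Leaf [11, 22, 4, 19, 21]) (Branch 32 (Leaf [21, 32, 8, 9, 11])
    (Leaf [29, 34, 6, 19, 32]))) (Leaf [18, 29, 3, 6, 21])) (Leaf [3, 12, 10, 22, 29]))))
    (Leaf [3, 28, 26, 27, 29]))))) (Branch 19 (Branch 6 (Leaf [4, 9, 6, 16, 19]) (Branch 21
    (Leaf [4, 9, 11, 19, 21]) (Leaf [3, 8, 6, 18, 21]))) (Branch 24 (Branch 26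
    (Leaf [11, 16, 9, 24, 26]) (Branch 34 (Leaf [5, 16, 24, 31, 34]) (Branch 27 (Branch 6
    (Leaf [16, 27, 6, 9, 24]) (Branch 21 (Branch 32 (Leaf [21, 32, 9, 11, 24])
    (Leaf [8, 19, 6, 32, 34])) (Leaf [3, 8, 6, 18, 21]))) (Leaf [8, 19, 26, 27, 34]))))
    (Branch 14 (Branch 6 (Branch 27 (Leaf [16, 27, 4, 6, 14]) (Branch 32
    (Leaf [16, 32, 4, 6, 14]) (Branch 17 (Leaf [6, 17, 4, 14, 16]) (Branch 29
    (Leaf [4, 29, 6, 14, 16]) (Leaf [27, 32, 17, 19, 29]))))) (Branch 21 (Branch 32
    (Leaf [21, 32, 4, 11, 14]) (Branch 29 (Leaf [4, 29, 11, 14, 21]) (Leaf [3, 8, 6, 29, 32])))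
    (Leaf [18, 24, 3, 6, 21]))) (Branch 27 (Branch 35 (Branch 6 (Leaf [16, 27, 6, 9, 35])
    (Branch 17 (Leaf [16, 27, 9, 17, 35]) (Leaf [6, 17, 7, 14, 24]))) (Leaf [1, 12, 2, 14, 35]))
    (Leaf [3, 14, 1, 24, 27])))))) (Branch 29 (Branch 8 (Branch 6 (Branch 26
    (Leaf [6, 26, 5, 8, 29]) (Leaf [1, 26, 3, 16, 18])) (Leaf [1, 6, 3, 16, 18]))
    (Leaf [3, 8, 1, 16, 18])) (Leaf [18, 29, 1, 3, 16]))) (Branch 29 (Branch 8 (Branch 26
    (Leaf [26, 31, 5, 8, 29]) (Leaf [1, 26, 3, 11, 18])) (Leaf [3, 8, 1, 11, 18]))
    (Leaf [18, 29, 1, 3, 11]))))) (Branch 10 (Branch 21 (Branch 19 (Branch 11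
    (Leaf [4, 9, 11, 19, 21]) (Branch 18 (Leaf [0, 20, 18, 19, 21]) (Branch 29 (Branch 16
    (Branch 8 (Branch 26 (Leaf [9, 29, 8, 16, 26]) (Leaf [1, 26, 3, 11, 18]))
    (Leaf [3, 8, 1, 11, 18])) (Leaf [11, 16, 1, 3, 18])) (Leaf [18, 29, 1, 3, 11])))) (Branch 14
    (Branch 29 (Branch 22 (Leaf [4, 29, 14, 21, 22]) (Branch 8 (Leaf [10, 21, 0, 8, 29])
    (Branch 6 (Leaf [4, 29, 6, 14, 21]) (Branch 16 (Branch 11 (Leaf [4, 29, 11, 14, 21])
    (Branch 24 (Branch 34 (Branch 26 (Leaf [24, 29, 14, 16, 26]) (Branch 13
    (Leaf [10, 21, 0, 13, 34]) (Leaf [1, 26, 3, 11, 13]))) (Leaf [8, 19, 1, 11, 34]))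
    (Leaf [11, 22, 1, 3, 24]))) (Leaf [6, 31, 8, 16, 23]))))) (Leaf [2, 29, 12, 19, 31]))
    (Leaf [14, 19, 2, 12, 31]))) (Leaf [3, 23, 2, 21, 31])) (Leaf [3, 12, 2, 10, 31])))
    (Branch 10 (Branch 15 (Branch 35 (Branch 27 (Branch 8 (Leaf [9, 20, 8, 10, 27]) (Branch 17
    (Leaf [10, 35, 9, 17, 27]) (Branch 6 (Branch 24 (Leaf [24, 35, 6, 9, 27]) (Branch 14
    (Leaf [4, 35, 6, 14, 27]) (Leaf [14, 25, 7, 17, 24]))) (Leaf [7, 23, 6, 8, 25]))))
    (Branch 24 (Branch 13 (Branch 28 (Leaf [10, 15, 0, 13, 28]) (Branch 34
    (Leaf [10, 15, 0, 13, 34]) (Branch 8 (Branch 26 (Branch 18 (Leaf [15, 20, 5, 8, 18])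
    (Branch 11 (Leaf [10, 26, 8, 9, 11]) (Branch 29 (Leaf [0, 5, 8, 26, 29]) (Branch 16
    (Leaf [8, 24, 9, 16, 26]) (Branch 14 (Branch 21 (Branch 31 (Leaf [13, 24, 14, 21, 31])
    (Leaf [3, 28, 16, 18, 31])) (Leaf [3, 28, 11, 18, 21])) (Leaf [1, 12, 11, 14, 29]))))))
    (Leaf [23, 28, 2, 25, 26])) (Leaf [25, 34, 1, 8, 27])))) (Branch 26 (Branch 34
    (Leaf [0, 5, 24, 26, 34]) (Branch 8 (Branch 11 (Branch 16 (Branch 6 (Leaf [8, 24, 6, 9, 16])
    (Branch 21 (Leaf [10, 21, 8, 9, 11]) (Leaf [3, 23, 6, 13, 21]))) (Leaf [3, 34, 1, 13, 16]))
    (Leaf [3, 34, 1, 11, 13])) (Leaf [25, 34, 1, 8, 27]))) (Leaf [2, 13, 23, 25, 26])))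
    (Leaf [3, 25, 1, 24, 27]))) (Leaf [1, 12, 2, 25, 35])) (Leaf [12, 23, 2, 15, 25]))
    (Leaf [12, 23, 2, 10, 25])))) (Branch 19 (Branch 30 (Branch 27 (Branch 6
    (Leaf [19, 30, 4, 6, 27]) (Branch 17 (Leaf [19, 30, 4, 17, 27]) (Branch 24 (Branch 10
    (Branch 28 (Leaf [10, 30, 20, 27, 28]) (Branch 26 (Branch 29 (Leaf [0, 27, 19, 26, 29])
    (Branch 16 (Branch 14 (Leaf [16, 27, 14, 24, 26]) (Branch 32 (Branch 22
    (Leaf [4, 20, 19, 22, 32]) (Leaf [3, 14, 1, 22, 29])) (Leaf [6, 17, 14, 29, 32])))
    (Leaf [1, 6, 3, 16, 29]))) (Leaf [2, 7, 9, 26, 28]))) (Leaf [2, 7, 9, 10, 17]))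
    (Leaf [6, 17, 7, 9, 24])))) (Branch 24 (Branch 10 (Branch 26 (Branch 34
    (Leaf [19, 24, 0, 26, 34]) (Branch 8 (Branch 18 (Leaf [20, 26, 5, 8, 18]) (Branch 29
    (Leaf [0, 5, 8, 26, 29]) (Branch 14 (Branch 16 (Branch 6 (Leaf [14, 19, 4, 6, 16])
    (Leaf [1, 6, 3, 27, 29])) (Leaf [18, 29, 1, 3, 16])) (Leaf [1, 12, 14, 27, 29]))))
    (Leaf [9, 34, 1, 8, 27]))) (Branch 29 (Branch 8 (Branch 23 (Leaf [0, 20, 8, 10, 23])
    (Branch 11 (Leaf [0, 11, 8, 10, 29]) (Branch 28 (Branch 13 (Leaf [0, 20, 10, 13, 28])
    (Leaf [3, 23, 11, 13, 26])) (Leaf [2, 7, 9, 26, 28])))) (Leaf [7, 27, 8, 9, 26]))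
    (Leaf [1, 26, 3, 27, 29]))) (Leaf [2, 27, 9, 10, 12])) (Leaf [3, 9, 1, 24, 27])))
    (Leaf [1, 12, 2, 9, 30])) (Leaf [1, 12, 2, 9, 19]))))) (Branch 15 (Branch 26 (Branch 31
    (Branch 28 (Branch 13 (Leaf [15, 26, 0, 13, 28]) (Branch 18 (Leaf [15, 26, 0, 18, 28])
    (Branch 11 (Branch 16 (Branch 6 (Branch 9 (Leaf [11, 16, 9, 26, 28]) (Branch 29
    (Leaf [26, 31, 16, 28, 29]) (Branch 22 (Branch 12 (Branch 30 (Leaf [12, 28, 4, 11, 30])
    (Branch 19 (Leaf [11, 22, 4, 12, 19]) (Leaf [19, 30, 1, 2, 9]))) (Branch 19 (Branch 14
    (Leaf [14, 19, 4, 6, 16]) (Branch 27 (Leaf [16, 27, 4, 6, 19]) (Branch 32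
    (Leaf [16, 32, 4, 6, 19]) (Branch 17 (Leaf [6, 17, 4, 16, 19])
    (Leaf [27, 32, 14, 17, 29]))))) (Leaf [1, 12, 2, 9, 19]))) (Leaf [1, 5, 3, 22, 29]))))
    (Leaf [13, 18, 3, 5, 6])) (Leaf [13, 18, 1, 3, 16])) (Leaf [13, 18, 1, 3, 11])))) (Branch 8
    (Branch 7 (Leaf [15, 26, 0, 7, 8]) (Branch 18 (Leaf [15, 26, 0, 8, 18]) (Branch 23
    (Leaf [15, 26, 0, 8, 23]) (Branch 10 (Branch 29 (Leaf [10, 26, 0, 8, 29]) (Branch 11
    (Branch 16 (Branch 6 (Branch 22 (Branch 9 (Leaf [10, 26, 8, 9, 11]) (Branch 30 (Branch 35
    (Branch 12 (Leaf [10, 30, 12, 20, 22]) (Branch 32 (Leaf [30, 35, 20, 22, 32]) (Branch 19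
    (Branch 14 (Leaf [14, 19, 4, 6, 16]) (Branch 27 (Leaf [16, 27, 4, 6, 19]) (Branch 17
    (Leaf [6, 17, 4, 16, 19]) (Leaf [27, 32, 14, 17, 29])))) (Leaf [1, 12, 2, 9, 19]))))
    (Leaf [2, 7, 9, 28, 35])) (Leaf [2, 7, 9, 28, 30]))) (Leaf [1, 5, 3, 22, 29]))
    (Leaf [18, 29, 3, 5, 6])) (Leaf [18, 29, 1, 3, 16])) (Leaf [18, 29, 1, 3, 11]))) (Branch 25
    (Branch 11 (Branch 27 (Leaf [15, 26, 8, 25, 27]) (Branch 29 (Leaf [0, 11, 8, 26, 29])
    (Leaf [3, 28, 10, 27, 29]))) (Leaf [1, 10, 3, 11, 18])) (Leaf [23, 28, 2, 10, 25]))))))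
    (Branch 11 (Branch 16 (Branch 24 (Branch 9 (Leaf [11, 16, 9, 24, 26]) (Branch 23
    (Leaf [26, 31, 16, 23, 24]) (Branch 34 (Leaf [26, 31, 16, 24, 34]) (Branch 27 (Branch 30
    (Branch 12 (Leaf [11, 27, 4, 12, 30]) (Branch 6 (Branch 19 (Leaf [16, 27, 4, 6, 19])
    (Leaf [1, 12, 2, 9, 19])) (Leaf [23, 34, 5, 6, 8]))) (Leaf [1, 28, 2, 9, 30]))
    (Leaf [9, 34, 1, 8, 27]))))) (Branch 22 (Branch 25 (Branch 12 (Leaf [4, 15, 12, 22, 25])
    (Branch 32 (Leaf [4, 15, 22, 25, 32]) (Branch 6 (Branch 14 (Branch 27
    (Leaf [16, 27, 4, 6, 14]) (Branch 19 (Leaf [14, 19, 4, 6, 16]) (Branch 17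
    (Leaf [6, 17, 4, 14, 16]) (Branch 29 (Leaf [4, 29, 6, 14, 16])
    (Leaf [27, 32, 17, 19, 29]))))) (Branch 27 (Branch 35 (Leaf [4, 35, 6, 25, 27])
    (Leaf [1, 12, 2, 14, 35])) (Leaf [3, 14, 1, 24, 27]))) (Leaf [5, 32, 3, 6, 24]))))
    (Branch 27 (Branch 35 (Branch 12 (Leaf [22, 27, 12, 20, 35]) (Branch 10 (Branch 7
    (Leaf [10, 35, 7, 20, 22]) (Branch 17 (Leaf [10, 35, 17, 20, 27]) (Branch 32 (Branch 19
    (Leaf [4, 20, 19, 22, 32]) (Branch 30 (Leaf [30, 35, 20, 22, 32]) (Branch 9
    (Leaf [9, 20, 22, 32, 35]) (Leaf [19, 30, 1, 2, 9])))) (Leaf [7, 32, 17, 24, 25]))))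
    (Leaf [12, 28, 2, 10, 25]))) (Leaf [1, 28, 2, 25, 35])) (Leaf [3, 25, 1, 24, 27])))
    (Leaf [1, 5, 3, 22, 24]))) (Branch 18 (Branch 29 (Branch 19 (Leaf [18, 29, 11, 19, 26])
    (Branch 9 (Branch 34 (Branch 24 (Leaf [9, 34, 11, 24, 26]) (Branch 13
    (Leaf [0, 11, 13, 26, 34]) (Leaf [13, 24, 1, 3, 16]))) (Leaf [8, 19, 1, 16, 34]))
    (Leaf [8, 19, 1, 9, 16]))) (Leaf [3, 8, 1, 16, 29])) (Leaf [3, 8, 1, 16, 18]))) (Branch 18
    (Branch 29 (Branch 19 (Leaf [18, 29, 0, 19, 26]) (Branch 34 (Branch 13
    (Leaf [15, 26, 0, 13, 34]) (Branch 24 (Branch 16 (Branch 14 (Leaf [26, 31, 14, 16, 24])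
    (Leaf [3, 14, 1, 11, 13])) (Leaf [11, 16, 1, 3, 13])) (Leaf [13, 24, 1, 3, 11])))
    (Leaf [8, 19, 1, 11, 34]))) (Leaf [3, 8, 1, 11, 29])) (Leaf [3, 8, 1, 11, 18])))))
    (Branch 10 (Branch 12 (Branch 13 (Leaf [0, 20, 10, 12, 13]) (Leaf [2, 13, 3, 5, 31]))
    (Leaf [3, 12, 2, 5, 31])) (Leaf [5, 10, 2, 3, 31]))) (Branch 23 (Branch 28 (Branch 13
    (Leaf [23, 28, 0, 13, 15]) (Leaf [2, 13, 3, 5, 26])) (Leaf [3, 28, 2, 5, 26]))
    (Leaf [3, 23, 2, 5, 26]))) (Branch 26 (Branch 23 (Branch 28 (Branch 13
    (Leaf [23, 28, 0, 13, 26]) (Leaf [2, 13, 3, 5, 15])) (Leaf [3, 28, 2, 5, 15]))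
    (Leaf [3, 23, 2, 5, 15])) (Leaf [15, 26, 2, 3, 5])))) (Branch 19 (Branch 30 (Branch 13
    (Branch 22 (Branch 27 (Branch 5 (Branch 10 (Branch 21 (Branch 6 (Leaf [21, 27, 4, 6, 19])
    (Branch 7 (Leaf [5, 19, 4, 7, 22]) (Branch 17 (Leaf [19, 30, 4, 17, 27]) (Branch 11
    (Leaf [11, 22, 4, 19, 21]) (Branch 32 (Leaf [21, 32, 4, 19, 22]) (Branch 14
    (Leaf [14, 19, 4, 21, 22]) (Branch 29 (Branch 8 (Leaf [0, 27, 8, 10, 29]) (Branch 34
    (Branch 15 (Leaf [0, 5, 13, 15, 34]) (Leaf [2, 7, 14, 15, 17])) (Leaf [1, 32, 8, 11, 34])))
    (Leaf [3, 14, 6, 29, 32])))))))) (Leaf [1, 21, 2, 3, 20])) (Leaf [1, 10, 2, 3, 20]))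
    (Leaf [1, 5, 2, 3, 20])) (Leaf [2, 27, 1, 3, 20])) (Leaf [2, 22, 1, 3, 20]))
    (Leaf [2, 13, 1, 3, 20])) (Leaf [3, 30, 1, 2, 20])) (Leaf [3, 19, 1, 2, 20]))) (Branch 20
    (Branch 14 (Branch 19 (Branch 30 (Branch 11 (Branch 16 (Branch 22 (Branch 27 (Branch 21
    (Branch 9 (Leaf [11, 22, 9, 19, 21]) (Branch 12 (Leaf [22, 27, 12, 19, 20]) (Branch 24
    (Leaf [11, 22, 14, 21, 24]) (Branch 17 (Leaf [19, 30, 17, 20, 27]) (Branch 32
    (Leaf [21, 32, 19, 20, 22]) (Branch 34 (Leaf [20, 34, 19, 21, 22]) (Branch 6 (Branch 35
    (Leaf [16, 27, 6, 14, 35]) (Leaf [1, 12, 2, 9, 35])) (Leaf [6, 17, 24, 32, 34]))))))))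
    (Leaf [1, 21, 2, 3, 4])) (Leaf [2, 27, 1, 3, 4])) (Leaf [2, 22, 1, 3, 4]))
    (Leaf [2, 16, 1, 3, 4])) (Leaf [2, 11, 1, 3, 4])) (Leaf [3, 30, 1, 2, 4]))
    (Leaf [3, 19, 1, 2, 4])) (Leaf [3, 14, 1, 2, 4])) (Leaf [4, 20, 1, 2, 3]))"

lemma certifies_cert_12: "certifies (J5_copy G36) [0] [3, 2, 1] cert_12"
  unfolding cert_12_def G36_def by (simp add: adjacent_diff_graph diff_adj_def distances_36_def)

definition cert_G36 :: split_tree where
  "cert_G36 =
    Branch 1 (Branch 2 cert_0 (Branch 3 cert_1 (Branch 4 (Branch 5 cert_2 cert_3) cert_4)))
    (Branch 2 (Branch 3 cert_5 (Branch 4 (Branch 19 cert_6 (Branch 29 cert_7 cert_8)) cert_9))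
    (Branch 3 (Branch 4 cert_10 cert_11) cert_12))"

lemma certifies_cert_G36: "certifies (J5_copy G36) [0] [] cert_G36"
  unfolding cert_G36_def
  by (simp only: certifies.simps(2) simp_thms
      certifies_cert_0 certifies_cert_1 certifies_cert_2 certifies_cert_3 certifies_cert_4
      certifies_cert_5 certifies_cert_6 certifies_cert_7 certifies_cert_8 certifies_cert_9
      certifies_cert_10 certifies_cert_11 certifies_cert_12)

lemma G36_arrows_J5: "vertex_arrows G36 (J 5) (J 5)"
  by (rule vertex_arrows_J5_if_certifies[OF simple_graph_G36 _ certifies_cert_G36])
    (simp add: G36_def diff_graph_def)

theorem mainTheorem5:
  shows "(\<exists>G. simple_graph G \<and> \<not> contains G (complete 5) \<and> vertex_arrows G (J 5) (J 5))
         \<and> Fv (J 5) (J 5) 5 \<le> 36"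
proof
  show "\<exists>G. simple_graph G \<and> \<not> contains G (complete 5) \<and> vertex_arrows G (J 5) (J 5)"
    using simple_graph_G36 G36_K5_free G36_arrows_J5 by blast
  have "card (fst G36) = 36"
    by (simp add: G36_def diff_graph_def)
  then show "Fv (J 5) (J 5) 5 \<le> 36"
    unfolding Fv_def using simple_graph_G36 G36_K5_free G36_arrows_J5 by (intro Least_le) blast
qed

end
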